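(* Let $\mathcal{A}$ be an ergodic algebra with mean value on $\mathbb{R}^d$ and let $A=A(y)\in L^\infty(\mathbb{R}^d)^{d\times d}$ be a symmetric matrix with $A\in(B^2_{\mathcal{A}}(\mathbb{R}^d))^{d\times d}$ and, for some constants $\alpha,\beta>0$, $\alpha|\lambda|^2\le A(y)\lambda\cdot\lambda\le\beta|\lambda|^2$ for all $\lambda\in\mathbb{R}^d$ and a.e. $y\in\mathbb{R}^d$. For $R\ge1$ and $1\le j\le d$ let $\chi_{j,R}\in H^1_0(Q_R)$ be the unique solution of $$-\nabla_y\cdot\big(A(e_j+\nabla_y\chi_{j,R})\big)=0\ \text{ in }Q_R,$$ set $\chi_R=(\chi_{j,R})_{1\le j\le d}$ and $$A^*_R=\frac1{|Q_R|}\int_{Q_R}A(y)(I+\nabla_y\chi_R(y))\,dy .$$ Then the generalized sequence of matrices $A^*_R$ converges, as $R\to\infty$, to the homogenized matrix $A^*=M(A(I+\nabla_y\chi))$, where $\chi$ is the corrector associated with $A$.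
   Context: $Q_R$ is the closed cube in $\mathbb{R}^d$ centred at the origin with side length $R$; $e_j$ is the $j$-th canonical basis vector, $I$ the $d\times d$ identity; $\nabla_y\chi_R$ has $j$-th column $\nabla_y\chi_{j,R}$ (similarly for $\nabla_y\chi$). An algebra with mean value on $\mathbb{R}^d$ is a closed subalgebra $\mathcal{A}$ of the algebra $\mathrm{BUC}(\mathbb{R}^d)$ of bounded uniformly continuous real-valued functions (sup norm) which contains the constants, is translation invariant, and each of whose elements $u$ has a mean value: $u(\cdot/\varepsilon)$ converges weakly-$*$ in $L^\infty(\mathbb{R}^d)$, as $\varepsilon\to0$, to a real constant $M(u)$; then $M(u)=\lim_{R\to\infty}\frac1{|B_R|}\int_{B_R}u\,dy$. For $1\le p<\infty$ and $u\in L^p_{loc}(\mathbb{R}^d)$, $\|u\|_p:=\big(\limsup_{R\to\infty}\frac1{|B_R|}\int_{B_R}|u|^p\,dy\big)^{1/p}$, and $B^p_{\mathcal{A}}(\mathbb{R}^d)$ is the closure of $\mathcal{A}$ in $\{u\in L^p_{loc}(\mathbb{R}^d):\|u\|_p<\infty\}$ for $\|\cdot\|_p$; $M$ extends by continuity to $B^p_{\mathcal{A}}(\mathbb{R}^d)$. $\mathcal{A}$ is ergodic if, whenever $u\in B^p_{\mathcal{A}}(\mathbb{R}^d)$ satisfies $\|u(\cdot+y)-u\|_p=0$ for every $y$, there is a constant $c$ with $\|u-c\|_p=0$. Corrector: $\chi=(\chi_j)_{1\le j\le d}$, where $\chi_j\in H^1_{loc}(\mathbb{R}^d)$ is the unique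 (up to an additive constant) function with $\nabla_y\chi_j\in B^2_{\mathcal{A}}(\mathbb{R}^d)^d$, $M(\nabla_y\chi_j)=0$ and $\nabla_y\cdot(A(e_j+\nabla_y\chi_j))=0$ in $\mathbb{R}^d$ in the sense of distributions. *)

theory Defs
  imports "HOL-Analysis.Analysis"
begin

text \<open>
  The space is \<open>real ^ 'n\<close>, so the dimension is \<open>CARD('n)\<close>. Functions defined almost
  everywhere are represented by Lebesgue measurable functions on the whole space; a function
  attached to a set \<open>S\<close> is only ever evaluated on \<open>S\<close>, its values elsewhere are irrelevant.
\<close>

definition Lp_on :: "real \<Rightarrow> (real ^ 'n) set \<Rightarrow> (real ^ 'n \<Rightarrow> 'b::euclidean_space) \<Rightarrow> bool" where
  "Lp_on p S f \<longleftrightarrow> set_borel_measurable lebesgue S f \<and>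
     set_integrable lebesgue S (\<lambda>x. norm (f x) powr p)"

definition Lp_loc :: "real \<Rightarrow> (real ^ 'n) set \<Rightarrow> (real ^ 'n \<Rightarrow> 'b::euclidean_space) \<Rightarrow> bool" where
  "Lp_loc p \<Omega> f \<longleftrightarrow> (\<forall>K. compact K \<and> K \<subseteq> \<Omega> \<longrightarrow> Lp_on p K f)"

definition Linf :: "(real ^ 'n \<Rightarrow> 'b::euclidean_space) \<Rightarrow> bool" where
  "Linf f \<longleftrightarrow> f \<in> borel_measurable lebesgue \<and> (\<exists>C. AE x in lebesgue. norm (f x) \<le> C)"


subsection \<open>Algebras with mean value\<close>

definition BUC :: "(real ^ 'n \<Rightarrow> real) set" where
  "BUC = {u. bounded (range u) \<and> uniformly_continuous_on UNIV u}"

text \<open>Weak-* convergence in \<open>L\<^sup>\<infinity>\<close> is tested against all of \<open>L\<^sup>1\<close>.\<close>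

definition has_mean_value :: "(real ^ 'n \<Rightarrow> real) \<Rightarrow> real \<Rightarrow> bool" where
  "has_mean_value u m \<longleftrightarrow>
     (\<forall>\<phi>. integrable lebesgue \<phi> \<longrightarrow>
        ((\<lambda>\<epsilon>. LINT x|lebesgue. u (x /\<^sub>R \<epsilon>) * \<phi> x) \<longlongrightarrow> (LINT x|lebesgue. m * \<phi> x)) (at_right 0))"

definition mean_value :: "(real ^ 'n \<Rightarrow> real) \<Rightarrow> real" where
  "mean_value u = (THE m. has_mean_value u m)"

definition algebra_wmv :: "(real ^ 'n \<Rightarrow> real) set \<Rightarrow> bool" where
  "algebra_wmv \<A> \<longleftrightarrow>
     \<A> \<subseteq> BUC \<and>
     (\<forall>u\<in>\<A>. \<forall>v\<in>\<A>. (\<lambda>x. u x + v x) \<in> \<A>) \<and>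
     (\<forall>u\<in>\<A>. \<forall>c. (\<lambda>x. c * u x) \<in> \<A>) \<and>
     (\<forall>u\<in>\<A>. \<forall>v\<in>\<A>. (\<lambda>x. u x * v x) \<in> \<A>) \<and>
     (\<forall>f u. (\<forall>n. f n \<in> \<A>) \<and> uniform_limit UNIV f u sequentially \<longrightarrow> u \<in> \<A>) \<and>
     (\<forall>c. (\<lambda>x. c) \<in> \<A>) \<and>
     (\<forall>u\<in>\<A>. \<forall>a. (\<lambda>x. u (x + a)) \<in> \<A>) \<and>
     (\<forall>u\<in>\<A>. \<exists>m. has_mean_value u m)"


subsection \<open>Besicovitch spaces\<close>

definition limsup_mean_power :: "real \<Rightarrow> (real ^ 'n \<Rightarrow> real) \<Rightarrow> ereal" where
  "limsup_mean_power p u =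
     Limsup at_top (\<lambda>R. ereal ((1 / measure lebesgue (ball (0 :: real ^ 'n) R)) *
       (LINT y:ball 0 R|lebesgue. \<bar>u y\<bar> powr p)))"

definition finite_seminorm_space :: "real \<Rightarrow> (real ^ 'n \<Rightarrow> real) set" where
  "finite_seminorm_space p = {u. Lp_loc p UNIV u \<and> limsup_mean_power p u < \<infinity>}"

text \<open>
  The seminorm is real-valued, so it is the intended one only on \<open>finite_seminorm_space p\<close>
  (\<open>real_of_ereal \<infinity> = 0\<close>). It is applied below only to elements of that space.
\<close>

definition seminorm_p :: "real \<Rightarrow> (real ^ 'n \<Rightarrow> real) \<Rightarrow> real" where
  "seminorm_p p u = real_of_ereal (limsup_mean_power p u) powr (1 / p)"

definition besicovitch :: "real \<Rightarrow> (real ^ 'n \<Rightarrow> real) set \<Rightarrow> (real ^ 'n \<Rightarrow> real) set" where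
  "besicovitch p \<A> =
     {u \<in> finite_seminorm_space p. \<forall>\<epsilon>>0. \<exists>v\<in>\<A>. seminorm_p p (\<lambda>x. u x - v x) < \<epsilon>}"

text \<open>Extension of \<^const>\<open>mean_value\<close> from \<open>\<A>\<close> to \<open>besicovitch p \<A>\<close> by continuity.\<close>

definition mean_ext :: "real \<Rightarrow> (real ^ 'n \<Rightarrow> real) set \<Rightarrow> (real ^ 'n \<Rightarrow> real) \<Rightarrow> real" where
  "mean_ext p \<A> u =
     (THE m. \<forall>v. (\<forall>n. v n \<in> \<A>) \<and> (\<lambda>n. seminorm_p p (\<lambda>x. v n x - u x)) \<longlonglongrightarrow> 0
        \<longrightarrow> (\<lambda>n. mean_value (v n)) \<longlonglongrightarrow> m)"

definition ergodic :: "real \<Rightarrow> (real ^ 'n \<Rightarrow> real) set \<Rightarrow> bool" where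
  "ergodic p \<A> \<longleftrightarrow>
     (\<forall>u\<in>besicovitch p \<A>. (\<forall>a. seminorm_p p (\<lambda>x. u (x + a) - u x) = 0)
        \<longrightarrow> (\<exists>c. seminorm_p p (\<lambda>x. u x - c) = 0))"


subsection \<open>Test functions and Sobolev spaces\<close>

definition grad :: "(real ^ 'n \<Rightarrow> real) \<Rightarrow> real ^ 'n \<Rightarrow> real ^ 'n" where
  "grad f x = (\<chi> i. frechet_derivative f (at x) (axis i 1))"

primrec times_cont_diff :: "nat \<Rightarrow> (real ^ 'n \<Rightarrow> real) \<Rightarrow> bool" where
  "times_cont_diff 0 f \<longleftrightarrow> continuous_on UNIV f"
| "times_cont_diff (Suc k) f \<longleftrightarrow>
     (\<forall>x. f differentiable (at x)) \<and> (\<forall>i. times_cont_diff k (\<lambda>x. grad f x $ i))"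

definition test_functions :: "(real ^ 'n) set \<Rightarrow> (real ^ 'n \<Rightarrow> real) set" where
  "test_functions \<Omega> = {\<phi>. (\<forall>k. times_cont_diff k \<phi>) \<and>
     compact (closure {x. \<phi> x \<noteq> 0}) \<and> closure {x. \<phi> x \<noteq> 0} \<subseteq> \<Omega>}"

definition has_weak_gradient ::
  "(real ^ 'n) set \<Rightarrow> (real ^ 'n \<Rightarrow> real) \<Rightarrow> (real ^ 'n \<Rightarrow> real ^ 'n) \<Rightarrow> bool" where
  "has_weak_gradient \<Omega> u G \<longleftrightarrow> Lp_loc 1 \<Omega> u \<and> Lp_loc 1 \<Omega> G \<and>
     (\<forall>\<phi>\<in>test_functions \<Omega>.
        (LINT x:\<Omega>|lebesgue. u x *\<^sub>R grad \<phi> x) = - (LINT x:\<Omega>|lebesgue. \<phi> x *\<^sub>R G x))"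

text \<open>The weak gradient is determined almost everywhere; a representative is chosen.\<close>

definition weak_gradient ::
  "(real ^ 'n) set \<Rightarrow> (real ^ 'n \<Rightarrow> real) \<Rightarrow> real ^ 'n \<Rightarrow> real ^ 'n" where
  "weak_gradient \<Omega> u = (SOME G. has_weak_gradient \<Omega> u G)"

definition H1 :: "(real ^ 'n) set \<Rightarrow> (real ^ 'n \<Rightarrow> real) set" where
  "H1 \<Omega> = {u. Lp_on 2 \<Omega> u \<and> (\<exists>G. has_weak_gradient \<Omega> u G) \<and> Lp_on 2 \<Omega> (weak_gradient \<Omega> u)}"

definition H1_loc :: "(real ^ 'n \<Rightarrow> real) set" where
  "H1_loc = {u. Lp_loc 2 UNIV u \<and> (\<exists>G. has_weak_gradient UNIV u G) \<and>
     Lp_loc 2 UNIV (weak_gradient UNIV u)}"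

text \<open>Closure of the test functions in \<open>H\<^sup>1(\<Omega>)\<close>.\<close>

definition H1_0 :: "(real ^ 'n) set \<Rightarrow> (real ^ 'n \<Rightarrow> real) set" where
  "H1_0 \<Omega> = {u \<in> H1 \<Omega>. \<exists>\<phi>. (\<forall>n. \<phi> n \<in> test_functions \<Omega>) \<and>
     (\<lambda>n. (LINT x:\<Omega>|lebesgue. (u x - \<phi> n x)\<^sup>2) +
          (LINT x:\<Omega>|lebesgue. (norm (weak_gradient \<Omega> u x - grad (\<phi> n) x))\<^sup>2)) \<longlonglongrightarrow> 0}"

definition distr_div_free :: "(real ^ 'n) set \<Rightarrow> (real ^ 'n \<Rightarrow> real ^ 'n) \<Rightarrow> bool" where
  "distr_div_free \<Omega> F \<longleftrightarrow>
     (\<forall>\<phi>\<in>test_functions \<Omega>. (LINT x:\<Omega>|lebesgue. F x \<bullet> grad \<phi> x) = 0)"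


subsection \<open>Correctors and homogenized matrices\<close>

definition is_corrector ::
  "(real ^ 'n \<Rightarrow> real) set \<Rightarrow> (real ^ 'n \<Rightarrow> real ^ 'n ^ 'n) \<Rightarrow> 'n \<Rightarrow> (real ^ 'n \<Rightarrow> real) \<Rightarrow> bool" where
  "is_corrector \<A> A j u \<longleftrightarrow> u \<in> H1_loc \<and>
     (\<forall>i. (\<lambda>y. weak_gradient UNIV u y $ i) \<in> besicovitch 2 \<A>) \<and>
     (\<forall>i. mean_ext 2 \<A> (\<lambda>y. weak_gradient UNIV u y $ i) = 0) \<and>
     distr_div_free UNIV (\<lambda>y. A y *v (axis j 1 + weak_gradient UNIV u y))"

definition cube :: "real \<Rightarrow> (real ^ 'n) set" where
  "cube R = cbox (\<chi> i. - R / 2) (\<chi> i. R / 2)"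

text \<open>Sobolev spaces and distributions on the closed cube are those of its interior.\<close>

definition solves_cube_problem ::
  "(real ^ 'n \<Rightarrow> real ^ 'n ^ 'n) \<Rightarrow> real \<Rightarrow> 'n \<Rightarrow> (real ^ 'n \<Rightarrow> real) \<Rightarrow> bool" where
  "solves_cube_problem A R j u \<longleftrightarrow> u \<in> H1_0 (interior (cube R)) \<and>
     distr_div_free (interior (cube R))
       (\<lambda>y. A y *v (axis j 1 + weak_gradient (interior (cube R)) u y))"

definition grad_matrix ::
  "(real ^ 'n) set \<Rightarrow> ('n \<Rightarrow> real ^ 'n \<Rightarrow> real) \<Rightarrow> real ^ 'n \<Rightarrow> real ^ 'n ^ 'n" where
  "grad_matrix \<Omega> u y = (\<chi> i j. weak_gradient \<Omega> (u j) y $ i)"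

definition approx_hom_matrix ::
  "(real ^ 'n \<Rightarrow> real ^ 'n ^ 'n) \<Rightarrow> real \<Rightarrow> ('n \<Rightarrow> real ^ 'n \<Rightarrow> real) \<Rightarrow> real ^ 'n ^ 'n" where
  "approx_hom_matrix A R u = (1 / measure lebesgue (cube R :: (real ^ 'n) set)) *\<^sub>R
     (LINT y:cube R|lebesgue. A y ** (mat 1 + grad_matrix (interior (cube R)) u y))"

definition hom_matrix ::
  "(real ^ 'n \<Rightarrow> real) set \<Rightarrow> (real ^ 'n \<Rightarrow> real ^ 'n ^ 'n) \<Rightarrow> ('n \<Rightarrow> real ^ 'n \<Rightarrow> real) \<Rightarrow> real ^ 'n ^ 'n" where
  "hom_matrix \<A> A u =
     (\<chi> i j. mean_ext 2 \<A> (\<lambda>y. (A y ** (mat 1 + grad_matrix UNIV u y)) $ i $ j))"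

end

theory Submission
  imports Defs
begin

text \<open>
  Write \<open>p\<^sub>j = e\<^sub>j + \<nabla>\<chi>\<^sub>j\<close> and \<open>p\<^sub>j\<^sub>R = e\<^sub>j + \<nabla>\<chi>\<^sub>j\<^sub>R\<close>. Since \<open>A\<close> is symmetric and \<open>A p\<^sub>i\<close> is divergence free,
  \<open>\<integral> A (p\<^sub>j\<^sub>R - p\<^sub>j) \<bullet> e\<^sub>i = - \<integral> A p\<^sub>i \<bullet> \<nabla>\<chi>\<^sub>j - \<integral> A (p\<^sub>j\<^sub>R - p\<^sub>j) \<bullet> \<nabla>\<chi>\<^sub>i\<close> over \<open>Q\<^sub>R\<close>, and both integrals on
  the right pair a divergence free field \<open>F\<close> on \<open>Q\<^sub>R\<close> of bounded mean energy with a gradient \<open>\<nabla>\<chi>\<close> whose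
  components lie in the Besicovitch space and have mean value zero. Such pairings are \<open>o(|Q\<^sub>R|)\<close>: one tests
  \<open>F\<close> with \<open>\<eta> (\<psi> - \<psi> * \<rho>\<^sub>s)\<close>, where \<open>\<psi> = \<chi> * \<rho>\<^sub>r\<close> with \<open>r\<close> small and fixed, \<open>s = \<delta> R\<close>, and \<open>\<eta>\<close> is a
  cutoff of \<open>Q\<^sub>R\<close>. No compactness theorem is needed: \<open>\<psi> - \<psi> * \<rho>\<^sub>s\<close> is of size \<open>\<delta> R\<close> by a translation
  estimate, and \<open>\<nabla>\<psi> * \<rho>\<^sub>s\<close> tends to the mean value zero.
\<close>


subsection \<open>Test functions\<close>

text \<open>Only \<open>\<nabla>\<chi>\<close> is under control: no growth bound on
  \<open>\<chi>\<close> is given, so testing with \<open>\<eta> \<chi>\<close> would leave the term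
  \<open>\<chi> \<nabla>\<eta>\<close> unestimated. Subtracting a local average replaces such a
  bound: \<open>\<nabla>\<eta>\<close> is of order \<open>1 / R\<close>, so a difference of size
  \<open>\<delta> R\<close> costs only \<open>\<delta>\<close> per unit volume. In return a smoothed
  gradient appears; as its scale is proportional to \<open>R\<close>, dilating the cube to unit size
  freezes the kernel, and the weak-* definition of the mean value applies directly. The scale
  \<open>r\<close> serves to produce a smooth function from \<open>\<chi>\<close>. One of the two
  fields paired with gradients, \<open>A (p\<^sub>j\<^sub>R - p\<^sub>j)\<close>, changes with
  \<open>R\<close>. The pairing estimate must therefore hold for all fields of given mean energy
  beyond a common threshold for \<open>R\<close>. This fixes the order of choices: approximants in
  the algebra, cutoff, \<open>\<delta>\<close>, \<open>r\<close>, and only then \<open>R\<close> and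
  the field. The limit is identified through averages of \<open>A p\<^sub>j\<close> over cubes,
  which converge to the extended mean value.\<close>

lemma has_derivative_grad:
  fixes f :: "real ^ 'n \<Rightarrow> real"
  assumes "f differentiable (at x)"
  shows "(f has_derivative (\<lambda>h. grad f x \<bullet> h)) (at x)"
proof -
  let ?D = "frechet_derivative f (at x)"
  have D: "(f has_derivative ?D) (at x)"
    using assms frechet_derivative_works by blast
  then have lin: "linear ?D" by (rule has_derivative_linear)
  have "?D h = grad f x \<bullet> h" for h
  proof -
    have "?D h = ?D (\<Sum>i\<in>UNIV. h $ i *\<^sub>R axis i 1)"
      using basis_expansion[of h] by (simp add: scalar_mult_eq_scaleR)
    also have "\<dots> = (\<Sum>i\<in>UNIV. h $ i *\<^sub>R ?D (axis i 1))"
      by (simp add: linear_sum[OF lin] linear_scale[OF lin] o_def)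
    finally show ?thesis by (simp add: grad_def inner_vec_def mult.commute)
  qed
  then show ?thesis using D by (metis (no_types, lifting) ext)
qed

lemma grad_eqI:
  fixes f :: "real ^ 'n \<Rightarrow> real"
  assumes "(f has_derivative (\<lambda>h. G \<bullet> h)) (at x)"
  shows "grad f x = G"
proof -
  have "frechet_derivative f (at x) = (\<lambda>h. G \<bullet> h)"
    using frechet_derivative_at[OF assms] by simp
  then show ?thesis by (simp add: grad_def inner_axis vec_eq_iff)
qed

lemma times_cont_diff_SucI:
  fixes f :: "real ^ 'n \<Rightarrow> real"
  assumes "\<And>x. (f has_derivative (\<lambda>h. G x \<bullet> h)) (at x)"
    and "\<And>i. times_cont_diff k (\<lambda>x. G x $ i)"
  shows "times_cont_diff (Suc k) f"
proof -
  have "grad f = G" using grad_eqI assms(1) by blast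
  moreover have "\<forall>x. f differentiable (at x)"
    using assms(1) differentiableI by blast
  ultimately show ?thesis using assms(2) by simp
qed

lemma times_cont_diff_SucD:
  fixes f :: "real ^ 'n \<Rightarrow> real"
  shows "times_cont_diff (Suc k) f \<Longrightarrow> times_cont_diff k f"
proof (induction k arbitrary: f)
  case 0
  then show ?case
    by (auto intro!: differentiable_imp_continuous_on simp: differentiable_on_def differentiable_at_withinI)
next
  case (Suc k)
  then show ?case using times_cont_diff.simps(2) by blast
qed

lemma times_cont_diff_const: "times_cont_diff k (\<lambda>x :: real ^ 'n. c)"
proof (induction k arbitrary: c)
  case (Suc k)
  show ?case
    by (rule times_cont_diff_SucI[where G = "\<lambda>_. 0"]) (auto intro: Suc)
qed simp

lemma times_cont_diff_add:
  fixes f g :: "real ^ 'n \<Rightarrow> real"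
  shows "times_cont_diff k f \<Longrightarrow> times_cont_diff k g \<Longrightarrow> times_cont_diff k (\<lambda>x. f x + g x)"
proof (induction k arbitrary: f g)
  case (Suc k)
  show ?case
  proof (rule times_cont_diff_SucI[where G = "\<lambda>x. grad f x + grad g x"])
    show "((\<lambda>x. f x + g x) has_derivative (\<lambda>h. (grad f x + grad g x) \<bullet> h)) (at x)" for x
      using Suc.prems
      by (auto simp: inner_add_left intro!: has_derivative_add has_derivative_grad)
  qed (use Suc in auto)
qed (auto intro: continuous_on_add)

lemma times_cont_diff_mult:
  fixes f g :: "real ^ 'n \<Rightarrow> real"
  shows "times_cont_diff k f \<Longrightarrow> times_cont_diff k g \<Longrightarrow> times_cont_diff k (\<lambda>x. f x * g x)"
proof (induction k arbitrary: f g)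
  case (Suc k)
  show ?case
  proof (rule times_cont_diff_SucI[where G = "\<lambda>x. f x *\<^sub>R grad g x + g x *\<^sub>R grad f x"])
    show "((\<lambda>x. f x * g x) has_derivative (\<lambda>h. (f x *\<^sub>R grad g x + g x *\<^sub>R grad f x) \<bullet> h)) (at x)" for x
      using Suc.prems has_derivative_mult[OF has_derivative_grad has_derivative_grad, of f x g]
      by (simp add: algebra_simps inner_add_left)
    show "times_cont_diff k (\<lambda>x. (f x *\<^sub>R grad g x + g x *\<^sub>R grad f x) $ i)" for i
      using Suc times_cont_diff_SucD[of k f] times_cont_diff_SucD[of k g]
      by (auto intro!: times_cont_diff_add)
  qed
qed (auto intro: continuous_on_mult)

lemma times_cont_diff_nth: "times_cont_diff k (\<lambda>x :: real ^ 'n. x $ i)"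
proof (cases k)
  case (Suc l)
  show ?thesis unfolding Suc
  proof (rule times_cont_diff_SucI[where G = "\<lambda>_. axis i 1"])
    show "((\<lambda>x. x $ i) has_derivative (\<lambda>h. axis i 1 \<bullet> h)) (at x)" for x :: "real ^ 'n"
      using bounded_linear_imp_has_derivative[OF bounded_linear_vec_nth, of i "at x"]
      by (simp add: inner_axis' )
  qed (rule times_cont_diff_const)
qed (auto intro!: continuous_intros)

lemma times_cont_diff_affine:
  fixes f :: "real ^ 'n \<Rightarrow> real"
  shows "times_cont_diff k f \<Longrightarrow> times_cont_diff k (\<lambda>x. f (c *\<^sub>R x + a))"
proof (induction k arbitrary: f)
  case 0
  then show ?case by (auto intro!: continuous_on_compose2[of UNIV f] continuous_intros)
next
  case (Suc k)
  show ?case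
  proof (rule times_cont_diff_SucI[where G = "\<lambda>x. c *\<^sub>R grad f (c *\<^sub>R x + a)"])
    show "((\<lambda>x. f (c *\<^sub>R x + a)) has_derivative (\<lambda>h. c *\<^sub>R grad f (c *\<^sub>R x + a) \<bullet> h)) (at x)" for x
    proof -
      have "((\<lambda>x. c *\<^sub>R x + a) has_derivative (\<lambda>h. c *\<^sub>R h)) (at x)"
        by (auto intro!: derivative_eq_intros)
      from has_derivative_compose[OF this has_derivative_grad] Suc.prems show ?thesis
        by simp
    qed
    show "times_cont_diff k (\<lambda>x. (c *\<^sub>R grad f (c *\<^sub>R x + a)) $ i)" for i
      using Suc by (auto intro!: times_cont_diff_mult times_cont_diff_const)
  qed
qed

text \<open>The classical flat function \<open>exp (- 1 / t)\<close>, enlarged to a family by the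
  factor \<open>1 / t ^ m\<close>: derivatives of members are linear combinations of members, so
  smoothness can be proved by induction with \<open>m\<close> generalised.\<close>

definition exp_cutoff :: "nat \<Rightarrow> real \<Rightarrow> real" where
  "exp_cutoff m t = (if t \<le> 0 then 0 else exp (- 1 / t) / t ^ m)"

lemma exp_cutoff_nonneg: "exp_cutoff m t \<ge> 0"
  by (simp add: exp_cutoff_def)

text \<open>The exponential beats every power: this is \<open>(1 + x / n) ^ n \<le> exp x\<close> at
  \<open>x = 1 / t\<close> with \<open>n = m + 2\<close>. The two powers of \<open>t\<close> beyond
  \<open>m\<close> are what differentiability at 0 requires.\<close>

lemma exp_cutoff_le:
  "exp_cutoff m t \<le> real (m + 2) ^ (m + 2) * t\<^sup>2"
proof (cases "t > 0")
  case True
  let ?n = "m + 2"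
  have "(1 / t / real ?n) ^ ?n \<le> (1 + 1 / t / real ?n) ^ ?n"
    using True by (intro power_mono) auto
  also have "\<dots> \<le> exp (1 / t)"
    using True by (intro exp_ge_one_plus_x_over_n_power_n) (auto intro: order_trans[of _ 0])
  finally have *: "(1 / t / real ?n) ^ ?n \<le> exp (1 / t)" .
  have "1 = (1 / t / real ?n) ^ ?n * (real ?n * t) ^ ?n"
    unfolding power_mult_distrib[symmetric] using True by simp
  also have "\<dots> \<le> exp (1 / t) * (real ?n * t) ^ ?n"
    using True by (intro mult_right_mono *) auto
  finally have "1 \<le> exp (1 / t) * (real ?n ^ ?n * t ^ ?n)"
    by (simp only: power_mult_distrib)
  then have "exp (- 1 / t) \<le> real ?n ^ ?n * t ^ ?n"
    by (simp add: exp_minus field_simps)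
  then have "exp (- 1 / t) / t ^ m \<le> real ?n ^ ?n * t ^ ?n / t ^ m"
    using True by (intro divide_right_mono) auto
  also have "\<dots> = real ?n ^ ?n * t\<^sup>2"
    using True by (simp add: power_add power2_eq_square)
  finally show ?thesis using True by (simp add: exp_cutoff_def)
qed (auto simp: exp_cutoff_def intro!: mult_nonneg_nonneg)

lemma exp_cutoff_DERIV:
  "(exp_cutoff m has_real_derivative (exp_cutoff (m + 2) t - real m * exp_cutoff (m + 1) t)) (at t)"
proof -
  consider "t > 0" | "t < 0" | "t = 0" by linarith
  then show ?thesis
  proof cases
    case 1
    have exp': "((\<lambda>t. exp (- 1 / t)) has_real_derivative exp (- 1 / t) / t\<^sup>2) (at t)"
      using 1 by (auto intro!: derivative_eq_intros simp: power2_eq_square)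
    have "((\<lambda>t. exp (- 1 / t) / t ^ m) has_real_derivative
        (exp_cutoff (m + 2) t - real m * exp_cutoff (m + 1) t)) (at t)"
    proof (cases m)
      case (Suc k)
      show ?thesis unfolding Suc
        by (rule DERIV_cong[OF DERIV_divide[OF exp' DERIV_power_Suc[OF DERIV_ident]]])
          (use 1 in \<open>auto simp: exp_cutoff_def field_simps power2_eq_square\<close>)
    qed (use exp' 1 in \<open>simp add: exp_cutoff_def power2_eq_square\<close>)
    then show ?thesis
      by (rule has_field_derivative_transform_within_open[where S = "{0<..}"])
        (use 1 in \<open>auto simp: exp_cutoff_def\<close>)
  next
    case 2
    have "((\<lambda>t. 0) has_real_derivative
        (exp_cutoff (m + 2) t - real m * exp_cutoff (m + 1) t)) (at t)"
      using 2 by (auto simp: exp_cutoff_def)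
    then show ?thesis
      by (rule has_field_derivative_transform_within_open[where S = "{..<0}"])
        (use 2 in \<open>auto simp: exp_cutoff_def\<close>)
  next
    case 3
    \<comment> \<open>At the gluing point the quadratic bound leaves a factor
      \<open>\<bar>h\<bar>\<close> in the difference quotient, from both sides at once.\<close>
    have "((\<lambda>h. exp_cutoff m h / h) \<longlongrightarrow> 0) (at 0)"
    proof (rule Lim_null_comparison)
      have "norm (exp_cutoff m h / h) \<le> real (m + 2) ^ (m + 2) * \<bar>h\<bar>" if "h \<noteq> 0" for h
        using exp_cutoff_le[of m h] exp_cutoff_nonneg[of m h] that
        by (simp add: field_simps power2_eq_square abs_mult_self_eq)
      then show "\<forall>\<^sub>F h in at 0. norm (exp_cutoff m h / h) \<le> real (m + 2) ^ (m + 2) * \<bar>h\<bar>"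
        by (auto simp: eventually_at_filter)
      show "((\<lambda>h. real (m + 2) ^ (m + 2) * \<bar>h\<bar>) \<longlongrightarrow> 0) (at 0)"
        by (rule tendsto_eq_intros refl | simp)+
    qed
    then show ?thesis unfolding 3 DERIV_def by (simp add: exp_cutoff_def)
  qed
qed

text \<open>Each gradient is \<open>x\<close> times a combination of the members
  \<open>m + 1\<close> and \<open>m + 2\<close> of the same family, so the induction closes for all
  \<open>m\<close> together.\<close>

lemma times_cont_diff_exp_cutoff:
  "times_cont_diff k (\<lambda>x :: real ^ 'n. exp_cutoff m (1 - x \<bullet> x))"
proof (induction k arbitrary: m)
  case 0
  have "continuous_on UNIV (exp_cutoff m)"
    using exp_cutoff_DERIV by (intro DERIV_continuous_on) (auto intro: DERIV_subset)
  then show ?case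
    by (auto intro!: continuous_on_compose2[of UNIV "exp_cutoff m"] continuous_intros)
next
  case (Suc k)
  show ?case
  proof (rule times_cont_diff_SucI[where G = "\<lambda>x.
      ((exp_cutoff (m + 2) (1 - x \<bullet> x) + (- real m) * exp_cutoff (m + 1) (1 - x \<bullet> x)) * (- 2)) *\<^sub>R x"])
    fix x :: "real ^ 'n"
    have "((\<lambda>x. 1 - x \<bullet> x) has_derivative (\<lambda>h. - 2 * (x \<bullet> h))) (at x)"
      by (auto intro!: derivative_eq_intros simp: inner_commute)
    from has_derivative_compose[OF this exp_cutoff_DERIV[unfolded has_field_derivative_def]]
    show "((\<lambda>x. exp_cutoff m (1 - x \<bullet> x)) has_derivative
      (\<lambda>h. (((exp_cutoff (m + 2) (1 - x \<bullet> x) + (- real m) * exp_cutoff (m + 1) (1 - x \<bullet> x)) * (- 2)) *\<^sub>R x) \<bullet> h)) (at x)"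
      by (simp add: algebra_simps)
  next
    fix i :: 'n
    show "times_cont_diff k (\<lambda>x :: real ^ 'n. (((exp_cutoff (m + 2) (1 - x \<bullet> x)
        + (- real m) * exp_cutoff (m + 1) (1 - x \<bullet> x)) * (- 2)) *\<^sub>R x) $ i)"
      unfolding vector_scaleR_component real_scaleR_def
      by (intro times_cont_diff_mult times_cont_diff_add times_cont_diff_const times_cont_diff_nth)
       (rule Suc)+
  qed
qed

lemma test_functionsI:
  fixes \<phi> :: "real ^ 'n \<Rightarrow> real"
  assumes "\<And>k. times_cont_diff k \<phi>" "compact K" "K \<subseteq> \<Omega>" "\<And>x. x \<notin> K \<Longrightarrow> \<phi> x = 0"
  shows "\<phi> \<in> test_functions \<Omega>"
proof -
  have "closure {x. \<phi> x \<noteq> 0} \<subseteq> K"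
    using assms by (intro closure_minimal) (auto intro: compact_imp_closed)
  moreover from this have "bounded {x. \<phi> x \<noteq> 0}"
    using closure_subset compact_imp_bounded[OF assms(2)] bounded_subset by (metis order_trans)
  ultimately have "compact (closure {x. \<phi> x \<noteq> 0})" "closure {x. \<phi> x \<noteq> 0} \<subseteq> \<Omega>"
    using assms(3) by (auto simp only: compact_closure)
  then show ?thesis using assms(1) unfolding test_functions_def by blast
qed

lemma test_functionsD:
  fixes \<phi> :: "real ^ 'n \<Rightarrow> real"
  assumes "\<phi> \<in> test_functions \<Omega>"
  shows "times_cont_diff k \<phi>" "continuous_on UNIV \<phi>" "\<phi> differentiable (at x)"
    "continuous_on UNIV (grad \<phi>)" "continuous_on UNIV (\<lambda>x. grad \<phi> x $ i)"
proof -
  show k: "times_cont_diff k \<phi>" for k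
    using assms by (auto simp: test_functions_def)
  from k[of 0] show "continuous_on UNIV \<phi>" by simp
  from k[of 1] show "\<phi> differentiable (at x)" "continuous_on UNIV (\<lambda>x. grad \<phi> x $ i)" for i by auto
  then have "continuous_on UNIV (\<lambda>x. \<chi> i. grad \<phi> x $ i)"
    by (intro continuous_on_vec_lambda)
  then show "continuous_on UNIV (grad \<phi>)" by simp
qed

lemma test_functions_supp:
  fixes \<phi> :: "real ^ 'n \<Rightarrow> real"
  assumes "\<phi> \<in> test_functions \<Omega>"
  obtains K where "compact K" "K \<subseteq> \<Omega>" "\<And>x. x \<notin> K \<Longrightarrow> \<phi> x = 0" "\<And>x. x \<notin> K \<Longrightarrow> grad \<phi> x = 0"
proof
  let ?K = "closure {x. \<phi> x \<noteq> 0}"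
  show "compact ?K" "?K \<subseteq> \<Omega>" using assms by (auto simp: test_functions_def)
  show "\<phi> x = 0" if "x \<notin> ?K" for x using that closure_subset[of "{x. \<phi> x \<noteq> 0}"] by auto
  show "grad \<phi> x = 0" if "x \<notin> ?K" for x
  proof (rule grad_eqI)
    have "((\<lambda>_. 0) has_derivative (\<lambda>h. 0 \<bullet> h)) (at x)" by simp
    then show "(\<phi> has_derivative (\<lambda>h. 0 \<bullet> h)) (at x)"
      by (rule has_derivative_transform_within_open[where s = "- ?K"])
        (use that closure_subset[of "{x. \<phi> x \<noteq> 0}"] in auto)
  qed
qed

lemma test_functions_mono: "\<Omega> \<subseteq> \<Omega>' \<Longrightarrow> test_functions \<Omega> \<subseteq> test_functions \<Omega>'"
  by (auto simp: test_functions_def)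

lemma grad_test_functions:
  fixes \<phi> :: "real ^ 'n \<Rightarrow> real"
  assumes "\<phi> \<in> test_functions \<Omega>"
  shows "(\<lambda>x. grad \<phi> x $ i) \<in> test_functions \<Omega>"
proof -
  obtain K where K: "compact K" "K \<subseteq> \<Omega>" "\<And>x. x \<notin> K \<Longrightarrow> grad \<phi> x = 0"
    using test_functions_supp[OF assms] by metis
  have "times_cont_diff k (\<lambda>x. grad \<phi> x $ i)" for k
    using test_functionsD(1)[OF assms, of "Suc k"] by simp
  then show ?thesis by (rule test_functionsI[OF _ K(1,2)]) (simp add: K)
qed

lemma test_functions_affine:
  fixes \<phi> :: "real ^ 'n \<Rightarrow> real"
  assumes "\<phi> \<in> test_functions UNIV" "c \<noteq> 0"
  shows "(\<lambda>x. b * \<phi> (c *\<^sub>R x + a)) \<in> test_functions UNIV"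
proof -
  obtain K where K: "compact K" "\<And>x. x \<notin> K \<Longrightarrow> \<phi> x = 0"
    using test_functions_supp[OF assms(1)] by metis
  show ?thesis
  proof (rule test_functionsI)
    show "times_cont_diff k (\<lambda>x. b * \<phi> (c *\<^sub>R x + a))" for k
      by (intro times_cont_diff_mult times_cont_diff_const times_cont_diff_affine test_functionsD(1)[OF assms(1)])
    show "compact ((\<lambda>y. (1 / c) *\<^sub>R (y - a)) ` K)"
      by (intro compact_continuous_image K continuous_intros)
    show "b * \<phi> (c *\<^sub>R x + a) = 0" if "x \<notin> (\<lambda>y. (1 / c) *\<^sub>R (y - a)) ` K" for x
    proof -
      have "c *\<^sub>R x + a \<notin> K"
      proof
        assume "c *\<^sub>R x + a \<in> K"
        moreover have "x = (1 / c) *\<^sub>R ((c *\<^sub>R x + a) - a)" using assms(2) by simp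
        ultimately show False using that by (metis (lifting) image_eqI)
      qed
      then show ?thesis using K by simp
    qed
  qed auto
qed

lemma grad_affine:
  fixes f :: "real ^ 'n \<Rightarrow> real"
  assumes "f differentiable (at (c *\<^sub>R x + a))"
  shows "grad (\<lambda>x. f (c *\<^sub>R x + a)) x = c *\<^sub>R grad f (c *\<^sub>R x + a)"
proof (rule grad_eqI)
  have "((\<lambda>x. c *\<^sub>R x + a) has_derivative (\<lambda>h. c *\<^sub>R h)) (at x)"
    by (auto intro!: derivative_eq_intros)
  from has_derivative_compose[OF this has_derivative_grad[OF assms]]
  show "((\<lambda>x. f (c *\<^sub>R x + a)) has_derivative (\<lambda>h. c *\<^sub>R grad f (c *\<^sub>R x + a) \<bullet> h)) (at x)"
    by simp
qed

lemma continuous_bounded_on_bounded_set: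
  fixes f :: "'a::heine_borel \<Rightarrow> real"
  assumes "continuous_on UNIV f" "bounded S"
  obtains C where "C > 0" "\<And>x. x \<in> S \<Longrightarrow> \<bar>f x\<bar> \<le> C"
proof -
  obtain r where r: "S \<subseteq> cball undefined r"
    using bounded_subset_ballD[OF assms(2), of undefined] ball_subset_cball by (metis order_trans)
  have "compact (f ` cball undefined r)"
    using assms by (intro compact_continuous_image) (auto intro: continuous_on_subset)
  then obtain C where "\<forall>y\<in>f ` cball undefined r. norm y \<le> C" using compact_imp_bounded bounded_iff by metis
  then show ?thesis using r by (intro that[of "max C 1"]) (auto intro: max.coboundedI1)
qed

lemma test_functions_bounded:
  fixes \<phi> :: "real ^ 'n \<Rightarrow> real"
  assumes "\<phi> \<in> test_functions \<Omega>"
  obtains B r where "B > 0" "r > 0" "\<And>x. \<bar>\<phi> x\<bar> \<le> B" "\<And>x. norm x > r \<Longrightarrow> \<phi> x = 0"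
proof -
  obtain K where K: "compact K" "\<And>x. x \<notin> K \<Longrightarrow> \<phi> x = 0"
    using test_functions_supp[OF assms(1)] by metis
  obtain r where r: "r > 0" "K \<subseteq> cball 0 r"
    using bounded_subset_ballD[OF compact_imp_bounded[OF K(1)], of 0] ball_subset_cball by (metis order_trans)
  obtain C where "C > 0" "\<And>x. x \<in> K \<Longrightarrow> \<bar>\<phi> x\<bar> \<le> C"
    using continuous_bounded_on_bounded_set[OF test_functionsD(2)[OF assms] compact_imp_bounded[OF K(1)]] by metis
  then have "\<bar>\<phi> x\<bar> \<le> C" for x using K(2) by (cases "x \<in> K") auto
  then show ?thesis using that[of C r] \<open>C > 0\<close> r K(2) by force
qed

lemma test_functions_integrable:
  fixes \<phi> :: "real ^ 'n \<Rightarrow> real"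
  assumes "\<phi> \<in> test_functions \<Omega>"
  shows "integrable lborel \<phi>"
proof -
  obtain K where K: "compact K" "\<And>x. x \<notin> K \<Longrightarrow> \<phi> x = 0"
    using test_functions_supp[OF assms(1)] by metis
  have "integrable lborel (\<lambda>x. indicator K x *\<^sub>R \<phi> x)"
    by (intro borel_integrable_compact K continuous_on_subset[OF test_functionsD(2)[OF assms]]) auto
  moreover have "(\<lambda>x. indicator K x *\<^sub>R \<phi> x) = \<phi>" using K(2) by (force simp: indicator_def)
  ultimately show ?thesis by simp
qed


subsection \<open>Square integrals and convolution\<close>

text \<open>Valued in \<open>ennreal\<close>, so that no integrability has to be known before an
  estimate; finiteness is expressed by a bound \<open>\<le> ennreal a\<close>.\<close>

definition sq_int :: "(real ^ 'n) set \<Rightarrow> (real ^ 'n \<Rightarrow> real) \<Rightarrow> ennreal" where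
  "sq_int S f = (\<integral>\<^sup>+x. indicator S x * ennreal ((f x)\<^sup>2) \<partial>lebesgue)"

lemma sq_int_mono_set: "S \<subseteq> T \<Longrightarrow> sq_int S f \<le> sq_int T f"
  unfolding sq_int_def by (intro nn_integral_mono mult_right_mono) (auto simp: indicator_def)

lemma sq_int_mono:
  "(\<And>x. x \<in> S \<Longrightarrow> \<bar>f x\<bar> \<le> \<bar>g x\<bar>) \<Longrightarrow> sq_int S f \<le> sq_int S g"
  unfolding sq_int_def
  by (intro nn_integral_mono) (auto simp: indicator_def abs_le_square_iff)

lemma sq_int_add:
  fixes f g :: "real ^ 'n \<Rightarrow> real"
  assumes [measurable]: "f \<in> borel_measurable lebesgue" "g \<in> borel_measurable lebesgue" "S \<in> sets lebesgue"
    and "sq_int S f \<le> ennreal a" "sq_int S g \<le> ennreal b" "0 \<le> a" "0 \<le> b"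
  shows "sq_int S (\<lambda>x. f x + g x) \<le> ennreal (2 * a + 2 * b)"
proof -
  have "sq_int S (\<lambda>x. f x + g x) \<le>
      (\<integral>\<^sup>+x. 2 * (indicator S x * ennreal ((f x)\<^sup>2)) + 2 * (indicator S x * ennreal ((g x)\<^sup>2)) \<partial>lebesgue)"
    unfolding sq_int_def
  proof (intro nn_integral_mono)
    fix x
    have "(f x + g x)\<^sup>2 \<le> 2 * (f x)\<^sup>2 + 2 * (g x)\<^sup>2"
      using sum_squares_bound[of "f x" "g x"] by (simp add: power2_sum)
    then have "ennreal ((f x + g x)\<^sup>2) \<le> 2 * ennreal ((f x)\<^sup>2) + 2 * ennreal ((g x)\<^sup>2)"
      by (simp flip: ennreal_plus ennreal_mult'' ennreal_numeral)
    then show "indicator S x * ennreal ((f x + g x)\<^sup>2)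
        \<le> 2 * (indicator S x * ennreal ((f x)\<^sup>2)) + 2 * (indicator S x * ennreal ((g x)\<^sup>2))"
      by (auto simp: indicator_def)
  qed
  also have "\<dots> = 2 * sq_int S f + 2 * sq_int S g"
    unfolding sq_int_def by (simp add: nn_integral_add nn_integral_cmult)
  also have "\<dots> \<le> 2 * ennreal a + 2 * ennreal b"
    using assms by (intro add_mono mult_left_mono) auto
  also have "\<dots> = ennreal (2 * a + 2 * b)"
    using assms by (simp add: ennreal_mult'' )
  finally show ?thesis .
qed

lemma sq_int_bounded_mult:
  fixes f h :: "real ^ 'n \<Rightarrow> real"
  assumes [measurable]: "f \<in> borel_measurable lebesgue" "S \<in> sets lebesgue"
    and "sq_int S f \<le> ennreal a" "0 \<le> a" "AE x in lebesgue. x \<in> S \<longrightarrow> \<bar>h x\<bar> \<le> c"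
  shows "sq_int S (\<lambda>x. h x * f x) \<le> ennreal (c\<^sup>2 * a)"
proof -
  have "sq_int S (\<lambda>x. h x * f x) \<le> (\<integral>\<^sup>+x. ennreal (c\<^sup>2) * (indicator S x * ennreal ((f x)\<^sup>2)) \<partial>lebesgue)"
    unfolding sq_int_def
  proof (intro nn_integral_mono_AE, use assms(5) in eventually_elim)
    fix x assume c: "x \<in> S \<longrightarrow> \<bar>h x\<bar> \<le> c"
    show "indicator S x * ennreal ((h x * f x)\<^sup>2) \<le> ennreal (c\<^sup>2) * (indicator S x * ennreal ((f x)\<^sup>2))"
    proof (cases "x \<in> S")
      case True
      then have "\<bar>h x\<bar> \<le> \<bar>c\<bar>" using c by force
      then have "(h x * f x)\<^sup>2 \<le> c\<^sup>2 * (f x)\<^sup>2"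
        by (simp add: power_mult_distrib mult_right_mono abs_le_square_iff)
      then show ?thesis using True by (simp flip: ennreal_mult)
    qed auto
  qed
  also have "\<dots> = ennreal (c\<^sup>2) * sq_int S f"
    unfolding sq_int_def by (simp add: nn_integral_cmult)
  also have "\<dots> \<le> ennreal (c\<^sup>2) * ennreal a"
    using assms by (intro mult_left_mono) auto
  finally show ?thesis using assms by (simp add: ennreal_mult)
qed

lemma sq_int_AE_cong:
  assumes "AE x in lebesgue. f x = g x"
  shows "sq_int S f = sq_int S g"
  unfolding sq_int_def using assms by (intro nn_integral_cong_AE) auto

text \<open>The Cauchy-Schwarz inequality is applied to nonnegative integrals, where nothing is
  presupposed. The finite bound then yields integrability, and only afterwards are the real-valued
  integrals compared.\<close>

lemma sq_int_CS:
  fixes f g :: "real ^ 'n \<Rightarrow> real"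
  assumes [measurable]: "f \<in> borel_measurable lebesgue" "g \<in> borel_measurable lebesgue" "S \<in> sets lebesgue"
    and "sq_int S f \<le> ennreal a" "sq_int S g \<le> ennreal b" "0 \<le> a" "0 \<le> b"
  shows "set_integrable lebesgue S (\<lambda>x. f x * g x)"
    "\<bar>LINT x:S|lebesgue. f x * g x\<bar> \<le> sqrt (a * b)"
    "(LINT x:S|lebesgue. \<bar>f x * g x\<bar>) \<le> sqrt (a * b)"
proof -
  let ?I = "\<integral>\<^sup>+x. ennreal (norm (indicator S x *\<^sub>R (f x * g x))) \<partial>lebesgue"
  have I: "?I = (\<integral>\<^sup>+x. (indicator S x * ennreal \<bar>f x\<bar>) * (indicator S x * ennreal \<bar>g x\<bar>) \<partial>lebesgue)"
    by (intro nn_integral_cong) (auto simp: indicator_def abs_mult ennreal_mult)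
  have sq: "(\<integral>\<^sup>+x. (indicator S x * ennreal \<bar>h x\<bar>)\<^sup>2 \<partial>lebesgue) = sq_int S h" for h :: "real ^ 'n \<Rightarrow> real"
    unfolding sq_int_def
    by (intro nn_integral_cong) (auto simp: indicator_def ennreal_power)
  have "?I\<^sup>2 \<le> sq_int S f * sq_int S g"
    unfolding I using Cauchy_Schwarz_nn_integral[of "\<lambda>x. indicator S x * ennreal \<bar>f x\<bar>" lebesgue
        "\<lambda>x. indicator S x * ennreal \<bar>g x\<bar>"]
    unfolding sq by simp
  also have "\<dots> \<le> ennreal a * ennreal b"
    using assms by (intro mult_mono) auto
  also have "\<dots> = (ennreal (sqrt (a * b)))\<^sup>2"
    using assms by (simp add: ennreal_power ennreal_mult)
  finally have sq_le: "?I\<^sup>2 \<le> (ennreal (sqrt (a * b)))\<^sup>2" .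
  have "?I\<^sup>2 < top"
    by (rule le_less_trans[OF sq_le]) (use assms in \<open>simp add: ennreal_power\<close>)
  then have "?I < top" by (simp add: power_less_top_ennreal)
  then obtain i where i: "?I = ennreal i" "i \<ge> 0" by (cases ?I) auto
  then have "i\<^sup>2 \<le> (sqrt (a * b))\<^sup>2"
    using sq_le assms unfolding i by (subst (asm) (1 2) ennreal_power) (auto simp: ennreal_le_iff)
  then have "i \<le> sqrt (a * b)" by (rule power2_le_imp_le) (use assms(6,7) in simp)
  then have le: "?I \<le> ennreal (sqrt (a * b))"
    unfolding i by (rule ennreal_leI)
  show int: "set_integrable lebesgue S (\<lambda>x. f x * g x)"
    unfolding set_integrable_def
    by (rule integrableI_bounded) (use le in \<open>auto intro: le_less_trans\<close>)
  have "ennreal (LINT x:S|lebesgue. \<bar>f x * g x\<bar>) = ?I"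
    unfolding set_lebesgue_integral_def
    using int unfolding set_integrable_def
    by (subst nn_integral_eq_integral[symmetric]) (auto simp: abs_mult dest: integrable_norm)
  then show 1: "(LINT x:S|lebesgue. \<bar>f x * g x\<bar>) \<le> sqrt (a * b)"
    using le assms(6,7) by (metis ennreal_le_iff mult_nonneg_nonneg real_sqrt_ge_zero)
  have "\<bar>LINT x:S|lebesgue. f x * g x\<bar> \<le> (LINT x:S|lebesgue. \<bar>f x * g x\<bar>)"
    unfolding set_lebesgue_integral_def
    using integral_norm_bound[of lebesgue "\<lambda>x. indicator S x *\<^sub>R (f x * g x)"]
    by (simp add: abs_mult)
  then show "\<bar>LINT x:S|lebesgue. f x * g x\<bar> \<le> sqrt (a * b)" using 1 by linarith
qed

definition loc_int :: "(real ^ 'n \<Rightarrow> real) \<Rightarrow> bool" where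
  "loc_int f \<longleftrightarrow> f \<in> borel_measurable lebesgue \<and> (\<forall>r. set_integrable lebesgue (cball 0 r) f)"

lemma continuous_loc_int:
  assumes "continuous_on UNIV f" shows "loc_int f"
  unfolding loc_int_def
proof (intro conjI allI)
  show "f \<in> borel_measurable lebesgue"
    using borel_measurable_continuous_onI[OF assms] by (intro measurable_completion) simp
  show "set_integrable lebesgue (cball 0 r) f" for r
  proof -
    have "integrable lborel (\<lambda>x. indicator (cball 0 r) x *\<^sub>R f x)"
      by (intro borel_integrable_compact continuous_on_subset[OF assms]) auto
    then show ?thesis unfolding set_integrable_def
      using integrable_completion borel_measurable_integrable by blast
  qed
qed

lemma loc_int_add: "loc_int f \<Longrightarrow> loc_int g \<Longrightarrow> loc_int (\<lambda>x. f x + g x)"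
  by (auto simp: loc_int_def)

lemma loc_int_diff: "loc_int f \<Longrightarrow> loc_int g \<Longrightarrow> loc_int (\<lambda>x. f x - g x)"
  by (auto simp: loc_int_def)

lemma sq_int_loc_int:
  fixes f :: "real ^ 'n \<Rightarrow> real"
  assumes "f \<in> borel_measurable lebesgue" "\<And>r. sq_int (cball 0 r) f < \<infinity>"
  shows "loc_int f"
  unfolding loc_int_def
proof (intro conjI allI assms)
  fix r
  obtain a where a: "sq_int (cball 0 r) f = ennreal a" "a \<ge> 0"
    using assms(2)[of r] by (cases "sq_int (cball 0 r) f") auto
  have "sq_int (cball 0 r :: (real ^ 'n) set) (\<lambda>_. 1) = emeasure lebesgue (cball (0::real^'n) r)"
    by (simp add: sq_int_def)
  also have "\<dots> = ennreal (measure lebesgue (cball (0::real^'n) r))"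
    by (intro emeasure_eq_ennreal_measure) (use emeasure_lborel_cball_finite[of "0::real^'n" r] in \<open>simp add: less_top\<close>)
  finally have "sq_int (cball 0 r :: (real ^ 'n) set) (\<lambda>_. 1) = ennreal (measure lebesgue (cball (0::real^'n) r))" .
  from sq_int_CS(1)[OF assms(1) _ _ eq_refl[OF a(1)] eq_refl[OF this] a(2)]
  show "set_integrable lebesgue (cball 0 r) f" by simp
qed

text \<open>The shift sits on the second argument: all derivatives fall on \<open>k\<close>, while
  \<open>f\<close> may be merely locally integrable.\<close>

definition conv :: "(real ^ 'n \<Rightarrow> real) \<Rightarrow> (real ^ 'n \<Rightarrow> real) \<Rightarrow> real ^ 'n \<Rightarrow> real" where
  "conv f k x = (LINT y|lebesgue. f y * k (x - y))"

lemma conv_integrable_bounded_supp: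
  fixes f :: "real ^ 'n \<Rightarrow> real"
  assumes "integrable lebesgue f" "\<And>y. norm y > B \<Longrightarrow> f y = 0" "continuous_on UNIV k"
  shows "integrable lebesgue (\<lambda>y. f y * k (x - y))"
proof -
  have cont: "continuous_on UNIV (\<lambda>y. k (x - y))"
    by (rule continuous_on_compose2[OF assms(3)]) (auto intro!: continuous_intros)
  then have [measurable]: "(\<lambda>y. k (x - y)) \<in> borel_measurable lebesgue"
    by (intro measurable_completion) (simp add: borel_measurable_continuous_onI)
  obtain C where C: "\<And>y. y \<in> cball 0 B \<Longrightarrow> \<bar>k (x - y)\<bar> \<le> C"
    using continuous_bounded_on_bounded_set[OF cont bounded_cball[of 0 B]] by metis
  show ?thesis
  proof (rule Bochner_Integration.integrable_bound)
    show "integrable lebesgue (\<lambda>y. C * f y)" using assms by simp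
    have "norm (f y * k (x - y)) \<le> norm (C * f y)" for y
    proof (cases "norm y > B")
      case False
      then have "\<bar>k (x - y)\<bar> \<le> \<bar>C\<bar>" using C[of y] by auto
      then show ?thesis by (simp add: abs_mult mult.commute[of "\<bar>C\<bar>"] mult_left_mono)
    qed (simp add: assms)
    then show "AE y in lebesgue. norm (f y * k (x - y)) \<le> norm (C * f y)" by simp
  qed (use assms(1) in measurable)
qed

text \<open>Here the compact support belongs to \<open>f\<close>, and \<open>k\<close> is an
  arbitrary continuously differentiable function; this is the version needed when the smooth factor
  is a mollified corrector. On the relevant ball \<open>grad k\<close> is uniformly continuous, so
  the linearisation error of \<open>k\<close> is small uniformly in the integration
  variable.\<close>

lemma conv_has_derivative_bounded_supp:
  fixes f :: "real ^ 'n \<Rightarrow> real"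
  assumes f: "integrable lebesgue f" "\<And>y. norm y > B \<Longrightarrow> f y = 0"
    and k: "\<And>x. k differentiable (at x)" "continuous_on UNIV (grad k)"
  shows "(conv f k has_derivative (\<lambda>h. (\<chi> i. conv f (\<lambda>z. grad k z $ i) x) \<bullet> h)) (at x)"
proof -
  have ck: "continuous_on UNIV k"
    using k(1) by (auto intro!: differentiable_imp_continuous_on simp: differentiable_on_def differentiable_at_withinI)
  have cki: "continuous_on UNIV (\<lambda>z. grad k z $ i)" for i
    by (intro continuous_intros k)
  have int_k: "integrable lebesgue (\<lambda>y. f y * k (x - y))" for x
    using conv_integrable_bounded_supp[OF f(1) _ ck] f(2) by blast
  have int_ki: "integrable lebesgue (\<lambda>y. f y * grad k (x - y) $ i)" for x i
    using conv_integrable_bounded_supp[OF f(1) _ cki] f(2) by blast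
  have lin: "(\<chi> i. conv f (\<lambda>z. grad k z $ i) x) \<bullet> h = (LINT y|lebesgue. f y * (grad k (x - y) \<bullet> h))"
    and int_h: "integrable lebesgue (\<lambda>y. f y * (grad k (x - y) \<bullet> h))" for h
  proof -
    have eq: "f y * (grad k (x - y) \<bullet> h) = (\<Sum>i\<in>UNIV. f y * grad k (x - y) $ i * h $ i)" for y
      by (simp add: inner_vec_def sum_distrib_left mult_ac)
    show "integrable lebesgue (\<lambda>y. f y * (grad k (x - y) \<bullet> h))"
      unfolding eq by (intro Bochner_Integration.integrable_sum integrable_mult_left int_ki)
    show "(\<chi> i. conv f (\<lambda>z. grad k z $ i) x) \<bullet> h = (LINT y|lebesgue. f y * (grad k (x - y) \<bullet> h))"
    proof -
      have "(\<chi> i. conv f (\<lambda>z. grad k z $ i) x) \<bullet> h = (\<Sum>i\<in>UNIV. conv f (\<lambda>z. grad k z $ i) x * h $ i)"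
        by (simp add: inner_vec_def)
      also have "\<dots> = (LINT y|lebesgue. (\<Sum>i\<in>UNIV. f y * grad k (x - y) $ i * h $ i))"
        using int_ki by (simp add: conv_def)
      finally show ?thesis unfolding eq .
    qed
  qed
  \<comment> \<open>The added 1 keeps \<open>N\<close> a legitimate divisor when \<open>f\<close>
    vanishes almost everywhere.\<close>
  define N where "N = (LINT y|lebesgue. \<bar>f y\<bar>) + 1"
  have N: "N > 0" unfolding N_def by (simp add: add_nonneg_pos)
  \<comment> \<open>This radius contains every segment from \<open>x - w\<close> to
    \<open>y - w\<close> with \<open>norm w \<le> B\<close> and \<open>norm (y - x) < 1\<close>,
    which explains the later \<open>min d 1\<close>.\<close>
  have uc: "uniformly_continuous_on (cball 0 (norm x + \<bar>B\<bar> + 1)) (grad k)"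
    by (intro compact_uniformly_continuous continuous_on_subset[OF k(2)]) auto
  show ?thesis unfolding has_derivative_at_alt
  proof (intro conjI allI impI)
    show "bounded_linear ((\<bullet>) (\<chi> i. conv f (\<lambda>z. grad k z $ i) x))"
      by (rule bounded_linear_inner_right)
    fix e :: real assume "e > 0"
    then have "e / N > 0" using N by simp
    then obtain d where d: "d > 0" "\<And>z w. z \<in> cball 0 (norm x + \<bar>B\<bar> + 1) \<Longrightarrow> w \<in> cball 0 (norm x + \<bar>B\<bar> + 1) \<Longrightarrow>
       dist z w < d \<Longrightarrow> dist (grad k z) (grad k w) < e / N"
      using uc unfolding uniformly_continuous_on_def by metis
    show "\<exists>d>0. \<forall>y. norm (y - x) < d \<longrightarrow>
      norm (conv f k y - conv f k x - (\<chi> i. conv f (\<lambda>z. grad k z $ i) x) \<bullet> (y - x)) \<le> e * norm (y - x)"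
    proof (intro exI[of _ "min d 1"] conjI allI impI)
      fix y assume y: "norm (y - x) < min d 1"
      let ?r = "\<lambda>w. k (y - w) - k (x - w) - grad k (x - w) \<bullet> (y - x)"
      have r: "\<bar>?r w\<bar> \<le> norm (y - x) * (e / N)" if "norm w \<le> B" for w
      proof -
        have "norm (k (y - w) - k (x - w) - grad k (x - w) \<bullet> ((y - w) - (x - w)))
           \<le> norm ((y - w) - (x - w)) * (e / N)"
        proof (rule differentiable_bound_linearization[where S = "cball (x - w) (norm (y - x))"
              and f' = "\<lambda>x h. grad k x \<bullet> h"])
          fix t :: real assume "t \<in> {0..1}"
          then show "x - w + t *\<^sub>R ((y - w) - (x - w)) \<in> cball (x - w) (norm (y - x))"
            by (simp add: dist_norm mult_left_le_one_le)
        next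
          fix z assume z: "z \<in> cball (x - w) (norm (y - x))"
          show "(k has_derivative (\<lambda>h. grad k z \<bullet> h)) (at z within cball (x - w) (norm (y - x)))"
            using has_derivative_at_withinI[OF has_derivative_grad[OF k(1)]] by blast
          have zd: "norm (z - (x - w)) \<le> norm (y - x)"
            using z by (metis mem_cball dist_commute dist_norm)
          then have "norm z \<le> norm (x - w) + norm (y - x)"
            using norm_triangle_sub[of z "x - w"] by linarith
          moreover have "norm (x - w) \<le> norm x + B" using that norm_triangle_ineq4[of x w] by linarith
          ultimately have "dist (grad k z) (grad k (x - w)) < e / N"
            using zd y that norm_minus_commute[of w x] by (intro d(2)) (auto simp: dist_norm)
          then have le: "norm (grad k z - grad k (x - w)) \<le> e / N" by (simp add: dist_norm)
          show "onorm ((\<lambda>h. grad k z \<bullet> h) - (\<lambda>h. grad k (x - w) \<bullet> h)) \<le> e / N"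
          proof (rule onorm_le)
            fix h
            have "\<bar>(grad k z - grad k (x - w)) \<bullet> h\<bar> \<le> norm (grad k z - grad k (x - w)) * norm h"
              by (rule Cauchy_Schwarz_ineq2)
            also have "\<dots> \<le> e / N * norm h" using le by (rule mult_right_mono) simp
            finally show "norm (((\<lambda>h. grad k z \<bullet> h) - (\<lambda>h. grad k (x - w) \<bullet> h)) h) \<le> e / N * norm h"
              by (simp add: inner_diff_left)
          qed
        qed auto
        then show ?thesis by simp
      qed
      have "conv f k y - conv f k x - (\<chi> i. conv f (\<lambda>z. grad k z $ i) x) \<bullet> (y - x) = (LINT w|lebesgue. f w * ?r w)"
        unfolding lin unfolding conv_def
        by (simp add: algebra_simps int_k int_h)
      also have "\<bar>\<dots>\<bar> \<le> (LINT w|lebesgue. \<bar>f w\<bar> * (norm (y - x) * (e / N)))"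
      proof (rule integral_abs_bound_integral)
        show "integrable lebesgue (\<lambda>w. f w * ?r w)"
          unfolding right_diff_distrib
          using int_k[of y] int_k[of x] int_h[of "y - x"] by (simp only: Bochner_Integration.integrable_diff right_diff_distrib)
        show "integrable lebesgue (\<lambda>w. \<bar>f w\<bar> * (norm (y - x) * (e / N)))"
          using f by simp
        show "\<bar>f w * ?r w\<bar> \<le> \<bar>f w\<bar> * (norm (y - x) * (e / N))" for w
        proof (cases "norm w \<le> B")
          case True
          then show ?thesis unfolding abs_mult using r[of w] by (intro mult_left_mono) auto
        qed (use f(2) in auto)
      qed
      also have "\<dots> = (N - 1) * (norm (y - x) * (e / N))"
        by (simp add: N_def)
      also have "\<dots> \<le> N * (norm (y - x) * (e / N))"
        using \<open>e > 0\<close> N by (intro mult_right_mono) auto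
      also have "\<dots> = e * norm (y - x)" using N by simp
      finally show "norm (conv f k y - conv f k x - (\<chi> i. conv f (\<lambda>z. grad k z $ i) x) \<bullet> (y - x)) \<le> e * norm (y - x)"
        by simp
    qed (use d in auto)
  qed
qed

lemma times_cont_diff_conv_bounded_supp:
  fixes f :: "real ^ 'n \<Rightarrow> real"
  assumes f: "integrable lebesgue f" "\<And>y. norm y > B \<Longrightarrow> f y = 0"
    and k: "\<And>m. times_cont_diff m k"
  shows "times_cont_diff m (conv f k)"
    and "conv f k differentiable (at x)"
    and "grad (conv f k) x $ i = conv f (\<lambda>z. grad k z $ i) x"
proof -
  have der: "(conv f k has_derivative (\<lambda>h. (\<chi> i. conv f (\<lambda>z. grad k z $ i) x) \<bullet> h)) (at x)"
    if "\<And>m. times_cont_diff m k" for x k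
  proof (rule conv_has_derivative_bounded_supp[OF f])
    show "k differentiable (at x)" for x using that[of 1] by simp
    have "continuous_on UNIV (\<lambda>x. \<chi> i. grad k x $ i)"
      using that[of 1] by (intro continuous_on_vec_lambda) simp
    then show "continuous_on UNIV (grad k)" by simp
  qed
  have "times_cont_diff (Suc m) (conv f k)" if "\<And>m. times_cont_diff m k" for m k
    using that
  proof (induction m arbitrary: k)
    case 0
    show ?case
    proof (rule times_cont_diff_SucI[OF der[OF 0]])
      fix i
      have k1: "times_cont_diff m (\<lambda>z. grad k z $ i)" for m using 0[of "Suc m"] by simp
      have "conv f (\<lambda>z. grad k z $ i) differentiable (at x)" for x
        using der[OF k1] differentiableI by blast
      then show "times_cont_diff 0 (\<lambda>x. (\<chi> i. conv f (\<lambda>z. grad k z $ i) x) $ i)"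
        by (auto intro!: differentiable_imp_continuous_on simp: differentiable_on_def differentiable_at_withinI)
    qed
  next
    case (Suc m)
    show ?case
    proof (rule times_cont_diff_SucI[OF der[OF Suc.prems]])
      fix i
      have k1: "times_cont_diff m (\<lambda>z. grad k z $ i)" for m using Suc.prems[of "Suc m"] by simp
      show "times_cont_diff (Suc m) (\<lambda>x. (\<chi> i. conv f (\<lambda>z. grad k z $ i) x) $ i)"
        using Suc.IH[OF k1] by simp
    qed
  qed
  then show "times_cont_diff m (conv f k)" using k times_cont_diff_SucD by blast
  show "conv f k differentiable (at x)" using der[OF k] differentiableI by blast
  show "grad (conv f k) x $ i = conv f (\<lambda>z. grad k z $ i) x"
    using grad_eqI[OF der[OF k]] by simp
qed

section \<open>Convolution of locally integrable functions with test functions\<close>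

lemma loc_int_restrict:
  assumes "loc_int f"
  shows "integrable lebesgue (\<lambda>y. indicator (cball 0 r) y * f y)"
  using assms by (auto simp: loc_int_def set_integrable_def)

text \<open>For \<open>norm x \<le> s\<close> a kernel supported in the ball of radius
  \<open>r\<close> sees \<open>f\<close> only within distance \<open>s + r\<close> of the origin.
  This reduces locally integrable data to integrable data of bounded support.\<close>

lemma conv_restrict:
  fixes f :: "real ^ 'n \<Rightarrow> real"
  assumes "\<And>x. norm x > r \<Longrightarrow> k x = 0" "norm x \<le> s" 
  shows "conv f k x = conv (\<lambda>y. indicator (cball 0 (s + r)) y * f y) k x"
  unfolding conv_def
proof (rule Bochner_Integration.integral_cong[OF refl])
  fix y
  show "f y * k (x - y) = indicator (cball 0 (s + r)) y * f y * k (x - y)"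
  proof (cases "norm (x - y) > r")
    case False
    have "norm y \<le> norm x + norm (x - y)" using norm_triangle_sub[of y x] by (simp add: norm_minus_commute)
    then have "norm y \<le> s + r" using False assms(2) by linarith
    then show ?thesis by simp
  qed (simp add: assms)
qed

lemma conv_integrable:
  fixes f :: "real ^ 'n \<Rightarrow> real"
  assumes "loc_int f" "k \<in> test_functions UNIV"
  shows "integrable lebesgue (\<lambda>y. f y * k (x - y))"
proof -
  obtain r where r: "\<And>x. norm x > r \<Longrightarrow> k x = 0"
    using test_functions_bounded[OF assms(2)] by metis
  have "integrable lebesgue (\<lambda>y. indicator (cball 0 (norm x + r)) y * f y * k (x - y))"
    by (rule conv_integrable_bounded_supp[OF loc_int_restrict[OF assms(1)], of "norm x + r"])
      (use test_functionsD(2)[OF assms(2)] in auto)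
  moreover have "(\<lambda>y. indicator (cball 0 (norm x + r)) y * f y * k (x - y)) = (\<lambda>y. f y * k (x - y))"
  proof
    fix y
    show "indicator (cball 0 (norm x + r)) y * f y * k (x - y) = f y * k (x - y)"
    proof (cases "norm (x - y) > r")
      case False
      have "norm y \<le> norm x + norm (x - y)" using norm_triangle_sub[of y x] by (simp add: norm_minus_commute)
      then have "norm y \<le> norm x + r" using False by linarith
      then show ?thesis by simp
    qed (simp add: r)
  qed
  ultimately show ?thesis by simp
qed

lemma conv_has_derivative:
  fixes f :: "real ^ 'n \<Rightarrow> real"
  assumes f: "loc_int f" and k: "k \<in> test_functions UNIV"
  shows "(conv f k has_derivative (\<lambda>h. (\<chi> i. conv f (\<lambda>z. grad k z $ i) x) \<bullet> h)) (at x)"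
proof -
  obtain K where K: "compact K" "\<And>x. x \<notin> K \<Longrightarrow> k x = 0" "\<And>x. x \<notin> K \<Longrightarrow> grad k x = 0"
    using test_functions_supp[OF k] by metis
  obtain r where r: "K \<subseteq> ball 0 r"
    using bounded_subset_ballD[OF compact_imp_bounded[OF K(1)]] by metis
  have k0: "k z = 0" and g0: "grad k z = 0" if "norm z > r" for z
  proof -
    have "z \<notin> K" using that r by force
    then show "k z = 0" "grad k z = 0" using K by auto
  qed
  \<comment> \<open>The extra unit of radius makes the two convolutions agree on all of
    \<open>ball x 1\<close>, not just at \<open>x\<close>, so that the derivative transfers.\<close>
  let ?f = "\<lambda>y. indicator (cball 0 (norm x + 1 + r)) y * f y"
  have "(conv ?f k has_derivative (\<lambda>h. (\<chi> i. conv ?f (\<lambda>z. grad k z $ i) x) \<bullet> h)) (at x)"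
    by (rule conv_has_derivative_bounded_supp[OF loc_int_restrict[OF f], of "norm x + 1 + r"])
      (use test_functionsD[OF k] in auto)
  moreover have "conv ?f (\<lambda>z. grad k z $ i) x = conv f (\<lambda>z. grad k z $ i) x" for i
    by (rule conv_restrict[symmetric]) (auto simp: g0)
  ultimately have "(conv ?f k has_derivative (\<lambda>h. (\<chi> i. conv f (\<lambda>z. grad k z $ i) x) \<bullet> h)) (at x)" by simp
  then show ?thesis
  proof (rule has_derivative_transform_within_open[of _ _ _ _ "ball x 1"])
    show "conv ?f k y = conv f k y" if "y \<in> ball x 1" for y
    proof (rule conv_restrict[symmetric])
      show "norm y \<le> norm x + 1"
        using that norm_triangle_sub[of y x] by (simp add: dist_norm norm_minus_commute)
    qed (rule k0)
  qed auto
qed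

lemma times_cont_diff_conv:
  fixes f :: "real ^ 'n \<Rightarrow> real"
  assumes f: "loc_int f" and k: "k \<in> test_functions UNIV"
  shows "times_cont_diff m (conv f k)"
    and "conv f k differentiable (at x)" 
    and "continuous_on UNIV (conv f k)"
    and "grad (conv f k) x $ i = conv f (\<lambda>z. grad k z $ i) x"
proof -
  have *: "conv f k differentiable (at x)" if "k \<in> test_functions UNIV" for x k
    using conv_has_derivative[OF f that] differentiableI by blast
  have c: "continuous_on UNIV (conv f k)" if "k \<in> test_functions UNIV" for k
    using * that by (auto intro!: differentiable_imp_continuous_on simp: differentiable_on_def differentiable_at_withinI)
  have "times_cont_diff m (conv f k)" if "k \<in> test_functions UNIV" for k m
    using that
  proof (induction m arbitrary: k)
    case (Suc m)
    show ?case
      by (rule times_cont_diff_SucI[OF conv_has_derivative[OF f Suc.prems]])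
        (simp add: Suc.IH grad_test_functions[OF Suc.prems])
  qed (simp add: c)
  then show "times_cont_diff m (conv f k)" using k by blast
  show "conv f k differentiable (at x)" "continuous_on UNIV (conv f k)" using c * k by auto
  show "grad (conv f k) x $ i = conv f (\<lambda>z. grad k z $ i) x"
    using grad_eqI[OF conv_has_derivative[OF f k]] by simp
qed

lemma conv_loc_int: "loc_int f \<Longrightarrow> k \<in> test_functions UNIV \<Longrightarrow> loc_int (conv f k)"
  by (rule continuous_loc_int[OF times_cont_diff_conv(3)])

lemma conv_add:
  assumes "loc_int f" "loc_int g" "k \<in> test_functions UNIV"
  shows "conv (\<lambda>x. f x + g x) k x = conv f k x + conv g k x"
  unfolding conv_def using conv_integrable[OF assms(1,3)] conv_integrable[OF assms(2,3)]
  by (simp add: distrib_right)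

lemma conv_diff:
  assumes "loc_int f" "loc_int g" "k \<in> test_functions UNIV"
  shows "conv (\<lambda>x. f x - g x) k x = conv f k x - conv g k x"
  unfolding conv_def using conv_integrable[OF assms(1,3)] conv_integrable[OF assms(2,3)]
  by (simp add: left_diff_distrib)

lemma conv_AE_cong:
  assumes "AE x in lebesgue. f x = g x" "f \<in> borel_measurable lebesgue" "g \<in> borel_measurable lebesgue"
    "continuous_on UNIV k"
  shows "conv f k x = conv g k x"
proof -
  have "continuous_on UNIV (\<lambda>y. k (x - y))"
    by (rule continuous_on_compose2[OF assms(4)]) (auto intro!: continuous_intros)
  then have [measurable]: "(\<lambda>y. k (x - y)) \<in> borel_measurable lebesgue"
    by (intro measurable_completion) (simp add: borel_measurable_continuous_onI)
  note assms(2,3)[measurable]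
  show ?thesis unfolding conv_def
    by (rule integral_cong_AE) (use assms(1) in auto)
qed

lemma lborel_integral_affine:
  fixes f :: "real ^ 'n \<Rightarrow> real"
  assumes [measurable]: "f \<in> borel_measurable borel" and c: "c \<noteq> 0"
  shows "(LINT x|lborel. f x) = \<bar>c\<bar> ^ CARD('n) * (LINT x|lborel. f (t + c *\<^sub>R x))"
  by (subst lborel_affine[OF c, of t]) (simp add: integral_density integral_distr)

lemma lebesgue_integral_affine:
  fixes f :: "real ^ 'n \<Rightarrow> real"
  assumes [measurable]: "f \<in> borel_measurable borel" and c: "c \<noteq> 0"
  shows "(LINT x|lebesgue. f x) = \<bar>c\<bar> ^ CARD('n) * (LINT x|lebesgue. f (t + c *\<^sub>R x))"
  using lborel_integral_affine[OF assms(1) c, of t]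
  by (simp add: integral_completion)

text \<open>The substitution \<open>y\<close> to \<open>x - y\<close>. It decides which factor
  receives the derivatives.\<close>

lemma conv_commute:
  fixes f :: "real ^ 'n \<Rightarrow> real"
  assumes "continuous_on UNIV f" "continuous_on UNIV k"
  shows "conv f k x = conv k f x"
proof -
  have "continuous_on UNIV (\<lambda>y. f y * k (x - y))"
    by (intro continuous_intros assms continuous_on_compose2[OF assms(2)]) auto
  then have "(\<lambda>y. f y * k (x - y)) \<in> borel_measurable borel"
    by (rule borel_measurable_continuous_onI)
  from lebesgue_integral_affine[OF this, of "-1" x] show ?thesis
    by (simp add: conv_def mult.commute)
qed


subsection \<open>Mollifiers\<close>

definition mollifier :: "real \<Rightarrow> (real ^ 'n \<Rightarrow> real) \<Rightarrow> bool" where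
  "mollifier r k \<longleftrightarrow> k \<in> test_functions UNIV \<and> (\<forall>x. 0 \<le> k x) \<and> (\<forall>x. norm x > r \<longrightarrow> k x = 0) \<and>
     (LINT x|lebesgue. k x) = 1"

lemma mollifierD:
  assumes "mollifier r k"
  shows "k \<in> test_functions UNIV" "0 \<le> k x" "norm x > r \<Longrightarrow> k x = 0" "(LINT x|lebesgue. k x) = 1"
    "continuous_on UNIV k" "integrable lebesgue k" "integrable lborel k" "(LINT x|lborel. k x) = 1"
proof -
  show *: "k \<in> test_functions UNIV" "0 \<le> k x" "norm x > r \<Longrightarrow> k x = 0" "(LINT x|lebesgue. k x) = 1"
    using assms by (auto simp: mollifier_def)
  show "continuous_on UNIV k" "integrable lborel k"
    using test_functionsD(2)[OF *(1)] test_functions_integrable[OF *(1)] by auto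
  then show "integrable lebesgue k" "(LINT x|lborel. k x) = 1"
    using integrable_completion borel_measurable_integrable integral_completion[of k lborel] *(4) by auto
qed

definition rescale :: "(real ^ 'n \<Rightarrow> real) \<Rightarrow> real \<Rightarrow> real ^ 'n \<Rightarrow> real" where
  "rescale k s x = (1 / s) ^ CARD('n) * k ((1 / s) *\<^sub>R x)"

lemma mollifier_rescale:
  fixes k :: "real ^ 'n \<Rightarrow> real"
  assumes k: "mollifier r k" and s: "s > 0"
  shows "mollifier (s * r) (rescale k s)"
  unfolding mollifier_def
proof (intro conjI allI impI)
  show "rescale k s \<in> test_functions UNIV"
    unfolding rescale_def[abs_def]
    using test_functions_affine[OF mollifierD(1)[OF k], of "1 / s" "(1 / s) ^ CARD('n)" 0] s by simp
  show "0 \<le> rescale k s x" for x using mollifierD(2)[OF k] s by (simp add: rescale_def)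
  show "rescale k s x = 0" if "s * r < norm x" for x
    using that s by (auto simp: rescale_def field_simps intro!: mollifierD(3)[OF k])
  have "k \<in> borel_measurable borel"
    by (rule borel_measurable_continuous_onI[OF mollifierD(5)[OF k]])
  from lebesgue_integral_affine[OF this, of "1 / s" 0] s mollifierD(4)[OF k]
  show "(LINT x|lebesgue. rescale k s x) = 1"
    by (simp add: rescale_def[abs_def])
qed

lemma mollifier_exists: "\<exists>k :: real ^ 'n \<Rightarrow> real. mollifier 1 k"
proof -
  define b :: "real ^ 'n \<Rightarrow> real" where "b x = exp_cutoff 0 (1 - x \<bullet> x)" for x
  have b_pos: "b x > 0" if "norm x < 1" for x
    using that by (simp add: b_def exp_cutoff_def dot_square_norm not_le abs_square_less_1)
  have b0: "b x = 0" if "norm x \<ge> 1" for x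
    using that by (simp add: b_def exp_cutoff_def dot_square_norm)
  have b_nonneg: "b x \<ge> 0" for x by (simp add: b_def exp_cutoff_nonneg)
  have b: "b \<in> test_functions UNIV"
    by (rule test_functionsI[of _ "cball 0 1"])
      (use b0 in \<open>auto simp: b_def[abs_def] intro: times_cont_diff_exp_cutoff\<close>)
  have int: "integrable lborel b" by (rule test_functions_integrable[OF b])
  \<comment> \<open>A nonnegative function of integral zero vanishes almost everywhere; since
    \<open>b\<close> is positive on the open unit ball, that ball would be a null set.\<close>
  have "(LINT x|lborel. b x) \<noteq> 0"
  proof
    assume "(LINT x|lborel. b x) = 0"
    then have "AE x in lborel. b x = 0"
      using integral_nonneg_eq_0_iff_AE[OF int] b_nonneg by auto
    then have "AE x in lborel. x \<notin> ball (0 :: real ^ 'n) 1"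
      by (rule AE_mp) (use b_pos in \<open>auto intro!: AE_I2 simp: less_le\<close>)
    then have "ball (0 :: real ^ 'n) 1 \<in> null_sets lborel"
      by (subst (asm) AE_iff_null_sets[symmetric]) auto
    then show False using content_ball_pos[of 1 "0 :: real ^ 'n"] by (auto simp: null_sets_def measure_def)
  qed
  moreover have "(LINT x|lborel. b x) \<ge> 0" using b_nonneg by (intro integral_nonneg_AE) auto
  ultimately have pos: "(LINT x|lborel. b x) > 0" by simp
  have "mollifier 1 (\<lambda>x. 1 / (LINT x|lborel. b x) * b x)"
    unfolding mollifier_def
  proof (intro conjI allI impI)
    show "(\<lambda>x. 1 / (LINT x|lborel. b x) * b x) \<in> test_functions UNIV"
      using test_functions_affine[OF b, of 1 "1 / (LINT x|lborel. b x)" 0] by simp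
    show "(LINT x|lebesgue. 1 / (LINT x|lborel. b x) * b x) = 1"
      using pos int by (simp add: integral_completion)
  qed (use b_nonneg pos b0 in auto)
  then show ?thesis by blast
qed

text \<open>Jensen's inequality for the probability density \<open>k (x - y)\<close>, obtained from
  Cauchy-Schwarz by splitting the kernel into two factors \<open>sqrt (k (x - y))\<close>.\<close>

lemma conv_sq_le:
  fixes f :: "real ^ 'n \<Rightarrow> real"
  assumes k: "mollifier r k" and f: "loc_int f" and fb[measurable]: "f \<in> borel_measurable borel"
  shows "ennreal ((conv f k x)\<^sup>2) \<le> (\<integral>\<^sup>+y. ennreal ((f y)\<^sup>2) * ennreal (k (x - y)) \<partial>lborel)"
proof -
  note [measurable] = borel_measurable_continuous_onI[OF mollifierD(5)[OF k]]
  have "ennreal \<bar>conv f k x\<bar> \<le> (\<integral>\<^sup>+y. ennreal \<bar>f y * k (x - y)\<bar> \<partial>lebesgue)"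
    unfolding conv_def using integral_norm_bound_ennreal[OF conv_integrable[OF f mollifierD(1)[OF k]], of x] by simp
  also have "\<dots> = (\<integral>\<^sup>+y. (ennreal \<bar>f y\<bar> * ennreal (sqrt (k (x - y)))) * ennreal (sqrt (k (x - y))) \<partial>lborel)"
    unfolding nn_integral_completion
    using mollifierD(2)[OF k]
    by (intro nn_integral_cong) (simp add: abs_mult ennreal_mult mult.assoc flip: ennreal_mult)
  finally have "(ennreal \<bar>conv f k x\<bar>)\<^sup>2 \<le> \<dots>\<^sup>2" by (intro power_mono) auto
  also have "\<dots> \<le> (\<integral>\<^sup>+y. (ennreal \<bar>f y\<bar> * ennreal (sqrt (k (x - y))))\<^sup>2 \<partial>lborel) *
     (\<integral>\<^sup>+y. (ennreal (sqrt (k (x - y))))\<^sup>2 \<partial>lborel)"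
    by (intro Cauchy_Schwarz_nn_integral) auto
  also have "(\<integral>\<^sup>+y. (ennreal \<bar>f y\<bar> * ennreal (sqrt (k (x - y))))\<^sup>2 \<partial>lborel) =
     (\<integral>\<^sup>+y. ennreal ((f y)\<^sup>2) * ennreal (k (x - y)) \<partial>lborel)"
    using mollifierD(2)[OF k]
    by (intro nn_integral_cong) (simp add: power_mult_distrib ennreal_power)
  also have "(\<integral>\<^sup>+y. (ennreal (sqrt (k (x - y))))\<^sup>2 \<partial>lborel) = (\<integral>\<^sup>+y. ennreal (k (x - y)) \<partial>lborel)"
    using mollifierD(2)[OF k]
    by (intro nn_integral_cong) (simp add: ennreal_power)
  also have "\<dots> = (\<integral>\<^sup>+y. ennreal (k y) \<partial>lborel)"
    by (subst lborel_affine[of "-1" x], simp, subst nn_integral_density, simp, simp,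
        subst nn_integral_distr) auto
  also have "\<dots> = 1"
    using nn_integral_eq_integral[OF mollifierD(7)[OF k]] mollifierD(2,8)[OF k] by simp
  finally show ?thesis by (simp add: ennreal_power)
qed

text \<open>Young's inequality in a local form: by Jensen and Tonelli, mollifying does not increase
  the square integral, provided that \<open>T\<close> contains every point within distance
  \<open>r\<close> of \<open>S\<close>. Borel measurability makes the integrand measurable on the
  product space.\<close>

lemma sq_int_conv_borel:
  fixes f :: "real ^ 'n \<Rightarrow> real"
  assumes k: "mollifier r k" and f: "loc_int f" and fb[measurable]: "f \<in> borel_measurable borel"
    and [measurable]: "S \<in> sets borel" "T \<in> sets borel"
    and ST: "\<And>x y. x \<in> S \<Longrightarrow> norm y \<le> r \<Longrightarrow> x - y \<in> T"
  shows "sq_int S (conv f k) \<le> sq_int T f"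
proof -
  note [measurable] = borel_measurable_continuous_onI[OF mollifierD(5)[OF k]]
  have "sq_int S (conv f k) \<le> (\<integral>\<^sup>+x. indicator S x * (\<integral>\<^sup>+y. ennreal ((f y)\<^sup>2) * ennreal (k (x - y)) \<partial>lborel) \<partial>lebesgue)"
    unfolding sq_int_def by (intro nn_integral_mono mult_left_mono conv_sq_le[OF k f fb]) auto
  also have "\<dots> = (\<integral>\<^sup>+x. (\<integral>\<^sup>+y. indicator S x * (ennreal ((f y)\<^sup>2) * ennreal (k (x - y))) \<partial>lborel) \<partial>lborel)"
    unfolding nn_integral_completion by (intro nn_integral_cong nn_integral_cmult[symmetric]) auto
  also have "\<dots> = (\<integral>\<^sup>+y. (\<integral>\<^sup>+x. indicator S x * (ennreal ((f y)\<^sup>2) * ennreal (k (x - y))) \<partial>lborel) \<partial>lborel)"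
    by (rule lborel_pair.Fubini'[symmetric]) measurable
  also have "\<dots> \<le> (\<integral>\<^sup>+y. indicator T y * ennreal ((f y)\<^sup>2) \<partial>lborel)"
  proof (intro nn_integral_mono)
    fix y
    have "(\<integral>\<^sup>+x. indicator S x * (ennreal ((f y)\<^sup>2) * ennreal (k (x - y))) \<partial>lborel)
      \<le> (\<integral>\<^sup>+x. (indicator T y * ennreal ((f y)\<^sup>2)) * ennreal (k (x - y)) \<partial>lborel)"
    proof (intro nn_integral_mono)
      fix x
      show "indicator S x * (ennreal ((f y)\<^sup>2) * ennreal (k (x - y))) \<le> (indicator T y * ennreal ((f y)\<^sup>2)) * ennreal (k (x - y))"
      proof (cases "x \<in> S \<and> norm (x - y) \<le> r")
        case True
        then have "y \<in> T" using ST[of x "x - y"] by simp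
        then show ?thesis by (simp add: indicator_def)
      next
        case False
        then show ?thesis using mollifierD(3)[OF k, of "x - y"] by (cases "x \<in> S") auto
      qed
    qed
    also have "\<dots> = (indicator T y * ennreal ((f y)\<^sup>2)) * (\<integral>\<^sup>+x. ennreal (k (x - y)) \<partial>lborel)"
      by (intro nn_integral_cmult) auto
    also have "(\<integral>\<^sup>+x. ennreal (k (x - y)) \<partial>lborel) = (\<integral>\<^sup>+x. ennreal (k x) \<partial>lborel)"
      by (subst (2) lborel_affine[of "1" "- y"], simp, subst nn_integral_density, simp, simp,
          subst nn_integral_distr) auto
    also have "\<dots> = 1"
      using nn_integral_eq_integral[OF mollifierD(7)[OF k]] mollifierD(2,8)[OF k] by simp
    finally show "(\<integral>\<^sup>+x. indicator S x * (ennreal ((f y)\<^sup>2) * ennreal (k (x - y))) \<partial>lborel) \<le> indicator T y * ennreal ((f y)\<^sup>2)"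
      by simp
  qed
  also have "\<dots> = sq_int T f" unfolding sq_int_def nn_integral_completion ..
  finally show ?thesis .
qed

lemma loc_int_AE_cong:
  assumes "loc_int f" "AE x in lebesgue. f x = g x" "g \<in> borel_measurable lebesgue"
  shows "loc_int g"
  unfolding loc_int_def
proof (intro conjI allI assms)
  fix r
  show "set_integrable lebesgue (cball 0 r) g"
    unfolding set_integrable_def
  proof (rule integrable_cong_AE_imp)
    show "integrable lebesgue (\<lambda>x. indicator (cball 0 r) x *\<^sub>R f x)"
      using assms(1) by (auto simp: loc_int_def set_integrable_def)
    show "AE x in lebesgue. indicator (cball 0 r) x *\<^sub>R f x = indicator (cball 0 r) x *\<^sub>R g x"
      using assms(2) by auto
    show "(\<lambda>x. indicat_real (cball 0 r) x *\<^sub>R g x) \<in> borel_measurable lebesgue"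
      by (intro borel_measurable_scaleR borel_measurable_indicator assms(3)) simp
  qed
qed

text \<open>A Lebesgue measurable function agrees almost everywhere with a Borel one, and neither
  \<open>conv\<close> nor \<open>sq_int\<close> notices the exchange.\<close>

lemma sq_int_conv:
  fixes f :: "real ^ 'n \<Rightarrow> real"
  assumes k: "mollifier r k" and f: "loc_int f"
    and S: "S \<in> sets borel" "T \<in> sets borel"
    and ST: "\<And>x y. x \<in> S \<Longrightarrow> norm y \<le> r \<Longrightarrow> x - y \<in> T"
  shows "sq_int S (conv f k) \<le> sq_int T f"
proof -
  have fm: "f \<in> borel_measurable lebesgue" using f by (simp add: loc_int_def)
  obtain f' where f': "f' \<in> borel_measurable lborel" "AE x in lborel. f x = f' x"
    using completion_ex_borel_measurable_real[OF fm] by blast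
  then have ae: "AE x in lebesgue. f x = f' x" by (simp add: AE_completion_iff)
  have f'm: "f' \<in> borel_measurable lebesgue" using f'(1) by (rule measurable_completion)
  have "conv f k = conv f' k"
    using conv_AE_cong[OF ae fm f'm mollifierD(5)[OF k]] by blast
  moreover have "sq_int T f = sq_int T f'" by (rule sq_int_AE_cong[OF ae])
  moreover have "sq_int S (conv f' k) \<le> sq_int T f'"
    by (rule sq_int_conv_borel[OF k loc_int_AE_cong[OF f ae f'm] _ S ST]) (use f' in auto)
  ultimately show ?thesis by simp
qed

text \<open>The shift by \<open>z\<close> is controlled by differentiating \<open>z \<mapsto> \<integral> H(x) \<psi>(x - z) dx\<close>,
  so that only one-parameter integrals of \<open>\<nabla>\<psi>\<close> occur.\<close>

lemma shift_difference_bound: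
  fixes H :: "real ^ 'n \<Rightarrow> real"
  assumes H: "integrable lebesgue H" "\<And>x. x \<notin> S \<Longrightarrow> H x = 0" "S \<subseteq> cball 0 B" "S \<in> sets borel"
    and psi: "\<And>x. psi differentiable (at x)" "continuous_on UNIV (grad psi)"
    and sq: "sq_int S H \<le> ennreal a" "0 \<le> a"
      "\<And>z i. norm z \<le> s \<Longrightarrow> sq_int S (\<lambda>x. grad psi (x - z) $ i) \<le> ennreal b" "0 \<le> b"
    and z: "norm z \<le> s"
  shows "\<bar>LINT x|lebesgue. H x * (psi x - psi (x - z))\<bar> \<le> s * real CARD('n) * sqrt (a * b)"
proof -
  \<comment> \<open>Reflecting \<open>psi\<close> turns the integral of
    \<open>H x * psi (x - z)\<close> into \<open>conv H k z\<close>, whose derivative in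
    \<open>z\<close> is already known.\<close>
  define k where "k w = psi (- 1 *\<^sub>R w + 0)" for w
  have k: "k differentiable (at x)" for x unfolding k_def
    by (rule differentiable_compose[of psi]) (use psi in \<open>auto intro!: derivative_intros\<close>)
  have gk: "grad k w = - grad psi (- w)" for w
    unfolding k_def using grad_affine[of psi "-1" w 0] psi by simp
  have cgk: "continuous_on UNIV (grad k)" unfolding gk[abs_def]
    by (intro continuous_intros continuous_on_compose2[OF psi(2)]) auto
  have H0: "norm y > B \<Longrightarrow> H y = 0" for y using H(2,3) by force
  note der = conv_has_derivative_bounded_supp[OF H(1) H0 k cgk]
  have ck: "continuous_on UNIV k"
    using k by (auto intro!: differentiable_imp_continuous_on simp: differentiable_on_def differentiable_at_withinI)
  have bound: "\<bar>conv H (\<lambda>z. grad k z $ i) y\<bar> \<le> sqrt (a * b)" if y: "norm y \<le> s" for i y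
  proof -
    have [measurable]: "(\<lambda>x. grad psi (x - y) $ i) \<in> borel_measurable lebesgue"
      by (intro measurable_completion)
        (auto intro!: borel_measurable_continuous_onI continuous_intros continuous_on_compose2[OF psi(2)])
    have "conv H (\<lambda>z. grad k z $ i) y = - (LINT x:S|lebesgue. H x * grad psi (x - y) $ i)"
      unfolding conv_def set_lebesgue_integral_def gk Bochner_Integration.integral_minus[symmetric]
      by (intro Bochner_Integration.integral_cong) (auto simp: indicator_def H(2))
    moreover have "\<bar>LINT x:S|lebesgue. H x * grad psi (x - y) $ i\<bar> \<le> sqrt (a * b)"
      using H(1,4) sq y by (intro sq_int_CS(2)) auto
    ultimately show ?thesis by simp
  qed
  \<comment> \<open>Mean value inequality on the ball of admissible shifts. The gradient norm is
    estimated by the sum of its components, each at most \<open>sqrt (a * b)\<close>; hence the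
    factor \<open>CARD('n)\<close>.\<close>
  have "norm (conv H k z - conv H k 0) \<le> (real CARD('n) * sqrt (a * b)) * norm (z - 0)"
  proof (rule differentiable_bound[where S = "cball 0 s"])
    fix y :: "real ^ 'n" assume "y \<in> cball 0 s"
    then have y: "norm y \<le> s" by simp
    show "(conv H k has_derivative (\<lambda>h. (\<chi> i. conv H (\<lambda>z. grad k z $ i) y) \<bullet> h)) (at y within cball 0 s)"
      using der has_derivative_at_withinI by blast
    show "onorm (\<lambda>h. (\<chi> i. conv H (\<lambda>z. grad k z $ i) y) \<bullet> h) \<le> real CARD('n) * sqrt (a * b)"
    proof (rule onorm_le)
      fix h :: "real ^ 'n"
      have "norm ((\<chi> i. conv H (\<lambda>z. grad k z $ i) y) \<bullet> h) \<le> norm (\<chi> i. conv H (\<lambda>z. grad k z $ i) y) * norm h"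
        using Cauchy_Schwarz_ineq2 by simp
      also have "norm (\<chi> i. conv H (\<lambda>z. grad k z $ i) y) \<le> (\<Sum>i\<in>UNIV. \<bar>conv H (\<lambda>z. grad k z $ i) y\<bar>)"
        using norm_le_l1_cart[of "\<chi> i. conv H (\<lambda>z. grad k z $ i) y"] by simp
      also have "\<dots> \<le> (\<Sum>i\<in>(UNIV :: 'n set). sqrt (a * b))"
        by (intro sum_mono bound y)
      finally show "norm ((\<chi> i. conv H (\<lambda>z. grad k z $ i) y) \<bullet> h) \<le> real CARD('n) * sqrt (a * b) * norm h"
        by (simp add: mult_right_mono)
    qed
  qed (use z order_trans[OF norm_ge_zero z] in auto)
  also have "\<dots> \<le> s * real CARD('n) * sqrt (a * b)"
    using mult_left_mono[OF z, of "real CARD('n) * sqrt (a * b)"] sq by (simp add: mult_ac)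
  finally have *: "\<bar>conv H k z - conv H k 0\<bar> \<le> s * real CARD('n) * sqrt (a * b)" by simp
  have i: "integrable lebesgue (\<lambda>y. H y * k (x - y))" for x
    using conv_integrable_bounded_supp[OF H(1) _ ck] H0 by blast
  have "(LINT x|lebesgue. H x * (psi x - psi (x - z))) = conv H k 0 - conv H k z"
    unfolding conv_def
    using i[of 0] i[of z]
    by (subst Bochner_Integration.integral_diff[symmetric]) (auto simp: k_def right_diff_distrib)
  then show ?thesis using * by simp
qed

text \<open>Since \<open>k\<close> has integral 1, \<open>psi - conv psi k\<close> is the
  \<open>k\<close>-average of the differences \<open>psi x - psi (x - z)\<close>. Fubini moves this
  average outside the pairing with \<open>H\<close>, so a bound valid for every single shift
  survives.\<close>

lemma integral_diff_conv_bound: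
  fixes H :: "real ^ 'n \<Rightarrow> real"
  assumes H: "integrable lebesgue H" "\<And>x. norm x > B \<Longrightarrow> H x = 0"
    and psi: "continuous_on UNIV psi" and k: "mollifier s k"
    and bd: "\<And>z. norm z \<le> s \<Longrightarrow> \<bar>LINT x|lebesgue. H x * (psi x - psi (x - z))\<bar> \<le> b"
  shows "\<bar>LINT x|lebesgue. H x * (psi x - conv psi k x)\<bar> \<le> b"
proof -
  have Hm: "H \<in> borel_measurable lebesgue" using H(1) by auto
  obtain H' where H': "H' \<in> borel_measurable lborel" "AE x in lborel. H x = H' x"
    using completion_ex_borel_measurable_real[OF Hm] by blast
  \<comment> \<open>A Borel representative of \<open>H\<close> with support in the same ball, as
    required for Fubini on \<open>lborel\<close>.\<close>
  define h where "h x = indicator (cball 0 B) x * H' x" for x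
  have [measurable]: "H' \<in> borel_measurable borel" using H'(1) by simp
  have hm[measurable]: "h \<in> borel_measurable borel" unfolding h_def
    by (intro borel_measurable_times borel_measurable_indicator) auto
  have aeb: "AE x in lborel. H x = h x"
    using H'(2) by (rule AE_mp) (auto intro!: AE_I2 simp: h_def indicator_def H(2))
  then have ae: "AE x in lebesgue. H x = h x" by (simp add: AE_completion_iff)
  have "integrable lebesgue h"
    by (rule integrable_cong_AE_imp[OF H(1) _ ae]) (simp add: measurable_completion)
  then have hi: "integrable lborel h" by (simp add: integrable_completion)
  have h0: "norm x > B \<Longrightarrow> h x = 0" for x by (simp add: h_def)
  note [measurable] = borel_measurable_continuous_onI[OF mollifierD(5)[OF k]] borel_measurable_continuous_onI[OF psi]
  have eq: "(LINT x|lebesgue. H x * g x) = (LINT x|lborel. h x * g x)" if [measurable]: "g \<in> borel_measurable borel" for g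
  proof -
    have [measurable]: "g \<in> borel_measurable lebesgue" by (simp add: measurable_completion)
    note Hm[measurable]
    have [measurable]: "h \<in> borel_measurable lebesgue" by (simp add: measurable_completion)
    have "(LINT x|lebesgue. H x * g x) = (LINT x|lebesgue. h x * g x)"
      by (rule integral_cong_AE) (use ae in auto)
    then show ?thesis by (simp add: integral_completion)
  qed
  \<comment> \<open>For \<open>norm x \<le> B\<close> and \<open>norm y \<le> s\<close> both
    \<open>x\<close> and \<open>x - y\<close> lie in this ball; elsewhere the product integrand
    vanishes. This yields an integrable majorant of product form.\<close>
  obtain C where C: "C > 0" "\<And>x. x \<in> cball 0 (\<bar>B\<bar> + \<bar>s\<bar>) \<Longrightarrow> \<bar>psi x\<bar> \<le> C"
    using continuous_bounded_on_bounded_set[OF psi bounded_cball[of 0 "\<bar>B\<bar> + \<bar>s\<bar>"]] by metis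
  have dom: "\<bar>h x * (k y * (psi x - psi (x - y)))\<bar> \<le> \<bar>h x\<bar> * (2 * C) * k y" for x y
  proof (cases "norm x > B \<or> norm y > s")
    case True
    then show ?thesis using h0[of x] mollifierD(2,3)[OF k, of y] C by auto
  next
    case False
    then have "\<bar>psi x\<bar> \<le> C" "\<bar>psi (x - y)\<bar> \<le> C"
      using norm_triangle_ineq4[of x y] by (auto intro!: C)
    then have "\<bar>psi x - psi (x - y)\<bar> \<le> 2 * C" by simp
    then have "\<bar>h x\<bar> * (k y * \<bar>psi x - psi (x - y)\<bar>) \<le> \<bar>h x\<bar> * (k y * (2 * C))"
      by (intro mult_left_mono mollifierD(2)[OF k]) auto
    then show ?thesis using mollifierD(2)[OF k, of y] by (simp add: abs_mult mult_ac)
  qed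
  have int2: "integrable (lborel \<Otimes>\<^sub>M lborel) (\<lambda>(x, y). h x * (k y * (psi x - psi (x - y))))"
  proof (rule Bochner_Integration.integrable_bound)
    show "integrable (lborel \<Otimes>\<^sub>M lborel) (\<lambda>(x, y). \<bar>h x\<bar> * (2 * C) * k y)"
    proof (rule lborel_pair.Fubini_integrable)
      show "integrable lborel (\<lambda>x. LINT y|lborel. norm (case (x, y) of (x, y) \<Rightarrow> \<bar>h x\<bar> * (2 * C) * k y))"
        using mollifierD(2,7,8)[OF k] C hi by (simp add: abs_mult)
      show "AE x in lborel. integrable lborel (\<lambda>y. case (x, y) of (x, y) \<Rightarrow> \<bar>h x\<bar> * (2 * C) * k y)"
        using mollifierD(7)[OF k] by simp
    qed measurable
    show "AE x in lborel \<Otimes>\<^sub>M lborel. norm (case x of (x, y) \<Rightarrow> h x * (k y * (psi x - psi (x - y)))) \<le>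
       norm (case x of (x, y) \<Rightarrow> \<bar>h x\<bar> * (2 * C) * k y)"
      using dom by (auto intro!: AE_I2 order_trans[OF dom])
  qed measurable
  have int_k: "integrable lborel (\<lambda>y. k y * psi (x - y))" for x
  proof -
    have "integrable lebesgue (\<lambda>y. k y * psi (x - y))"
      using conv_integrable_bounded_supp[OF mollifierD(6)[OF k] _ psi] mollifierD(3)[OF k] by blast
    then show ?thesis by (simp add: integrable_completion)
  qed
  have diff: "psi x - conv psi k x = (LINT y|lborel. k y * (psi x - psi (x - y)))" for x
  proof -
    have "conv psi k x = (LINT y|lborel. k y * psi (x - y))"
      using conv_commute[OF psi mollifierD(5)[OF k]] by (simp add: conv_def integral_completion)
    then show ?thesis
      using mollifierD(7,8)[OF k] int_k by (simp add: right_diff_distrib)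
  qed
  have [measurable]: "conv psi k \<in> borel_measurable borel"
    using times_cont_diff_conv(3)[OF continuous_loc_int[OF psi] mollifierD(1)[OF k]]
    by (rule borel_measurable_continuous_onI)
  have "(LINT x|lebesgue. H x * (psi x - conv psi k x)) = (LINT x|lborel. h x * (psi x - conv psi k x))"
    by (rule eq) measurable
  also have "\<dots> = (LINT x|lborel. LINT y|lborel. h x * (k y * (psi x - psi (x - y))))"
    unfolding diff by simp
  also have "\<dots> = (LINT y|lborel. LINT x|lborel. h x * (k y * (psi x - psi (x - y))))"
    using lborel_pair.Fubini_integral[OF int2] by simp
  also have "\<bar>\<dots>\<bar> \<le> (LINT y|lborel. k y * b)"
  proof (rule integral_abs_bound_integral)
    show "integrable lborel (\<lambda>y. LINT x|lborel. h x * (k y * (psi x - psi (x - y))))"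
      using lborel_pair.integrable_snd[OF int2] by simp
    show "integrable lborel (\<lambda>y. k y * b)" using mollifierD(7)[OF k] by simp
    fix y
    have "(LINT x|lborel. h x * (k y * (psi x - psi (x - y)))) = k y * (LINT x|lborel. h x * (psi x - psi (x - y)))"
      by (subst Bochner_Integration.integral_mult_right_zero[symmetric]) (simp add: mult_ac)
    also have "(LINT x|lborel. h x * (psi x - psi (x - y))) = (LINT x|lebesgue. H x * (psi x - psi (x - y)))"
      by (rule eq[symmetric]) measurable
    finally have e: "(LINT x|lborel. h x * (k y * (psi x - psi (x - y)))) = k y * (LINT x|lebesgue. H x * (psi x - psi (x - y)))" .
    show "\<bar>LINT x|lborel. h x * (k y * (psi x - psi (x - y)))\<bar> \<le> k y * b"
    proof (cases "norm y \<le> s")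
      case True
      then show ?thesis unfolding e using bd[OF True] mollifierD(2)[OF k, of y]
        by (simp add: abs_mult mult_left_mono)
    next
      case False
      then show ?thesis unfolding e using mollifierD(3)[OF k, of y] by simp
    qed
  qed
  also have "\<dots> = b" using mollifierD(8)[OF k] by simp
  finally show ?thesis .
qed


subsection \<open>Besicovitch spaces\<close>

lemma Lp_loc_2D:
  fixes u :: "real ^ 'n \<Rightarrow> real"
  assumes "Lp_loc 2 UNIV u"
  shows "u \<in> borel_measurable lebesgue" "sq_int (cball 0 r) u < \<infinity>"
proof -
  have L: "Lp_on 2 (cball 0 r) u" for r using assms by (auto simp: Lp_loc_def)
  show m: "u \<in> borel_measurable lebesgue"
  proof (rule borel_measurable_LIMSEQ_real)
    show "(\<lambda>x. indicator (cball 0 (real i)) x *\<^sub>R u x) \<in> borel_measurable lebesgue" for i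
      using L[of i] by (simp add: Lp_on_def set_borel_measurable_def)
    fix x :: "real ^ 'n"
    obtain N where N: "norm x \<le> real N" using real_arch_simple by blast
    then have "indicator (cball 0 (real i)) x *\<^sub>R u x = u x" if "i \<ge> N" for i
    proof -
      have "norm x \<le> real i" using that N by linarith
      then show ?thesis by simp
    qed
    then show "(\<lambda>i. indicator (cball 0 (real i)) x *\<^sub>R u x) \<longlonglongrightarrow> u x"
      by (intro tendsto_eventually eventually_sequentiallyI)
  qed
  have "set_integrable lebesgue (cball 0 r) (\<lambda>x. (u x)\<^sup>2)"
    using L[of r] by (simp add: Lp_on_def)
  then have "(\<integral>\<^sup>+x. norm (indicator (cball 0 r) x *\<^sub>R (u x)\<^sup>2) \<partial>lebesgue) < \<infinity>"
    unfolding set_integrable_def integrable_iff_bounded by blast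
  also have "(\<integral>\<^sup>+x. norm (indicator (cball 0 r) x *\<^sub>R (u x)\<^sup>2) \<partial>lebesgue) = sq_int (cball 0 r) u"
    unfolding sq_int_def by (intro nn_integral_cong) (auto simp: indicator_def)
  finally show "sq_int (cball 0 r) u < \<infinity>" .
qed

lemma Lp_loc_2I:
  fixes u :: "real ^ 'n \<Rightarrow> real"
  assumes m[measurable]: "u \<in> borel_measurable lebesgue" and "\<And>r. sq_int (cball 0 r) u < \<infinity>"
  shows "Lp_loc 2 UNIV u"
  unfolding Lp_loc_def
proof (intro allI impI)
  fix K :: "(real ^ 'n) set" assume K: "compact K \<and> K \<subseteq> UNIV"
  then have [measurable]: "K \<in> sets lebesgue" by (simp add: compact_imp_closed)
  obtain r where r: "K \<subseteq> ball 0 r"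
    using K bounded_subset_ballD[OF compact_imp_bounded] by metis
  have "sq_int K u \<le> sq_int (cball 0 r) u" by (rule sq_int_mono_set) (use r in force)
  then have fin: "sq_int K u < \<infinity>" using assms(2)[of r] by (rule le_less_trans)
  have "set_integrable lebesgue K (\<lambda>x. (u x)\<^sup>2)"
    unfolding set_integrable_def integrable_iff_bounded
  proof
    have "(\<integral>\<^sup>+x. norm (indicator K x *\<^sub>R (u x)\<^sup>2) \<partial>lebesgue) = sq_int K u"
      unfolding sq_int_def by (intro nn_integral_cong) (auto simp: indicator_def)
    then show "(\<integral>\<^sup>+x. norm (indicator K x *\<^sub>R (u x)\<^sup>2) \<partial>lebesgue) < \<infinity>" using fin by simp
  qed measurable
  then show "Lp_on 2 K u" unfolding Lp_on_def set_borel_measurable_def by simp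
qed

text \<open>Up to the volume of the unit ball, \<open>asym_le f e\<close> says \<open>\<parallel>f\<parallel>\<^sub>2\<^sup>2 \<le> e\<close>; unlike \<^const>\<open>seminorm_p\<close> it has no junk
  value when the upper limit is infinite.\<close>

definition asym_le :: "(real ^ 'n \<Rightarrow> real) \<Rightarrow> real \<Rightarrow> bool" where
  "asym_le f e \<longleftrightarrow> (\<forall>\<^sub>F R in at_top. sq_int (ball 0 R) f \<le> ennreal (e * R ^ CARD('n)))"

lemma asym_le_add:
  fixes f g :: "real ^ 'n \<Rightarrow> real"
  assumes "f \<in> borel_measurable lebesgue" "g \<in> borel_measurable lebesgue"
    and "asym_le f a" "asym_le g b" "0 \<le> a" "0 \<le> b"
  shows "asym_le (\<lambda>x. f x + g x) (2 * a + 2 * b)"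
  unfolding asym_le_def
  using assms(3)[unfolded asym_le_def] assms(4)[unfolded asym_le_def] eventually_ge_at_top[of 0]
proof eventually_elim
  fix R :: real
  assume h: "sq_int (ball 0 R) f \<le> ennreal (a * R ^ CARD('n))" "sq_int (ball 0 R) g \<le> ennreal (b * R ^ CARD('n))" "0 \<le> R"
  have "sq_int (ball 0 R) (\<lambda>x. f x + g x) \<le> ennreal (2 * (a * R ^ CARD('n)) + 2 * (b * R ^ CARD('n)))"
    by (rule sq_int_add[OF assms(1,2) _ h(1,2)]) (use h assms in auto)
  then show "sq_int (ball 0 R) (\<lambda>x. f x + g x) \<le> ennreal ((2 * a + 2 * b) * R ^ CARD('n))"
    by (simp add: algebra_simps)
qed

lemma asym_le_mult:
  fixes f h :: "real ^ 'n \<Rightarrow> real"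
  assumes "f \<in> borel_measurable lebesgue" "asym_le f a" "0 \<le> a" "AE x in lebesgue. \<bar>h x\<bar> \<le> c"
  shows "asym_le (\<lambda>x. h x * f x) (c\<^sup>2 * a)"
  unfolding asym_le_def
  using assms(2)[unfolded asym_le_def] eventually_ge_at_top[of 0]
proof eventually_elim
  fix R :: real
  assume h: "sq_int (ball 0 R) f \<le> ennreal (a * R ^ CARD('n))" "0 \<le> R"
  have "sq_int (ball 0 R) (\<lambda>x. h x * f x) \<le> ennreal (c\<^sup>2 * (a * R ^ CARD('n)))"
    by (rule sq_int_bounded_mult[OF assms(1) _ h(1)]) (use h assms in auto)
  then show "sq_int (ball 0 R) (\<lambda>x. h x * f x) \<le> ennreal (c\<^sup>2 * a * R ^ CARD('n))"
    by (simp add: mult.assoc)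
qed

lemma asym_le_mono: "asym_le f a \<Longrightarrow> a \<le> b \<Longrightarrow> asym_le f b"
  for f :: "real ^ 'n \<Rightarrow> real"
  unfolding asym_le_def
  by (erule eventually_elim2[OF _ eventually_ge_at_top[of 0]])
    (erule order_trans, auto intro!: ennreal_leI mult_right_mono)

lemma asym_le_cong: "asym_le f a \<Longrightarrow> (\<And>x. \<bar>g x\<bar> = \<bar>f x\<bar>) \<Longrightarrow> asym_le g a"
  unfolding asym_le_def using sq_int_mono[of _ g f] by (auto elim!: eventually_mono intro: order_trans)

lemma sq_int_one:
  "sq_int S (\<lambda>_. 1 :: real) = emeasure lebesgue S" if "S \<in> sets lebesgue"
  using that by (simp add: sq_int_def)

lemma measure_ball_cart:
  assumes "R \<ge> 0"
  shows "measure lebesgue (ball (0 :: real ^ 'n) R) = unit_ball_vol (real CARD('n)) * R ^ CARD('n)"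
  using content_ball[OF assms, of "0 :: real ^ 'n"] by simp

lemma asym_le_one: "asym_le (\<lambda>_ :: real ^ 'n. 1) (unit_ball_vol (real CARD('n)))"
  unfolding asym_le_def
proof (rule eventually_mono[OF eventually_ge_at_top[of 0]])
  fix R :: real assume R: "R \<ge> 0"
  have "emeasure lebesgue (ball (0 :: real ^ 'n) R) = ennreal (measure lebesgue (ball (0 :: real ^ 'n) R))"
    by (intro emeasure_eq_ennreal_measure) (use emeasure_lborel_ball_finite[of "0::real^'n" R] in \<open>simp add: less_top\<close>)
  then show "sq_int (ball 0 R) (\<lambda>_ :: real ^ 'n. 1) \<le> ennreal (unit_ball_vol (real CARD('n)) * R ^ CARD('n))"
    using measure_ball_cart[OF R, where 'n = 'n] by (simp add: sq_int_one)
qed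

lemma BUC_D:
  fixes v :: "real ^ 'n \<Rightarrow> real"
  assumes "v \<in> BUC"
  shows "continuous_on UNIV v" "uniformly_continuous_on UNIV v" "\<exists>C>0. \<forall>x. \<bar>v x\<bar> \<le> C"
    "v \<in> borel_measurable lebesgue" "v \<in> borel_measurable borel" "loc_int v"
proof -
  show u: "uniformly_continuous_on UNIV v" using assms by (auto simp: BUC_def)
  show c: "continuous_on UNIV v" by (rule uniformly_continuous_imp_continuous[OF u])
  then show "loc_int v" "v \<in> borel_measurable borel"
    by (auto intro: continuous_loc_int borel_measurable_continuous_onI)
  then show "v \<in> borel_measurable lebesgue" by (simp add: measurable_completion)
  obtain C where "\<And>x. \<bar>v x\<bar> \<le> C" using assms by (auto simp: BUC_def bounded_iff)
  then show "\<exists>C>0. \<forall>x. \<bar>v x\<bar> \<le> C" by (intro exI[of _ "max C 1"]) (auto intro: max.coboundedI1)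
qed

lemma BUC_asym_le:
  assumes "v \<in> BUC" shows "\<exists>a\<ge>0. asym_le v a"
proof -
  obtain C where C: "\<forall>x. \<bar>v x\<bar> \<le> C" using BUC_D(3)[OF assms] by blast
  have "asym_le (\<lambda>x. v x * 1) (C\<^sup>2 * unit_ball_vol (real CARD('a)))"
    by (rule asym_le_mult[OF _ asym_le_one]) (use C in auto)
  then show ?thesis by (intro exI[of _ "C\<^sup>2 * unit_ball_vol (real CARD('a))"]) simp
qed

text \<open>One sufficiently large radius at which the eventual bound holds controls all smaller
  balls.\<close>

lemma asym_le_local_finite:
  fixes f :: "real ^ 'n \<Rightarrow> real"
  assumes "asym_le f a" shows "sq_int (cball 0 r) f < \<infinity>"
proof -
  have "\<forall>\<^sub>F R in at_top. sq_int (ball 0 R) f \<le> ennreal (a * R ^ CARD('n)) \<and> R > r"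
    using assms[unfolded asym_le_def] eventually_gt_at_top[of r] by (rule eventually_conj)
  then obtain R where R: "sq_int (ball 0 R) f \<le> ennreal (a * R ^ CARD('n))" "R > r"
    using eventually_happens'[OF trivial_limit_at_top_linorder] by blast
  have "sq_int (cball 0 r) f \<le> sq_int (ball 0 R) f" by (rule sq_int_mono_set) (use R in auto)
  also have "\<dots> < \<infinity>" using R(1) le_less_trans by fastforce
  finally show ?thesis .
qed

lemma unit_ball_vol_card_nonzero [simp]: "unit_ball_vol (real CARD('n :: finite)) \<noteq> 0"
  using unit_ball_vol_pos[of "real CARD('n)"] by linarith

text \<open>Passage from the averaged real integral in \<open>limsup_mean_power\<close> to
  \<open>sq_int\<close>. The finiteness assumption rules out the default value 0 that the Lebesgue
  integral takes on nonintegrable functions.\<close>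

lemma mean_power_eq:
  fixes f :: "real ^ 'n \<Rightarrow> real"
  assumes [measurable]: "f \<in> borel_measurable lebesgue" and "sq_int (cball 0 R) f < \<infinity>" and "R > 0"
  shows "ennreal ((1 / measure lebesgue (ball (0 :: real ^ 'n) R) * (LINT y:ball 0 R|lebesgue. \<bar>f y\<bar> powr 2))
      * (unit_ball_vol (real CARD('n)) * R ^ CARD('n))) = sq_int (ball 0 R) f"
proof -
  have "sq_int (ball 0 R) f \<le> sq_int (cball 0 R) f" by (intro sq_int_mono_set) auto
  then have fin: "sq_int (ball 0 R) f < \<infinity>" using assms(2) by (rule le_less_trans)
  have e: "(\<integral>\<^sup>+x. ennreal (indicator (ball 0 R) x *\<^sub>R (f x)\<^sup>2) \<partial>lebesgue) = sq_int (ball 0 R) f"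
    unfolding sq_int_def by (intro nn_integral_cong) (auto simp: indicator_def)
  have int: "integrable lebesgue (\<lambda>x. indicator (ball 0 R) x *\<^sub>R (f x)\<^sup>2)"
    by (rule integrableI_nonneg)
      (use e fin in \<open>auto intro!: borel_measurable_times borel_measurable_indicator borel_measurable_power assms(1)\<close>)
  have "ennreal (LINT y:ball 0 R|lebesgue. \<bar>f y\<bar> powr 2) = sq_int (ball 0 R) f"
    unfolding set_lebesgue_integral_def e[symmetric]
    using nn_integral_eq_integral[OF int] by simp
  moreover have "measure lebesgue (ball (0 :: real ^ 'n) R) > 0"
    using content_ball_pos[OF \<open>R > 0\<close>, of "0 :: real ^ 'n"] by simp
  moreover have "unit_ball_vol (real CARD('n)) > 0" by (rule unit_ball_vol_pos) simp
  ultimately show ?thesis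
    using measure_ball_cart[of R, where 'n = 'n] \<open>R > 0\<close> by simp
qed

lemma limsup_mean_power_le:
  fixes f :: "real ^ 'n \<Rightarrow> real"
  assumes m: "f \<in> borel_measurable lebesgue" and a: "asym_le f a" "0 \<le> a"
  shows "limsup_mean_power 2 f \<le> ereal (a / unit_ball_vol (real CARD('n)))"
  unfolding limsup_mean_power_def
proof (rule Limsup_bounded, use a(1)[unfolded asym_le_def] eventually_gt_at_top[of 0] in eventually_elim)
  fix R :: real
  assume R: "sq_int (ball 0 R) f \<le> ennreal (a * R ^ CARD('n))" "R > 0"
  let ?V = "unit_ball_vol (real CARD('n))"
  have V: "?V > 0" by (rule unit_ball_vol_pos) simp
  let ?m = "1 / measure lebesgue (ball (0 :: real ^ 'n) R) * (LINT y:ball 0 R|lebesgue. \<bar>f y\<bar> powr 2)"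
  have "ennreal (?m * (?V * R ^ CARD('n))) \<le> ennreal (a * R ^ CARD('n))"
    using R(1) mean_power_eq[OF m asym_le_local_finite[OF a(1)] R(2)] by simp
  then have "?m * (?V * R ^ CARD('n)) \<le> a * R ^ CARD('n)"
    by (rule ennreal_le_iff[THEN iffD1, rotated]) (use a R in auto)
  then have "(?m * ?V) * R ^ CARD('n) \<le> a * R ^ CARD('n)" by (simp only: mult.assoc)
  then have "?m * ?V \<le> a" using R(2) by (subst (asm) mult_le_cancel_right) auto
  then show "ereal ?m \<le> ereal (a / ?V)" using V by (simp add: field_simps)
qed

lemma limsup_mean_power_nonneg:
  fixes f :: "real ^ 'n \<Rightarrow> real" shows "0 \<le> limsup_mean_power 2 f"
  unfolding limsup_mean_power_def
  by (rule le_Limsup) (auto intro!: always_eventually mult_nonneg_nonneg integral_nonneg_AE simp: set_lebesgue_integral_def)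

lemma limsup_mean_power_less_imp:
  fixes f :: "real ^ 'n \<Rightarrow> real"
  assumes m: "f \<in> borel_measurable lebesgue" and fin: "\<And>r. sq_int (cball 0 r) f < \<infinity>"
    and less: "limsup_mean_power 2 f < ereal e"
  shows "asym_le f (e * unit_ball_vol (real CARD('n)))"
  unfolding asym_le_def
  using Limsup_lessD[OF less[unfolded limsup_mean_power_def]] eventually_gt_at_top[of 0]
proof eventually_elim
  fix R :: real
  let ?V = "unit_ball_vol (real CARD('n))"
  let ?m = "1 / measure lebesgue (ball (0 :: real ^ 'n) R) * (LINT y:ball 0 R|lebesgue. \<bar>f y\<bar> powr 2)"
  assume R: "ereal ?m < ereal e" "R > 0"
  have "sq_int (ball 0 R) f = ennreal (?m * (?V * R ^ CARD('n)))"
    by (rule mean_power_eq[OF m fin R(2), symmetric])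
  also have "\<dots> \<le> ennreal (e * (?V * R ^ CARD('n)))"
    using R by (intro ennreal_leI mult_right_mono) auto
  finally show "sq_int (ball 0 R) f \<le> ennreal (e * ?V * R ^ CARD('n))" by (simp add: mult.assoc)
qed

lemma seminorm_p_le:
  fixes f :: "real ^ 'n \<Rightarrow> real"
  assumes m: "f \<in> borel_measurable lebesgue" and a: "asym_le f a" "0 \<le> a"
  shows "seminorm_p 2 f \<le> sqrt (a / unit_ball_vol (real CARD('n)))"
proof -
  have "limsup_mean_power 2 f \<le> ereal (a / unit_ball_vol (real CARD('n)))"
    by (rule limsup_mean_power_le[OF assms])
  moreover note limsup_mean_power_nonneg[of f]
  ultimately obtain l where "limsup_mean_power 2 f = ereal l" "0 \<le> l" "l \<le> a / unit_ball_vol (real CARD('n))"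
    by (cases "limsup_mean_power 2 f") auto
  then show ?thesis by (simp add: seminorm_p_def powr_half_sqrt)
qed

text \<open>Finiteness of the upper limit is assumed because
  \<open>real_of_ereal \<infinity> = 0\<close>: a small value of \<open>seminorm_p\<close> alone
  would be compatible with an infinite upper limit.\<close>

lemma seminorm_p_less_imp:
  fixes f :: "real ^ 'n \<Rightarrow> real"
  assumes m: "f \<in> borel_measurable lebesgue" and fin: "\<And>r. sq_int (cball 0 r) f < \<infinity>"
    and "limsup_mean_power 2 f < \<infinity>" and less: "seminorm_p 2 f < e"
  shows "asym_le f (e\<^sup>2 * unit_ball_vol (real CARD('n)))"
proof (rule limsup_mean_power_less_imp[OF m fin])
  note limsup_mean_power_nonneg[of f]
  with assms(3) obtain l where l: "limsup_mean_power 2 f = ereal l" "0 \<le> l"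
    by (cases "limsup_mean_power 2 f") auto
  then have "sqrt l < e" using less by (simp add: seminorm_p_def powr_half_sqrt)
  then have "l < e\<^sup>2" using l(2) by (metis real_sqrt_less_iff real_sqrt_ge_zero real_sqrt_abs abs_of_nonneg le_less_trans less_imp_le)
  then show "limsup_mean_power 2 f < ereal (e\<^sup>2)" using l by simp
qed

text \<open>The last conclusion is the working form of membership: approximation by the algebra
  measured with \<open>asym_le\<close>. The one before it guarantees that seminorms of differences
  \<open>u - v\<close> are genuine, so that the two forms can be exchanged.\<close>

lemma besicovitchD:
  fixes u :: "real ^ 'n \<Rightarrow> real"
  assumes u: "u \<in> besicovitch 2 \<A>" and \<A>: "\<A> \<subseteq> BUC"
  shows "u \<in> borel_measurable lebesgue" "loc_int u" "\<exists>a\<ge>0. asym_le u a"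
    "v \<in> \<A> \<Longrightarrow> limsup_mean_power 2 (\<lambda>x. u x - v x) < \<infinity>"
    "\<epsilon> > 0 \<Longrightarrow> \<exists>v\<in>\<A>. asym_le (\<lambda>x. u x - v x) \<epsilon>"
proof -
  have L: "Lp_loc 2 UNIV u" and lim: "limsup_mean_power 2 u < \<infinity>"
    using u by (auto simp: besicovitch_def finite_seminorm_space_def)
  show m: "u \<in> borel_measurable lebesgue" by (rule Lp_loc_2D[OF L])
  have fin: "\<And>r. sq_int (cball 0 r) u < \<infinity>" by (rule Lp_loc_2D[OF L])
  then show "loc_int u" by (rule sq_int_loc_int[OF m])
  obtain e where e: "limsup_mean_power 2 u < ereal e" "e > 0"
    using lim limsup_mean_power_nonneg[of u]
    by (cases "limsup_mean_power 2 u") (auto intro: that[of "real_of_ereal (limsup_mean_power 2 u) + 1"])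
  have as: "asym_le u (e * unit_ball_vol (real CARD('n)))" by (rule limsup_mean_power_less_imp[OF m fin e(1)])
  moreover have "e * unit_ball_vol (real CARD('n)) \<ge> 0" using e by simp
  ultimately show a: "\<exists>a\<ge>0. asym_le u a" by blast
  have *: "\<exists>a\<ge>0. asym_le (\<lambda>x. u x - v x) a" if "v \<in> \<A>" for v
  proof -
    have v: "v \<in> BUC" using that \<A> by blast
    obtain a b where ab: "asym_le u a" "asym_le v b" "0 \<le> a" "0 \<le> b" using a BUC_asym_le[OF v] by blast
    have "asym_le (\<lambda>x. - v x) b" by (rule asym_le_cong[OF ab(2)]) simp
    from asym_le_add[OF m _ ab(1) this ab(3,4)] BUC_D(4)[OF v] show ?thesis
      using ab(3,4) by (intro exI[of _ "2 * a + 2 * b"]) simp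
  qed
  have d: "(\<lambda>x. u x - v x) \<in> borel_measurable lebesgue" if "v \<in> \<A>" for v
    using m BUC_D(4) that \<A> by (intro borel_measurable_diff) auto
  show lf: "limsup_mean_power 2 (\<lambda>x. u x - v x) < \<infinity>" if v: "v \<in> \<A>" for v
  proof -
    obtain a where "a \<ge> 0" "asym_le (\<lambda>x. u x - v x) a" using *[OF v] by blast
    from limsup_mean_power_le[OF d[OF v] this(2,1)] show ?thesis by (auto intro: le_less_trans)
  qed
  show "\<exists>v\<in>\<A>. asym_le (\<lambda>x. u x - v x) \<epsilon>" if \<epsilon>: "\<epsilon> > 0" for \<epsilon>
  proof -
    let ?V = "unit_ball_vol (real CARD('n))"
    have V: "?V > 0" by (rule unit_ball_vol_pos) simp
    then have "sqrt (\<epsilon> / ?V) > 0" using \<epsilon> by simp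
    moreover have "\<forall>e>0. \<exists>v\<in>\<A>. seminorm_p 2 (\<lambda>x. u x - v x) < e"
      using u by (auto simp: besicovitch_def)
    ultimately obtain v where v: "v \<in> \<A>" "seminorm_p 2 (\<lambda>x. u x - v x) < sqrt (\<epsilon> / ?V)"
      by blast
    obtain a where "asym_le (\<lambda>x. u x - v x) a" using *[OF v(1)] by blast
    from seminorm_p_less_imp[OF d[OF v(1)] asym_le_local_finite[OF this] lf[OF v(1)] v(2)]
    have "asym_le (\<lambda>x. u x - v x) \<epsilon>" using V \<epsilon> by simp
    then show ?thesis using v(1) by blast
  qed
qed

text \<open>Approximation alone suffices: an approximant at squared distance 1 is bounded, and this
  already makes the seminorm of \<open>u\<close> finite.\<close>

lemma besicovitchI:
  fixes u :: "real ^ 'n \<Rightarrow> real"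
  assumes m: "u \<in> borel_measurable lebesgue" and \<A>: "\<A> \<subseteq> BUC"
    and "\<And>\<epsilon>. \<epsilon> > 0 \<Longrightarrow> \<exists>v\<in>\<A>. asym_le (\<lambda>x. u x - v x) \<epsilon>"
  shows "u \<in> besicovitch 2 \<A>"
proof -
  let ?V = "unit_ball_vol (real CARD('n))"
  have V: "?V > 0" by (rule unit_ball_vol_pos) simp
  obtain v where v: "v \<in> \<A>" "asym_le (\<lambda>x. u x - v x) 1" using assms(3)[of 1] by auto
  then have vB: "v \<in> BUC" using \<A> by blast
  obtain a where a: "asym_le v a" "a \<ge> 0" using BUC_asym_le[OF vB] by blast
  have "asym_le (\<lambda>x. (u x - v x) + v x) (2 * 1 + 2 * a)"
    by (rule asym_le_add[OF _ _ v(2) a(1)]) (use m a BUC_D(4)[OF vB] in auto)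
  then have as: "asym_le u (2 + 2 * a)" by simp
  have "u \<in> finite_seminorm_space 2"
    unfolding finite_seminorm_space_def
    using limsup_mean_power_le[OF m as] a Lp_loc_2I[OF m asym_le_local_finite[OF as]]
    by (auto intro: le_less_trans)
  moreover have "\<exists>v\<in>\<A>. seminorm_p 2 (\<lambda>x. u x - v x) < \<epsilon>" if \<epsilon>: "\<epsilon> > 0" for \<epsilon>
  proof -
    have "(\<epsilon> / 2)\<^sup>2 * ?V > 0" using \<epsilon> V by simp
    then obtain v where v: "v \<in> \<A>" "asym_le (\<lambda>x. u x - v x) ((\<epsilon> / 2)\<^sup>2 * ?V)" using assms(3) by blast
    have "seminorm_p 2 (\<lambda>x. u x - v x) \<le> sqrt (((\<epsilon> / 2)\<^sup>2 * ?V) / ?V)"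
      by (rule seminorm_p_le[OF _ v(2)]) (use m BUC_D(4)[of v] v(1) \<A> V in \<open>auto intro!: borel_measurable_diff\<close>)
    also have "\<dots> = sqrt ((\<epsilon> / 2)\<^sup>2)" using V by (subst nonzero_mult_div_cancel_right) auto
    also have "\<dots> = \<epsilon> / 2" using \<epsilon> by simp
    finally show ?thesis using v(1) \<epsilon> by force
  qed
  ultimately show ?thesis by (simp add: besicovitch_def)
qed

lemma has_mean_value_at_top:
  fixes v :: "real ^ 'n \<Rightarrow> real"
  assumes "has_mean_value v m" "integrable lebesgue \<phi>"
  shows "((\<lambda>R. LINT x|lebesgue. v (R *\<^sub>R x) * \<phi> x) \<longlongrightarrow> m * (LINT x|lebesgue. \<phi> x)) at_top"
proof -
  have "((\<lambda>\<epsilon>. LINT x|lebesgue. v (x /\<^sub>R \<epsilon>) * \<phi> x) \<longlongrightarrow> (LINT x|lebesgue. m * \<phi> x)) (at_right 0)"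
    using assms by (auto simp: has_mean_value_def)
  from filterlim_compose[OF this filterlim_inverse_at_right_top]
  show ?thesis by simp
qed

text \<open>Two candidate values are compared by testing with a single function of integral
  1.\<close>

lemma mean_value_eq:
  fixes v :: "real ^ 'n \<Rightarrow> real"
  assumes "has_mean_value v m"
  shows "mean_value v = m"
  unfolding mean_value_def
proof (rule the_equality, rule assms)
  fix m' assume m': "has_mean_value v m'"
  obtain k :: "real ^ 'n \<Rightarrow> real" where k: "mollifier 1 k" using mollifier_exists by blast
  have "m' * (LINT x|lebesgue. k x) = m * (LINT x|lebesgue. k x)"
    by (rule tendsto_unique[OF trivial_limit_at_top_linorder
          has_mean_value_at_top[OF m' mollifierD(6)[OF k]] has_mean_value_at_top[OF assms mollifierD(6)[OF k]]])
  then show "m' = m" using mollifierD(4)[OF k] by simp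
qed

section \<open>Cubes and averages over cubes\<close>

lemma cube_sets: "cube R \<in> sets borel" "interior (cube R) \<in> sets borel"
    "cube R \<in> sets lebesgue" "interior (cube R) \<in> sets lebesgue"
  by (auto simp: cube_def)

lemma mem_cube: "x \<in> (cube R :: (real ^ 'n) set) \<longleftrightarrow> (\<forall>i. \<bar>x $ i\<bar> \<le> R / 2)"
  unfolding cube_def mem_box_cart by (intro iff_allI) (auto simp: abs_le_iff)

lemma mem_interior_cube: "x \<in> interior (cube R :: (real ^ 'n) set) \<longleftrightarrow> (\<forall>i. \<bar>x $ i\<bar> < R / 2)"
  unfolding cube_def interior_cbox mem_box_cart by (intro iff_allI) (auto simp: abs_less_iff)

lemma measure_cube:
  assumes "R \<ge> 0"
  shows "measure lebesgue (cube R :: (real ^ 'n) set) = R ^ CARD('n)"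
proof -
  have "cube R \<noteq> ({} :: (real ^ 'n) set)" using mem_cube[of "0 :: real ^ 'n" R] assms by auto
  then show ?thesis unfolding cube_def by (simp add: content_cbox_cart)
qed

lemma emeasure_cube:
  assumes "R \<ge> 0"
  shows "emeasure lebesgue (cube R :: (real ^ 'n) set) = ennreal (R ^ CARD('n))"
  unfolding measure_cube[OF assms, symmetric, where 'n = 'n]
  by (intro emeasure_eq_ennreal_measure)
    (use emeasure_lborel_cbox_finite[of "(\<chi> i. - R / 2) :: real ^ 'n" "\<chi> i. R / 2"] in \<open>simp add: cube_def less_top\<close>)

lemma cube_subset_ball:
  assumes "R > 0" shows "cube R \<subseteq> ball (0 :: real ^ 'n) (real CARD('n) * R)"
proof
  fix x :: "real ^ 'n" assume "x \<in> cube R"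
  then have "norm x \<le> (\<Sum>i\<in>(UNIV :: 'n set). R / 2)"
    by (intro order_trans[OF norm_le_l1_cart] sum_mono) (simp add: mem_cube)
  also have "\<dots> < real CARD('n) * R" using assms by simp
  finally show "x \<in> ball 0 (real CARD('n) * R)" by simp
qed

lemma cube_scale:
  assumes "R > 0" shows "R *\<^sub>R x \<in> cube R \<longleftrightarrow> x \<in> (cube 1 :: (real ^ 'n) set)"
  unfolding mem_cube using assms by (simp add: abs_mult field_simps)

lemma cube_integral_scale:
  fixes v :: "real ^ 'n \<Rightarrow> real"
  assumes [measurable]: "v \<in> borel_measurable borel" and R: "R > 0"
  shows "(LINT x:cube R|lebesgue. v x) = R ^ CARD('n) * (LINT x:cube 1|lebesgue. v (R *\<^sub>R x))"
proof -
  have "(\<lambda>x. indicator (cube R) x *\<^sub>R v x) \<in> borel_measurable borel"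
    by (intro borel_measurable_scaleR borel_measurable_indicator cube_sets assms(1))
  from lebesgue_integral_affine[OF this, of R 0] show ?thesis
    unfolding set_lebesgue_integral_def using R cube_scale[OF R, where 'n = 'n] by (simp add: indicator_def)
qed

text \<open>After dilation to the unit cube, weak-* convergence is tested against its indicator. The
  homogenisation problem lives on cubes, whereas the seminorms average over balls.\<close>

lemma mean_value_cube:
  fixes v :: "real ^ 'n \<Rightarrow> real"
  assumes [measurable]: "v \<in> borel_measurable borel" and "has_mean_value v m"
  shows "((\<lambda>R. (LINT x:cube R|lebesgue. v x) / R ^ CARD('n)) \<longlongrightarrow> m) at_top"
proof -
  have i: "integrable lebesgue (indicator (cube 1 :: (real ^ 'n) set) :: _ \<Rightarrow> real)"
    using emeasure_cube[of 1, where 'n = 'n] cube_sets(1)[of 1]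
    by (intro integrable_real_indicator) auto
  have "(LINT x|lebesgue. indicator (cube 1 :: (real ^ 'n) set) x) = (1 :: real)"
    using measure_cube[of 1, where 'n = 'n] by simp
  with has_mean_value_at_top[OF assms(2) i]
  have "((\<lambda>R. LINT x|lebesgue. v (R *\<^sub>R x) * indicator (cube 1) x) \<longlongrightarrow> m) at_top" by simp
  then show ?thesis
  proof (rule Lim_transform_eventually)
    show "\<forall>\<^sub>F R in at_top. (LINT x|lebesgue. v (R *\<^sub>R x) * indicator (cube 1) x) =
        (LINT x:cube R|lebesgue. v x) / R ^ CARD('n)"
      using eventually_gt_at_top[of 0]
    proof eventually_elim
      fix R :: real assume "0 < R"
      then show "(LINT x|lebesgue. v (R *\<^sub>R x) * indicator (cube 1) x) =
          (LINT x:cube R|lebesgue. v x) / R ^ CARD('n)"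
        unfolding cube_integral_scale[OF assms(1) \<open>0 < R\<close>]
        by (simp add: set_lebesgue_integral_def mult.commute)
    qed
  qed
qed

lemma asym_le_scaled_ball:
  fixes f :: "real ^ 'n \<Rightarrow> real"
  assumes "asym_le f a" "c > 0"
  shows "\<forall>\<^sub>F R in at_top. sq_int (ball 0 (c * R)) f \<le> ennreal (a * c ^ CARD('n) * R ^ CARD('n))"
proof -
  have "filterlim (\<lambda>R. c * R) at_top at_top"
    using assms(2) by (intro filterlim_tendsto_pos_mult_at_top[OF tendsto_const _ filterlim_ident]) auto
  from eventually_compose_filterlim[OF assms(1)[unfolded asym_le_def] this]
  show ?thesis by (simp add: power_mult_distrib mult.assoc)
qed

text \<open>Cauchy-Schwarz against the constant 1. The factor \<open>CARD('n) ^ CARD('n)\<close>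
  comes from enclosing \<open>cube R\<close> in the ball of radius
  \<open>CARD('n) * R\<close>.\<close>

lemma cube_mean_bound:
  fixes f :: "real ^ 'n \<Rightarrow> real"
  assumes m: "f \<in> borel_measurable lebesgue" and a: "asym_le f a" "0 \<le> a"
  shows "\<forall>\<^sub>F R in at_top. \<bar>(LINT x:cube R|lebesgue. f x) / R ^ CARD('n)\<bar> \<le> sqrt (a * real CARD('n) ^ CARD('n))"
proof -
  have n: "real CARD('n) > 0" by simp
  show ?thesis
    using asym_le_scaled_ball[OF a(1) n] eventually_gt_at_top[of 0]
  proof eventually_elim
    fix R :: real
    let ?c = "real CARD('n) ^ CARD('n)"
    assume h: "sq_int (ball 0 (real CARD('n) * R)) f \<le> ennreal (a * ?c * R ^ CARD('n))" "0 < R"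
    have "sq_int (cube R) f \<le> ennreal (a * ?c * R ^ CARD('n))"
      using sq_int_mono_set[OF cube_subset_ball[OF h(2)], of f] h(1) by (rule order_trans)
    moreover have "sq_int (cube R :: (real ^ 'n) set) (\<lambda>_. 1) \<le> ennreal (R ^ CARD('n))"
      unfolding sq_int_one[OF cube_sets(3)] using emeasure_cube[of R, where 'n = 'n] h(2) by simp
    ultimately have "\<bar>LINT x:cube R|lebesgue. f x * 1\<bar> \<le> sqrt ((a * ?c * R ^ CARD('n)) * R ^ CARD('n))"
      by (intro sq_int_CS(2)[OF m]) (use a h(2) cube_sets(3)[of R] in auto)
    also have "\<dots> = sqrt ((a * ?c) * (R ^ CARD('n))\<^sup>2)" by (simp add: power2_eq_square mult.assoc)
    also have "\<dots> = sqrt (a * ?c) * R ^ CARD('n)"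
      using h(2) by (simp only: real_sqrt_mult real_sqrt_abs) simp
    finally show "\<bar>(LINT x:cube R|lebesgue. f x) / R ^ CARD('n)\<bar> \<le> sqrt (a * ?c)"
      using h(2) by (simp add: field_simps)
  qed
qed

lemma loc_int_cube: "loc_int f \<Longrightarrow> set_integrable lebesgue (cube R) f"
  for f :: "real ^ 'n \<Rightarrow> real"
proof -
  assume f: "loc_int f"
  have "bounded (cube R :: (real ^ 'n) set)" unfolding cube_def by (rule bounded_cbox)
  then obtain r where r: "cube R \<subseteq> ball (0 :: real ^ 'n) r" using bounded_subset_ballD by metis
  show ?thesis
    by (rule set_integrable_subset[of _ "cball 0 r"]) (use f r cube_sets(3)[of R] in \<open>auto simp: loc_int_def subset_iff\<close>)
qed

lemma cube_mean_diff_bound: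
  fixes u v :: "real ^ 'n \<Rightarrow> real"
  assumes u: "loc_int u" "loc_int v" and a: "asym_le (\<lambda>x. u x - v x) a" "0 \<le> a"
  shows "\<forall>\<^sub>F R in at_top. \<bar>(LINT x:cube R|lebesgue. u x) / R ^ CARD('n) -
     (LINT x:cube R|lebesgue. v x) / R ^ CARD('n)\<bar> \<le> sqrt (a * real CARD('n) ^ CARD('n))"
proof -
  have "(\<lambda>x. u x - v x) \<in> borel_measurable lebesgue" using u by (auto simp: loc_int_def)
  from cube_mean_bound[OF this a] show ?thesis
    using loc_int_cube[OF u(1)] loc_int_cube[OF u(2)]
    by (simp add: set_integral_diff diff_divide_distrib)
qed

lemma algebra_wmvD:
  assumes "algebra_wmv \<A>"
  shows "\<A> \<subseteq> BUC" "v \<in> \<A> \<Longrightarrow> w \<in> \<A> \<Longrightarrow> (\<lambda>x. v x + w x) \<in> \<A>"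
    "v \<in> \<A> \<Longrightarrow> w \<in> \<A> \<Longrightarrow> (\<lambda>x. v x * w x) \<in> \<A>" "(\<lambda>x. c) \<in> \<A>"
    "v \<in> \<A> \<Longrightarrow> has_mean_value v (mean_value v)"
proof -
  note a = assms[unfolded algebra_wmv_def]
  show "\<A> \<subseteq> BUC" "v \<in> \<A> \<Longrightarrow> w \<in> \<A> \<Longrightarrow> (\<lambda>x. v x + w x) \<in> \<A>"
    "v \<in> \<A> \<Longrightarrow> w \<in> \<A> \<Longrightarrow> (\<lambda>x. v x * w x) \<in> \<A>" "(\<lambda>x. c) \<in> \<A>"
    using a by blast+
  show "has_mean_value v (mean_value v)" if "v \<in> \<A>"
  proof -
    have "\<forall>u\<in>\<A>. \<exists>m. has_mean_value u m" using a by (elim conjE)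
    then have "\<exists>m. has_mean_value v m" using \<open>v \<in> \<A>\<close> by (rule bspec)
    then obtain m where m: "has_mean_value v m" ..
    show ?thesis using m unfolding mean_value_eq[OF m] .
  qed
qed

text \<open>For large cubes the averages of \<open>u\<close> and of an approximant differ by at most
  a multiple of their distance. Hence the mean values of approximants form a Cauchy sequence, whose
  limit is both the limit of the averages of \<open>u\<close> and the number described in
  \<open>mean_ext\<close>. The second conclusion keeps the quantitative estimate, which is needed to
  show that approximants of a mean-zero function have small mean value.\<close>

lemma mean_ext_limit:
  fixes u :: "real ^ 'n \<Rightarrow> real"
  assumes \<A>: "algebra_wmv \<A>" and u: "u \<in> besicovitch 2 \<A>"
  shows "((\<lambda>R. (LINT x:cube R|lebesgue. u x) / R ^ CARD('n)) \<longlongrightarrow> mean_ext 2 \<A> u) at_top"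
    and "\<And>v a. v \<in> \<A> \<Longrightarrow> asym_le (\<lambda>x. u x - v x) a \<Longrightarrow> 0 \<le> a \<Longrightarrow>
       \<bar>mean_value v - mean_ext 2 \<A> u\<bar> \<le> sqrt (a * real CARD('n) ^ CARD('n))"
proof -
  let ?K = "real CARD('n) ^ CARD('n)"
  let ?avg = "\<lambda>f R. (LINT x:cube R|lebesgue. (f :: real ^ 'n \<Rightarrow> real) x) / R ^ CARD('n)"
  note AB = algebra_wmvD(1)[OF \<A>]
  note uD = besicovitchD[OF u AB]
  have vB: "v \<in> BUC" if "v \<in> \<A>" for v using that AB by blast
  have lim_v: "(?avg v \<longlongrightarrow> mean_value v) at_top" if "v \<in> \<A>" for v
    by (rule mean_value_cube[OF BUC_D(5)[OF vB[OF that]] algebra_wmvD(5)[OF \<A> that]])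
  have ev: "\<forall>\<^sub>F R in at_top. \<bar>?avg u R - ?avg v R\<bar> \<le> sqrt (a * ?K)"
    if "v \<in> \<A>" "asym_le (\<lambda>x. u x - v x) a" "0 \<le> a" for v a
    by (rule cube_mean_diff_bound[OF uD(2) BUC_D(6)[OF vB[OF that(1)]] that(2,3)])
  have dist_vw: "\<bar>mean_value v - mean_value w\<bar> \<le> sqrt (a * ?K) + sqrt (b * ?K)"
    if v: "v \<in> \<A>" "asym_le (\<lambda>x. u x - v x) a" "0 \<le> a"
      and w: "w \<in> \<A>" "asym_le (\<lambda>x. u x - w x) b" "0 \<le> b" for v w a b
  proof (rule tendsto_upperbound)
    show "((\<lambda>R. \<bar>?avg v R - ?avg w R\<bar>) \<longlongrightarrow> \<bar>mean_value v - mean_value w\<bar>) at_top"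
      by (intro tendsto_intros lim_v v w)
    show "\<forall>\<^sub>F R in at_top. \<bar>?avg v R - ?avg w R\<bar> \<le> sqrt (a * ?K) + sqrt (b * ?K)"
      using ev[OF v] ev[OF w] by eventually_elim linarith
  qed simp
  \<comment> \<open>A fixed approximating sequence with an explicit rate; the limit of its mean
    values will be the extended mean value.\<close>
  have "\<forall>k. \<exists>v. v \<in> \<A> \<and> asym_le (\<lambda>x. u x - v x) (inverse (real (Suc k)))"
    using uD(5)[of "inverse (real (Suc k))" for k] by (metis inverse_positive_iff_positive of_nat_0_less_iff zero_less_Suc)
  then obtain v where v: "\<And>k. v k \<in> \<A>" "\<And>k. asym_le (\<lambda>x. u x - v k x) (inverse (real (Suc k)))"
    by metis
  define e where "e k = sqrt (inverse (real (Suc k)) * ?K)" for k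
  have e_lim: "e \<longlonglongrightarrow> 0"
  proof -
    have "(\<lambda>k. sqrt (inverse (real (Suc k)) * ?K)) \<longlonglongrightarrow> sqrt (0 * ?K)"
      by (intro tendsto_intros LIMSEQ_inverse_real_of_nat)
    then show ?thesis by (simp add: e_def[abs_def])
  qed
  have dist_k: "\<bar>mean_value w - mean_value (v k)\<bar> \<le> sqrt (a * ?K) + e k"
    if "w \<in> \<A>" "asym_le (\<lambda>x. u x - w x) a" "0 \<le> a" for w a k
    unfolding e_def by (rule dist_vw[OF that v]) simp
  have "Cauchy (\<lambda>k. mean_value (v k))"
  proof (rule metric_CauchyI)
    fix \<epsilon> :: real assume "\<epsilon> > 0"
    then have "\<forall>\<^sub>F k in sequentially. e k < \<epsilon> / 2" using order_tendstoD(2)[OF e_lim, of "\<epsilon> / 2"] by simp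
    then obtain N where N: "\<And>k. k \<ge> N \<Longrightarrow> e k < \<epsilon> / 2" by (auto simp: eventually_sequentially)
    show "\<exists>M. \<forall>m\<ge>M. \<forall>n\<ge>M. dist (mean_value (v m)) (mean_value (v n)) < \<epsilon>"
    proof (intro exI[of _ N] allI impI)
      fix m n assume "m \<ge> N" "n \<ge> N"
      then have "e m < \<epsilon> / 2" "e n < \<epsilon> / 2" using N by auto
      moreover have "\<bar>mean_value (v m) - mean_value (v n)\<bar> \<le> e m + e n"
        using dist_k[OF v(1) v(2), of m n] by (simp add: e_def)
      ultimately show "dist (mean_value (v m)) (mean_value (v n)) < \<epsilon>" by (simp add: dist_real_def)
    qed
  qed
  then obtain m where m: "(\<lambda>k. mean_value (v k)) \<longlonglongrightarrow> m" using Cauchy_convergent convergent_def by blast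
  \<comment> \<open>Letting \<open>k\<close> tend to infinity in the comparison with
    \<open>v k\<close> removes the error \<open>e k\<close> and frees the estimate from the chosen
    sequence.\<close>
  have dist_m: "\<bar>mean_value w - m\<bar> \<le> sqrt (a * ?K)" if "w \<in> \<A>" "asym_le (\<lambda>x. u x - w x) a" "0 \<le> a" for w a
  proof (rule LIMSEQ_le)
    show "(\<lambda>k. \<bar>mean_value w - mean_value (v k)\<bar>) \<longlonglongrightarrow> \<bar>mean_value w - m\<bar>"
      by (intro tendsto_intros m)
    show "(\<lambda>k. sqrt (a * ?K) + e k) \<longlonglongrightarrow> sqrt (a * ?K)"
      using tendsto_add[OF tendsto_const e_lim, of "sqrt (a * ?K)"] by simp
  qed (use dist_k[OF that] in blast)
  have lim: "(?avg u \<longlongrightarrow> m) at_top"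
  proof (rule tendstoI)
    fix \<epsilon> :: real assume \<epsilon>: "\<epsilon> > 0"
    then have "\<forall>\<^sub>F k in sequentially. e k < \<epsilon> / 3" using order_tendstoD(2)[OF e_lim, of "\<epsilon> / 3"] by simp
    then obtain k where k: "e k < \<epsilon> / 3" by (auto simp: eventually_sequentially)
    have 1: "\<forall>\<^sub>F R in at_top. \<bar>?avg u R - ?avg (v k) R\<bar> \<le> e k" unfolding e_def by (rule ev[OF v]) simp
    have 2: "\<forall>\<^sub>F R in at_top. dist (?avg (v k) R) (mean_value (v k)) < \<epsilon> / 3"
      using \<epsilon> by (intro tendstoD[OF lim_v[OF v(1)]]) auto
    have 3: "\<bar>mean_value (v k) - m\<bar> \<le> e k" unfolding e_def by (rule dist_m[OF v]) simp
    show "\<forall>\<^sub>F R in at_top. dist (?avg u R) m < \<epsilon>"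
      using 1 2 by eventually_elim (use 3 k in \<open>simp only: dist_real_def; linarith\<close>)
  qed
  \<comment> \<open>The definite description requires both that \<open>m\<close> is the limit along
    every approximating sequence and that no other number is.\<close>
  have "mean_ext 2 \<A> u = m"
    unfolding mean_ext_def
  proof (rule the_equality)
    let ?V = "unit_ball_vol (real CARD('n))"
    have V: "?V > 0" by (rule unit_ball_vol_pos) simp
    show "\<forall>w. (\<forall>n. w n \<in> \<A>) \<and> (\<lambda>n. seminorm_p 2 (\<lambda>x. w n x - u x)) \<longlonglongrightarrow> 0 \<longrightarrow> (\<lambda>n. mean_value (w n)) \<longlonglongrightarrow> m"
    proof (intro allI impI, elim conjE)
      fix w assume w: "\<forall>n. w n \<in> \<A>" and s: "(\<lambda>n. seminorm_p 2 (\<lambda>x. w n x - u x)) \<longlonglongrightarrow> 0"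
      show "(\<lambda>n. mean_value (w n)) \<longlonglongrightarrow> m"
      proof (rule tendstoI)
        fix \<epsilon> :: real assume \<epsilon>: "\<epsilon> > 0"
        \<comment> \<open>Chosen so that the resulting bound
          \<open>sqrt (\<delta>\<^sup>2 * ?V * ?K)\<close> equals \<open>\<epsilon> / 2\<close>;
          \<open>?V\<close> enters because \<open>asym_le\<close> is not normalised by the volume of
          the unit ball.\<close>
        define \<delta> where "\<delta> = \<epsilon> / (2 * sqrt (?V * ?K))"
        have \<delta>: "\<delta> > 0" using \<epsilon> V by (simp add: \<delta>_def)
        show "\<forall>\<^sub>F n in sequentially. dist (mean_value (w n)) m < \<epsilon>"
          using order_tendstoD(2)[OF s \<delta>]
        proof eventually_elim
          fix n assume n: "seminorm_p 2 (\<lambda>x. w n x - u x) < \<delta>"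
          have wn: "w n \<in> \<A>" using w by blast
          have "seminorm_p 2 (\<lambda>x. u x - w n x) = seminorm_p 2 (\<lambda>x. w n x - u x)"
            by (simp add: seminorm_p_def limsup_mean_power_def abs_minus_commute)
          then have n': "seminorm_p 2 (\<lambda>x. u x - w n x) < \<delta>" using n by simp
          have li: "loc_int (\<lambda>x. u x - w n x)"
            using uD(2) BUC_D(6)[OF vB[OF wn]] by (rule loc_int_diff)
          have fin: "sq_int (cball 0 r) (\<lambda>x. u x - w n x) < \<infinity>" for r
          proof -
            obtain a b where ab: "asym_le u a" "0 \<le> a" "asym_le (w n) b" "0 \<le> b"
              using uD(3) BUC_asym_le[OF vB[OF wn]] by blast
            have b: "asym_le (\<lambda>x. - w n x) b" by (rule asym_le_cong[OF ab(3)]) simp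
            have "asym_le (\<lambda>x. u x + - w n x) (2 * a + 2 * b)"
              by (rule asym_le_add[OF uD(1) _ ab(1) b ab(2,4)]) (use BUC_D(4)[OF vB[OF wn]] in simp)
            from asym_le_local_finite[OF this] show ?thesis by simp
          qed
          have "asym_le (\<lambda>x. u x - w n x) (\<delta>\<^sup>2 * ?V)"
            by (rule seminorm_p_less_imp[OF _ fin uD(4)[OF wn] n']) (use li in \<open>simp add: loc_int_def\<close>)
          from dist_m[OF wn this] have "\<bar>mean_value (w n) - m\<bar> \<le> sqrt (\<delta>\<^sup>2 * ?V * ?K)" using V by simp
          also have "\<dots> = \<delta> * sqrt (?V * ?K)" using \<delta> by (simp add: real_sqrt_mult mult.assoc)
          also have "\<dots> < \<epsilon>" using \<epsilon> V by (simp add: \<delta>_def)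
          finally show "dist (mean_value (w n)) m < \<epsilon>" by (simp add: dist_real_def)
        qed
      qed
    qed
    fix m' assume m': "\<forall>w. (\<forall>n. w n \<in> \<A>) \<and> (\<lambda>n. seminorm_p 2 (\<lambda>x. w n x - u x)) \<longlonglongrightarrow> 0 \<longrightarrow> (\<lambda>n. mean_value (w n)) \<longlonglongrightarrow> m'"
    \<comment> \<open>Uniqueness rests on the existence of at least one approximating sequence;
      otherwise every number would satisfy the condition vacuously.\<close>
    have "(\<lambda>k. seminorm_p 2 (\<lambda>x. v k x - u x)) \<longlonglongrightarrow> 0"
    proof (rule tendsto_sandwich)
      show "\<forall>\<^sub>F k in sequentially. 0 \<le> seminorm_p 2 (\<lambda>x. v k x - u x)"
        by (simp add: seminorm_p_def)
      have "seminorm_p 2 (\<lambda>x. v k x - u x) \<le> sqrt (inverse (real (Suc k)) / ?V)" for k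
      proof (rule seminorm_p_le)
        show "(\<lambda>x. v k x - u x) \<in> borel_measurable lebesgue"
          using uD(1) BUC_D(4)[OF vB[OF v(1)]] by (intro borel_measurable_diff)
        show "asym_le (\<lambda>x. v k x - u x) (inverse (real (Suc k)))"
          by (rule asym_le_cong[OF v(2)]) simp
      qed simp
      then show "\<forall>\<^sub>F k in sequentially. seminorm_p 2 (\<lambda>x. v k x - u x) \<le> sqrt (inverse (real (Suc k)) / ?V)"
        by simp
      have "(\<lambda>k. sqrt (inverse (real (Suc k)) / ?V)) \<longlonglongrightarrow> sqrt (0 / ?V)"
        by (intro tendsto_intros LIMSEQ_inverse_real_of_nat) (use V in simp)
      then show "(\<lambda>k. sqrt (inverse (real (Suc k)) / ?V)) \<longlonglongrightarrow> 0" by simp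
    qed simp
    then have "(\<lambda>k. mean_value (v k)) \<longlonglongrightarrow> m'" using m' v(1) by blast
    then show "m' = m" using m LIMSEQ_unique by blast
  qed
  then show "(?avg u \<longlongrightarrow> mean_ext 2 \<A> u) at_top"
    "\<And>v a. v \<in> \<A> \<Longrightarrow> asym_le (\<lambda>x. u x - v x) a \<Longrightarrow> 0 \<le> a \<Longrightarrow> \<bar>mean_value v - mean_ext 2 \<A> u\<bar> \<le> sqrt (a * ?K)"
    using lim dist_m by auto
qed

section \<open>Closure of the Besicovitch space under sums and bounded products\<close>

lemma besicovitch_add:
  fixes f g :: "real ^ 'n \<Rightarrow> real"
  assumes \<A>: "algebra_wmv \<A>" and f: "f \<in> besicovitch 2 \<A>" and g: "g \<in> besicovitch 2 \<A>"
  shows "(\<lambda>x. f x + g x) \<in> besicovitch 2 \<A>"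
proof (rule besicovitchI)
  note AB = algebra_wmvD(1)[OF \<A>]
  note fD = besicovitchD[OF f AB] and gD = besicovitchD[OF g AB]
  show "(\<lambda>x. f x + g x) \<in> borel_measurable lebesgue" using fD(1) gD(1) by simp
  show "\<A> \<subseteq> BUC" by (rule AB)
  fix \<epsilon> :: real assume \<epsilon>: "\<epsilon> > 0"
  then obtain v w where v: "v \<in> \<A>" "asym_le (\<lambda>x. f x - v x) (\<epsilon> / 4)" and w: "w \<in> \<A>" "asym_le (\<lambda>x. g x - w x) (\<epsilon> / 4)"
    using fD(5)[of "\<epsilon> / 4"] gD(5)[of "\<epsilon> / 4"] by auto
  have m: "v \<in> borel_measurable lebesgue" "w \<in> borel_measurable lebesgue" using v w AB BUC_D(4) by blast+
  have "asym_le (\<lambda>x. (f x - v x) + (g x - w x)) (2 * (\<epsilon> / 4) + 2 * (\<epsilon> / 4))"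
    by (rule asym_le_add[OF _ _ v(2) w(2)]) (use fD(1) gD(1) m \<epsilon> in auto)
  then have "asym_le (\<lambda>x. (f x + g x) - (v x + w x)) \<epsilon>" by (simp add: algebra_simps)
  then show "\<exists>v\<in>\<A>. asym_le (\<lambda>x. f x + g x - v x) \<epsilon>"
    using algebra_wmvD(2)[OF \<A> v(1) w(1)] by (intro bexI[of _ "\<lambda>x. v x + w x"])
qed

lemma besicovitch_algebra:
  fixes v :: "real ^ 'n \<Rightarrow> real"
  assumes \<A>: "algebra_wmv \<A>" and v: "v \<in> \<A>"
  shows "v \<in> besicovitch 2 \<A>"
proof (rule besicovitchI)
  note AB = algebra_wmvD(1)[OF \<A>]
  show "v \<in> borel_measurable lebesgue" using v AB BUC_D(4) by blast
  show "\<A> \<subseteq> BUC" by (rule AB)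
  show "\<exists>w\<in>\<A>. asym_le (\<lambda>x. v x - w x) \<epsilon>" if "\<epsilon> > 0" for \<epsilon> :: real
    by (intro bexI[OF _ v]) (use that in \<open>auto simp: asym_le_def sq_int_def intro!: always_eventually\<close>)
qed

text \<open>Based on \<open>f * g - v * w = f * (g - w) + w * (f - v)\<close>. The approximant
  \<open>w\<close> of \<open>g\<close> comes first, with accuracy dictated by the essential bound on
  \<open>f\<close>; its own supremum then dictates how closely \<open>v\<close> must follow
  \<open>f\<close>.\<close>

lemma besicovitch_mult:
  fixes f g :: "real ^ 'n \<Rightarrow> real"
  assumes \<A>: "algebra_wmv \<A>" and f: "f \<in> besicovitch 2 \<A>" and g: "g \<in> besicovitch 2 \<A>"
    and bd: "AE x in lebesgue. \<bar>f x\<bar> \<le> C"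
  shows "(\<lambda>x. f x * g x) \<in> besicovitch 2 \<A>"
proof (rule besicovitchI)
  note AB = algebra_wmvD(1)[OF \<A>]
  note fD = besicovitchD[OF f AB] and gD = besicovitchD[OF g AB]
  show "(\<lambda>x. f x * g x) \<in> borel_measurable lebesgue" using fD(1) gD(1) by simp
  show "\<A> \<subseteq> BUC" by (rule AB)
  fix \<epsilon> :: real assume \<epsilon>: "\<epsilon> > 0"
  \<comment> \<open>The added 1 keeps the denominator positive even for
    \<open>C = 0\<close>.\<close>
  have "\<epsilon> / (4 * (C\<^sup>2 + 1)) > 0" using \<epsilon> by (simp add: add_nonneg_pos)
  then obtain w where w: "w \<in> \<A>" "asym_le (\<lambda>x. g x - w x) (\<epsilon> / (4 * (C\<^sup>2 + 1)))"
    using gD(5) by blast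
  obtain D where D: "D > 0" "\<forall>x. \<bar>w x\<bar> \<le> D" using BUC_D(3) w(1) AB by blast
  have "\<epsilon> / (4 * D\<^sup>2) > 0" using \<epsilon> D by simp
  then obtain v where v: "v \<in> \<A>" "asym_le (\<lambda>x. f x - v x) (\<epsilon> / (4 * D\<^sup>2))"
    using fD(5) by blast
  have m: "v \<in> borel_measurable lebesgue" "w \<in> borel_measurable lebesgue" using v w AB BUC_D(4) by blast+
  have "asym_le (\<lambda>x. f x * (g x - w x)) (C\<^sup>2 * (\<epsilon> / (4 * (C\<^sup>2 + 1))))"
    by (rule asym_le_mult[OF _ w(2)]) (use gD(1) m \<epsilon> bd in auto)
  moreover have "C\<^sup>2 * (\<epsilon> / (4 * (C\<^sup>2 + 1))) \<le> \<epsilon> / 4"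
  proof -
    have "C\<^sup>2 * (\<epsilon> / (4 * (C\<^sup>2 + 1))) \<le> (C\<^sup>2 + 1) * (\<epsilon> / (4 * (C\<^sup>2 + 1)))"
      using \<epsilon> by (intro mult_right_mono) auto
    also have "\<dots> = \<epsilon> / 4" using add_nonneg_pos[of "C\<^sup>2" 1] by (simp add: field_simps)
    finally show ?thesis .
  qed
  ultimately have 1: "asym_le (\<lambda>x. f x * (g x - w x)) (\<epsilon> / 4)" by (rule asym_le_mono)
  have "asym_le (\<lambda>x. w x * (f x - v x)) (D\<^sup>2 * (\<epsilon> / (4 * D\<^sup>2)))"
    by (rule asym_le_mult[OF _ v(2)]) (use fD(1) m \<epsilon> D in auto)
  then have 2: "asym_le (\<lambda>x. w x * (f x - v x)) (\<epsilon> / 4)" using D by simp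
  have "asym_le (\<lambda>x. f x * (g x - w x) + w x * (f x - v x)) (2 * (\<epsilon> / 4) + 2 * (\<epsilon> / 4))"
    by (rule asym_le_add[OF _ _ 1 2]) (use fD(1) gD(1) m \<epsilon> in auto)
  then have "asym_le (\<lambda>x. f x * g x - (v x * w x)) \<epsilon>" by (simp add: algebra_simps)
  then show "\<exists>v\<in>\<A>. asym_le (\<lambda>x. f x * g x - v x) \<epsilon>"
    using algebra_wmvD(3)[OF \<A> v(1) w(1)] by (intro bexI[of _ "\<lambda>x. v x * w x"])
qed

lemma besicovitch_sum:
  fixes f :: "'i \<Rightarrow> real ^ 'n \<Rightarrow> real"
  assumes \<A>: "algebra_wmv \<A>" and f: "\<And>i. i \<in> I \<Longrightarrow> f i \<in> besicovitch 2 \<A>"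
  shows "(\<lambda>x. \<Sum>i\<in>I. f i x) \<in> besicovitch 2 \<A>"
  using f
  by (induction I rule: infinite_finite_induct)
    (auto intro: besicovitch_add[OF \<A>] besicovitch_algebra[OF \<A> algebra_wmvD(4)[OF \<A>]])


subsection \<open>Mollification at a large scale and cutoffs\<close>

lemma integrable_vecI:
  fixes f :: "'a \<Rightarrow> real ^ 'n"
  assumes "\<And>i. integrable M (\<lambda>x. f x $ i)"
  shows "integrable M f"
proof -
  have "integrable M (\<lambda>x. \<Sum>i\<in>UNIV. f x $ i *\<^sub>R axis i (1 :: real))"
    using assms by (intro Bochner_Integration.integrable_sum integrable_scaleR_left) auto
  moreover have "(\<Sum>i\<in>UNIV. f x $ i *\<^sub>R axis i (1 :: real)) = f x" for x
    using basis_expansion[of "f x"] by (simp add: scalar_mult_eq_scaleR)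
  ultimately show ?thesis by simp
qed

lemma integral_vec_nth:
  fixes f :: "'a \<Rightarrow> real ^ 'n"
  assumes "\<And>i. integrable M (\<lambda>x. f x $ i)"
  shows "integral\<^sup>L M f $ i = (LINT x|M. f x $ i)"
  using integral_bounded_linear[OF bounded_linear_vec_nth integrable_vecI[OF assms]] by simp

text \<open>The weak gradient is tested with \<open>y \<mapsto> k (x - y)\<close>. The minus sign
  from the reflection cancels the one from integration by parts.\<close>

lemma conv_weak_gradient:
  fixes u :: "real ^ 'n \<Rightarrow> real"
  assumes w: "has_weak_gradient UNIV u G" and u: "loc_int u" and G: "\<And>i. loc_int (\<lambda>y. G y $ i)"
    and k: "k \<in> test_functions UNIV"
  shows "conv u (\<lambda>z. grad k z $ i) x = conv (\<lambda>y. G y $ i) k x"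
proof -
  define \<phi> where "\<phi> y = k (- 1 *\<^sub>R y + x)" for y
  have \<phi>: "\<phi> \<in> test_functions UNIV"
    unfolding \<phi>_def using test_functions_affine[OF k, of "-1" 1 x] by simp
  have g: "grad \<phi> y = - grad k (x - y)" for y
    unfolding \<phi>_def using grad_affine[of k "-1" y x] test_functionsD(3)[OF k] by simp
  have "(LINT y:UNIV|lebesgue. u y *\<^sub>R grad \<phi> y) = - (LINT y:UNIV|lebesgue. \<phi> y *\<^sub>R G y)"
    using w \<phi> by (auto simp: has_weak_gradient_def)
  then have *: "(LINT y|lebesgue. u y *\<^sub>R grad \<phi> y) $ i = - ((LINT y|lebesgue. \<phi> y *\<^sub>R G y) $ i)"
    by (simp add: set_lebesgue_integral_def)
  have i1: "integrable lebesgue (\<lambda>y. (u y *\<^sub>R grad \<phi> y) $ j)" for j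
    using conv_integrable[OF u grad_test_functions[OF k], of x j] by (simp add: g)
  have i2: "integrable lebesgue (\<lambda>y. (\<phi> y *\<^sub>R G y) $ j)" for j
    using conv_integrable[OF G k, of j x] by (simp add: \<phi>_def mult.commute)
  show ?thesis using * unfolding integral_vec_nth[OF i1] integral_vec_nth[OF i2]
    by (simp add: conv_def g \<phi>_def mult.commute)
qed

lemma sq_int_bounded:
  fixes f :: "real ^ 'n \<Rightarrow> real"
  assumes "\<And>x. x \<in> S \<Longrightarrow> \<bar>f x\<bar> \<le> c" "S \<in> sets lebesgue" "emeasure lebesgue S \<le> ennreal m" "0 \<le> m"
  shows "sq_int S f \<le> ennreal (c\<^sup>2 * m)"
proof -
  have "sq_int S (\<lambda>x. f x * 1) \<le> ennreal (c\<^sup>2 * m)"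
    by (rule sq_int_bounded_mult) (use assms in \<open>auto simp: sq_int_one\<close>)
  then show ?thesis by simp
qed

lemma sq_int_cube_eq:
  fixes f :: "real ^ 'n \<Rightarrow> real"
  assumes "continuous_on UNIV f"
  shows "sq_int (cube R) f = ennreal (LINT x:cube R|lebesgue. (f x)\<^sup>2)"
proof -
  have "continuous_on UNIV (\<lambda>x. (f x)\<^sup>2)" by (intro continuous_intros assms)
  then have int: "set_integrable lebesgue (cube R) (\<lambda>x. (f x)\<^sup>2)"
    by (intro loc_int_cube continuous_loc_int)
  have "sq_int (cube R) f = (\<integral>\<^sup>+x. ennreal (indicator (cube R) x *\<^sub>R (f x)\<^sup>2) \<partial>lebesgue)"
    unfolding sq_int_def by (intro nn_integral_cong) (auto simp: indicator_def)
  also have "\<dots> = ennreal (LINT x:cube R|lebesgue. (f x)\<^sup>2)"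
    unfolding set_lebesgue_integral_def using int[unfolded set_integrable_def]
    by (intro nn_integral_eq_integral) auto
  finally show ?thesis .
qed

lemma sq_int_cube_scale:
  fixes f :: "real ^ 'n \<Rightarrow> real"
  assumes f: "continuous_on UNIV f" and R: "R > 0"
  shows "sq_int (cube R) f = ennreal (R ^ CARD('n) * (LINT x:cube 1|lebesgue. (f (R *\<^sub>R x))\<^sup>2))"
proof -
  have "continuous_on UNIV (\<lambda>x. (f x)\<^sup>2)" by (intro continuous_intros f)
  from cube_integral_scale[OF borel_measurable_continuous_onI[OF this] R]
  show ?thesis unfolding sq_int_cube_eq[OF f] by simp
qed

lemma conv_const:
  fixes k :: "real ^ 'n \<Rightarrow> real"
  assumes k: "mollifier r k"
  shows "conv (\<lambda>_. c) k x = c"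
proof -
  have "conv (\<lambda>_. c) k x = conv k (\<lambda>_. c) x"
    by (rule conv_commute) (use mollifierD(5)[OF k] in auto)
  then show ?thesis using mollifierD(4)[OF k] by (simp add: conv_def)
qed

text \<open>A convolution with a mollifier is an average over a ball of radius \<open>r\<close>. The
  free constant \<open>c\<close> serves several purposes: 0 for supremum bounds, the value at
  \<open>x\<close> for the mollification error, 1/2 for confining a cutoff to the unit
  interval.\<close>

lemma conv_bound:
  fixes f :: "real ^ 'n \<Rightarrow> real"
  assumes k: "mollifier r k" and f: "loc_int f" and b: "\<And>y. norm (x - y) \<le> r \<Longrightarrow> \<bar>f y - c\<bar> \<le> e"
  shows "\<bar>conv f k x - c\<bar> \<le> e"
proof -
  have li: "loc_int (\<lambda>_ :: real ^ 'n. d)" for d by (intro continuous_loc_int continuous_intros)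
  have "conv f k x - c = conv (\<lambda>y. f y - c) k x"
    using conv_diff[OF f li mollifierD(1)[OF k], where x = x] conv_const[OF k] by simp
  also have "\<bar>\<dots>\<bar> \<le> (LINT y|lebesgue. e * k (x - y))"
    unfolding conv_def
  proof (rule integral_abs_bound_integral)
    show "integrable lebesgue (\<lambda>y. (f y - c) * k (x - y))"
      by (rule conv_integrable[OF loc_int_diff[OF f li] mollifierD(1)[OF k]])
    show "integrable lebesgue (\<lambda>y. e * k (x - y))"
      by (rule conv_integrable[OF li mollifierD(1)[OF k]])
    fix y
    show "\<bar>(f y - c) * k (x - y)\<bar> \<le> e * k (x - y)"
    proof (cases "norm (x - y) \<le> r")
      case True
      then show ?thesis using b[OF True] mollifierD(2)[OF k, of "x - y"] by (simp add: abs_mult mult_right_mono)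
    next
      case False
      then show ?thesis using mollifierD(3)[OF k, of "x - y"] by simp
    qed
  qed
  also have "\<dots> = e" using conv_const[OF k, where c = e and x = x] by (simp add: conv_def)
  finally show ?thesis .
qed

text \<open>Dilation by \<open>R\<close> turns the kernel of width \<open>\<delta> * R\<close> into
  the fixed kernel of width \<open>\<delta>\<close>, and only the function still depends on
  \<open>R\<close>.\<close>

lemma conv_rescale:
  fixes v :: "real ^ 'n \<Rightarrow> real"
  assumes v: "continuous_on UNIV v" and k: "mollifier 1 \<rho>" and pos: "R > 0" "\<delta> > 0"
  shows "conv v (rescale \<rho> (\<delta> * R)) (R *\<^sub>R x) = conv (\<lambda>y. v (R *\<^sub>R y)) (rescale \<rho> \<delta>) x"
proof -
  have "mollifier (\<delta> * R * 1) (rescale \<rho> (\<delta> * R))"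
    using pos by (intro mollifier_rescale k) auto
  then have "continuous_on UNIV (\<lambda>y. v y * rescale \<rho> (\<delta> * R) (R *\<^sub>R x - y))"
    by (intro continuous_intros v continuous_on_compose2[OF mollifierD(5)]) auto
  from lebesgue_integral_affine[OF borel_measurable_continuous_onI[OF this], of R 0]
  have "conv v (rescale \<rho> (\<delta> * R)) (R *\<^sub>R x) =
     (LINT y|lebesgue. R ^ CARD('n) * (v (R *\<^sub>R y) * rescale \<rho> (\<delta> * R) (R *\<^sub>R x - R *\<^sub>R y)))"
    using pos by (simp add: conv_def)
  also have "\<dots> = conv (\<lambda>y. v (R *\<^sub>R y)) (rescale \<rho> \<delta>) x"
    unfolding conv_def
  proof (rule Bochner_Integration.integral_cong[OF refl])
    fix y
    have "(1 / (\<delta> * R)) *\<^sub>R (R *\<^sub>R x - R *\<^sub>R y) = (1 / \<delta>) *\<^sub>R (x - y)"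
      using pos by (simp flip: scaleR_diff_right)
    then show "R ^ CARD('n) * (v (R *\<^sub>R y) * rescale \<rho> (\<delta> * R) (R *\<^sub>R x - R *\<^sub>R y)) = v (R *\<^sub>R y) * rescale \<rho> \<delta> (x - y)"
      unfolding rescale_def using pos by (simp add: power_mult_distrib power_one_over field_simps)
  qed
  finally show ?thesis .
qed

text \<open>After dilation, the smoothed function at \<open>x\<close> is
  \<open>v (R *\<^sub>R y)\<close> tested against a fixed integrable function of \<open>y\<close>
  with integral 1, so it converges to \<open>m\<close> pointwise by the definition of the mean
  value. Boundedness of \<open>v\<close> allows dominated convergence of the squares on the unit
  cube. Thus weak-* convergence becomes strong after averaging at a scale proportional to
  \<open>R\<close>.\<close>

lemma smoothing_mean_value:
  fixes v :: "real ^ 'n \<Rightarrow> real"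
  assumes v: "v \<in> BUC" "has_mean_value v m" and k: "mollifier 1 \<rho>" and \<delta>: "\<delta> > 0" and e: "e > 0"
  shows "\<forall>\<^sub>F R in at_top. sq_int (cube R) (conv v (rescale \<rho> (\<delta> * R))) \<le> ennreal ((m\<^sup>2 + e) * R ^ CARD('n))"
proof -
  obtain C where C: "\<forall>x. \<bar>v x\<bar> \<le> C" using BUC_D(3)[OF v(1)] by blast
  have kd: "mollifier \<delta> (rescale \<rho> \<delta>)" using mollifier_rescale[OF k \<delta>] by simp
  have cv: "continuous_on UNIV (\<lambda>y. v (R *\<^sub>R y))" for R
    by (rule continuous_on_compose2[OF BUC_D(1)[OF v(1)]]) (auto intro!: continuous_intros)
  define w where "w R = conv (\<lambda>y. v (R *\<^sub>R y)) (rescale \<rho> \<delta>)" for R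
  have cw: "continuous_on UNIV (w R)" for R
    unfolding w_def by (rule times_cont_diff_conv(3)[OF continuous_loc_int[OF cv] mollifierD(1)[OF kd]])
  have bw: "\<bar>w R x\<bar> \<le> C" for R x
    unfolding w_def using conv_bound[OF kd continuous_loc_int[OF cv], where x = x and c = 0 and e = C] C by simp
  have lim: "((\<lambda>R. w R x) \<longlongrightarrow> m) at_top" for x
  proof -
    have "integrable lebesgue (\<lambda>y. 1 * rescale \<rho> \<delta> (x - y))"
      by (rule conv_integrable[OF continuous_loc_int mollifierD(1)[OF kd]]) simp
    moreover have "(LINT y|lebesgue. rescale \<rho> \<delta> (x - y)) = 1"
      using conv_const[OF kd, where c = 1 and x = x] by (simp add: conv_def)
    ultimately show ?thesis
      using has_mean_value_at_top[OF v(2), of "\<lambda>y. rescale \<rho> \<delta> (x - y)"] by (simp add: w_def conv_def)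
  qed
  have "((\<lambda>R. LINT x|lebesgue. indicator (cube 1) x *\<^sub>R (w R x)\<^sup>2) \<longlongrightarrow> (LINT x|lebesgue. indicator (cube 1 :: (real ^ 'n) set) x *\<^sub>R m\<^sup>2)) at_top"
  proof (rule integral_dominated_convergence_at_top)
    show "(\<lambda>x. indicat_real (cube 1) x *\<^sub>R (w R x)\<^sup>2) \<in> borel_measurable lebesgue" for R
      using borel_measurable_continuous_onI[OF cw, of R] cube_sets(3)[of 1]
      by (intro borel_measurable_scaleR borel_measurable_indicator borel_measurable_power)
        (auto intro!: measurable_completion)
    show "(\<lambda>x. indicat_real (cube 1 :: (real ^ 'n) set) x *\<^sub>R m\<^sup>2) \<in> borel_measurable lebesgue"
      using cube_sets(3)[of 1] by (intro borel_measurable_scaleR borel_measurable_indicator) auto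
    have "set_integrable lebesgue (cube 1 :: (real ^ 'n) set) (\<lambda>_. C\<^sup>2)"
      by (intro loc_int_cube continuous_loc_int continuous_intros)
    then show "integrable lebesgue (\<lambda>x. indicat_real (cube 1 :: (real ^ 'n) set) x *\<^sub>R C\<^sup>2)"
      by (simp add: set_integrable_def)
    show "\<forall>\<^sub>F R in at_top. AE x in lebesgue. norm (indicat_real (cube 1) x *\<^sub>R (w R x)\<^sup>2) \<le> indicat_real (cube 1) x *\<^sub>R C\<^sup>2"
    proof (intro always_eventually allI AE_I2)
      fix R x
      have "(w R x)\<^sup>2 \<le> C\<^sup>2" using bw[of R x] by (metis abs_le_square_iff abs_ge_self order_trans)
      then show "norm (indicat_real (cube 1) x *\<^sub>R (w R x)\<^sup>2) \<le> indicat_real (cube 1) x *\<^sub>R C\<^sup>2"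
        by (simp add: indicator_def)
    qed
    show "AE x in lebesgue. ((\<lambda>R. indicat_real (cube 1) x *\<^sub>R (w R x)\<^sup>2) \<longlongrightarrow> indicat_real (cube 1) x *\<^sub>R m\<^sup>2) at_top"
      by (intro AE_I2 tendsto_intros lim)
  qed
  moreover have "(LINT x|lebesgue. indicator (cube 1 :: (real ^ 'n) set) x *\<^sub>R m\<^sup>2) = m\<^sup>2"
    using measure_cube[of 1, where 'n = 'n] by simp
  ultimately have "((\<lambda>R. LINT x:cube 1|lebesgue. (w R x)\<^sup>2) \<longlongrightarrow> m\<^sup>2) at_top"
    unfolding set_lebesgue_integral_def by metis
  then have "\<forall>\<^sub>F R in at_top. (LINT x:cube 1|lebesgue. (w R x)\<^sup>2) < m\<^sup>2 + e"
    using e by (intro order_tendstoD(2)[where y = "m\<^sup>2"]) auto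
  then show ?thesis using eventually_gt_at_top[of 0]
  proof eventually_elim
    fix R :: real
    assume h: "(LINT x:cube 1|lebesgue. (w R x)\<^sup>2) < m\<^sup>2 + e" "0 < R"
    have kR: "mollifier (\<delta> * R * 1) (rescale \<rho> (\<delta> * R))"
      using h \<delta> by (intro mollifier_rescale k) auto
    have "sq_int (cube R) (conv v (rescale \<rho> (\<delta> * R))) = ennreal (R ^ CARD('n) * (LINT x:cube 1|lebesgue. (w R x)\<^sup>2))"
      using sq_int_cube_scale[OF times_cont_diff_conv(3)[OF BUC_D(6)[OF v(1)] mollifierD(1)[OF kR]] h(2)]
      by (simp add: conv_rescale[OF BUC_D(1)[OF v(1)] k h(2) \<delta>] w_def)
    also have "\<dots> \<le> ennreal ((m\<^sup>2 + e) * R ^ CARD('n))"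
      using h mult_left_mono[of "(LINT x:cube 1|lebesgue. (w R x)\<^sup>2)" "m\<^sup>2 + e" "R ^ CARD('n)"]
      by (intro ennreal_leI) (simp add: mult.commute)
    finally show "sq_int (cube R) (conv v (rescale \<rho> (\<delta> * R))) \<le> ennreal ((m\<^sup>2 + e) * R ^ CARD('n))" .
  qed
qed

text \<open>A mollified indicator of a slightly smaller cube. The defect \<open>1 - \<eta>\<close>
  is nonzero only in a shell of volume \<open>1 - (1 - 2 * t) ^ CARD('n)\<close>, which Bernoulli's
  inequality bounds by \<open>2 * CARD('n) * t\<close>.\<close>

lemma cutoff_exists:
  assumes "\<kappa> > 0"
  shows "\<exists>\<eta> :: real ^ 'n \<Rightarrow> real. \<eta> \<in> test_functions (interior (cube 1)) \<and> (\<forall>x. 0 \<le> \<eta> x \<and> \<eta> x \<le> 1) \<and>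
    (LINT x:cube 1|lebesgue. (1 - \<eta> x)\<^sup>2) \<le> \<kappa>"
proof -
  \<comment> \<open>In terms of half sides, the cubes of side \<open>1 - 2 * t\<close>,
    \<open>1 - t\<close> and \<open>1 - t / 2\<close> are separated by gaps \<open>t / 2\<close> and
    \<open>t / 4\<close>; hence the mollification radius \<open>t / 4\<close>. The bound
    \<open>1 / 4\<close> keeps all sides positive.\<close>
  define t where "t = min (1 / 4) (\<kappa> / (2 * real CARD('n)))"
  have t: "t > 0" "t \<le> 1 / 4" "2 * real CARD('n) * t \<le> \<kappa>"
    using assms by (auto simp: t_def min_def field_simps)
  obtain \<rho> :: "real ^ 'n \<Rightarrow> real" where \<rho>: "mollifier 1 \<rho>" using mollifier_exists by blast
  have k: "mollifier (t / 4) (rescale \<rho> (t / 4))" using mollifier_rescale[OF \<rho>, of "t / 4"] t by simp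
  define I :: "real ^ 'n \<Rightarrow> real" where "I = indicator (cube (1 - t))"
  have I: "loc_int I"
  proof -
    have "set_integrable lebesgue (cball 0 r) I" for r
    proof (rule set_integrable_bound[of _ _ "\<lambda>_. 1 :: real"])
      show "set_integrable lebesgue (cball 0 r) (\<lambda>_ :: real ^ 'n. 1 :: real)"
        using continuous_loc_int[OF continuous_on_const] unfolding loc_int_def by blast
      show "set_borel_measurable lebesgue (cball 0 r) I"
        unfolding set_borel_measurable_def I_def using cube_sets(3)[of "1 - t"]
        by (intro borel_measurable_scaleR borel_measurable_indicator) auto
    qed (auto simp: I_def indicator_def)
    moreover have "I \<in> borel_measurable lebesgue"
      unfolding I_def using cube_sets(3)[of "1 - t"] by (intro borel_measurable_indicator) auto
    ultimately show ?thesis by (auto simp: loc_int_def)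
  qed
  define \<eta> where "\<eta> = conv I (rescale \<rho> (t / 4))"
  have bnd: "0 \<le> \<eta> x \<and> \<eta> x \<le> 1" for x
  proof -
    \<comment> \<open>Distance at most 1/2 from 1/2 encodes both bounds
      \<open>0 \<le> \<eta> x\<close> and \<open>\<eta> x \<le> 1\<close> in one application of
      \<open>conv_bound\<close>.\<close>
    have "\<bar>I y - 1 / 2\<bar> \<le> 1 / 2" for y by (simp add: I_def indicator_def)
    then have "\<bar>conv I (rescale \<rho> (t / 4)) x - 1 / 2\<bar> \<le> 1 / 2" by (intro conv_bound[OF k I])
    then show ?thesis unfolding \<eta>_def abs_le_iff by linarith
  qed
  have comp: "\<bar>(x - y) $ i\<bar> \<le> t / 4" if "norm (x - y) \<le> t / 4" for x y :: "real ^ 'n" and i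
    using component_le_norm_cart[of "x - y" i] that by linarith
  have one: "\<eta> x = 1" if x: "x \<in> cube (1 - 2 * t)" for x
  proof -
    have "\<bar>I y - 1\<bar> \<le> 0" if "norm (x - y) \<le> t / 4" for y
    proof -
      have "\<bar>y $ i\<bar> \<le> (1 - t) / 2" for i
      proof -
        have "\<bar>x $ i\<bar> \<le> (1 - 2 * t) / 2" using x by (simp add: mem_cube)
        moreover have "\<bar>x $ i - y $ i\<bar> \<le> t / 4" using comp[OF that, of i] by simp
        moreover have "\<bar>y $ i\<bar> \<le> \<bar>x $ i\<bar> + \<bar>x $ i - y $ i\<bar>" by arith
        ultimately have "\<bar>y $ i\<bar> \<le> (1 - 2 * t) / 2 + t / 4" by linarith
        also have "\<dots> \<le> (1 - t) / 2" using t(1) by (simp add: field_simps)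
        finally show ?thesis .
      qed
      then show ?thesis by (simp add: I_def mem_cube)
    qed
    from conv_bound[OF k I this] show ?thesis by (simp add: \<eta>_def)
  qed
  have zero: "\<eta> x = 0" if x: "x \<notin> cube (1 - t / 2)" for x
  proof -
    have "\<bar>I y - 0\<bar> \<le> 0" if "norm (x - y) \<le> t / 4" for y
    proof -
      obtain i where i: "\<bar>x $ i\<bar> > (1 - t / 2) / 2" using x by (auto simp: mem_cube not_le)
      moreover have "\<bar>x $ i - y $ i\<bar> \<le> t / 4" using comp[OF that, of i] by simp
      moreover have "\<bar>x $ i\<bar> \<le> \<bar>y $ i\<bar> + \<bar>x $ i - y $ i\<bar>" by arith
      ultimately have "(1 - t / 2) / 2 < \<bar>y $ i\<bar> + t / 4" by linarith
      then have "\<bar>y $ i\<bar> > (1 - t) / 2" by (simp add: field_simps)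
      then show ?thesis by (auto simp: I_def mem_cube not_le indicator_def)
    qed
    from conv_bound[OF k I this] show ?thesis by (simp add: \<eta>_def)
  qed
  have test: "\<eta> \<in> test_functions (interior (cube 1))"
  proof (rule test_functionsI)
    show "times_cont_diff m \<eta>" for m unfolding \<eta>_def by (rule times_cont_diff_conv(1)[OF I mollifierD(1)[OF k]])
    show "compact (cube (1 - t / 2) :: (real ^ 'n) set)" by (simp add: cube_def)
    show "cube (1 - t / 2) \<subseteq> interior (cube 1 :: (real ^ 'n) set)"
    proof
      fix x :: "real ^ 'n" assume x: "x \<in> cube (1 - t / 2)"
      have "\<bar>x $ i\<bar> < 1 / 2" for i
      proof -
        have "\<bar>x $ i\<bar> \<le> (1 - t / 2) / 2" using x by (simp add: mem_cube)
        also have "\<dots> < 1 / 2" using t by simp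
        finally show ?thesis .
      qed
      then show "x \<in> interior (cube 1)" by (simp add: mem_interior_cube)
    qed
  qed (rule zero)
  have "(LINT x:cube 1|lebesgue. (1 - \<eta> x)\<^sup>2) \<le> (LINT x|lebesgue. indicator (cube 1) x - indicator (cube (1 - 2 * t) :: (real ^ 'n) set) x)"
    unfolding set_lebesgue_integral_def
  proof (rule integral_mono)
    have "continuous_on UNIV (\<lambda>x. (1 - \<eta> x)\<^sup>2)"
      by (intro continuous_intros test_functionsD(2)[OF test])
    from loc_int_cube[OF continuous_loc_int[OF this]]
    show "integrable lebesgue (\<lambda>x. indicat_real (cube 1) x *\<^sub>R (1 - \<eta> x)\<^sup>2)"
      by (simp add: set_integrable_def)
    have i: "integrable lebesgue (indicator (cube R :: (real ^ 'n) set) :: _ \<Rightarrow> real)" if "R \<ge> 0" for R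
      using emeasure_cube[OF that, where 'n = 'n] cube_sets(3)[of R]
      by (intro integrable_real_indicator) auto
    show "integrable lebesgue (\<lambda>x. indicator (cube 1) x - indicator (cube (1 - 2 * t) :: (real ^ 'n) set) x :: real)"
      using i[of 1] i[of "1 - 2 * t"] t by simp
    fix x :: "real ^ 'n"
    have sub: "x \<in> cube 1" if "x \<in> cube (1 - 2 * t)"
      unfolding mem_cube
    proof
      fix i
      have "\<bar>x $ i\<bar> \<le> (1 - 2 * t) / 2" using that by (simp add: mem_cube)
      also have "\<dots> \<le> 1 / 2" using t(1) by simp
      finally show "\<bar>x $ i\<bar> \<le> 1 / 2" .
    qed
    have "(1 - \<eta> x)\<^sup>2 \<le> 1" using bnd[of x] by (simp add: power_le_one)
    then show "indicat_real (cube 1) x *\<^sub>R (1 - \<eta> x)\<^sup>2 \<le> indicator (cube 1) x - indicator (cube (1 - 2 * t)) x"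
      using one[of x] sub by (simp add: indicator_def)
  qed
  also have "\<dots> = 1 - (1 - 2 * t) ^ CARD('n)"
  proof -
    have i: "integrable lebesgue (indicator (cube R :: (real ^ 'n) set) :: _ \<Rightarrow> real)" if "R \<ge> 0" for R
      using emeasure_cube[OF that, where 'n = 'n] cube_sets(3)[of R]
      by (intro integrable_real_indicator) auto
    show ?thesis
      using i[of 1] i[of "1 - 2 * t"] t measure_cube[of 1, where 'n = 'n] measure_cube[of "1 - 2 * t", where 'n = 'n]
      by simp
  qed
  also have "\<dots> \<le> 2 * real CARD('n) * t"
    using Bernoulli_inequality[of "- 2 * t" "CARD('n)"] t by simp
  also have "\<dots> \<le> \<kappa>" by (rule t)
  finally show ?thesis using test bnd by blast
qed

text \<open>Dilation gains a factor \<open>1 / R\<close> in the gradient, while the defect relative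
  to the volume of the cube stays the same.\<close>

lemma cutoff_scale:
  fixes \<eta> :: "real ^ 'n \<Rightarrow> real"
  assumes \<eta>: "\<eta> \<in> test_functions (interior (cube 1))" and R: "R > 0"
  shows "(\<lambda>x. \<eta> ((1 / R) *\<^sub>R x)) \<in> test_functions (interior (cube R))"
    and "grad (\<lambda>x. \<eta> ((1 / R) *\<^sub>R x)) x $ i = (1 / R) * grad \<eta> ((1 / R) *\<^sub>R x) $ i"
    and "sq_int (cube R) (\<lambda>x. 1 - \<eta> ((1 / R) *\<^sub>R x)) = ennreal (R ^ CARD('n) * (LINT x:cube 1|lebesgue. (1 - \<eta> x)\<^sup>2))"
proof -
  show "grad (\<lambda>x. \<eta> ((1 / R) *\<^sub>R x)) x $ i = (1 / R) * grad \<eta> ((1 / R) *\<^sub>R x) $ i"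
    using grad_affine[of \<eta> "1 / R" x 0] test_functionsD(3)[OF \<eta>] by simp
  have c: "continuous_on UNIV (\<lambda>x. 1 - \<eta> ((1 / R) *\<^sub>R x))"
    by (intro continuous_intros continuous_on_compose2[OF test_functionsD(2)[OF \<eta>]]) auto
  show "sq_int (cube R) (\<lambda>x. 1 - \<eta> ((1 / R) *\<^sub>R x)) = ennreal (R ^ CARD('n) * (LINT x:cube 1|lebesgue. (1 - \<eta> x)\<^sup>2))"
    using sq_int_cube_scale[OF c R] R by simp
  obtain K where K: "compact K" "K \<subseteq> interior (cube 1)" "\<And>x. x \<notin> K \<Longrightarrow> \<eta> x = 0"
    using test_functions_supp[OF \<eta>] by metis
  show "(\<lambda>x. \<eta> ((1 / R) *\<^sub>R x)) \<in> test_functions (interior (cube R))"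
  proof (rule test_functionsI)
    show "times_cont_diff m (\<lambda>x. \<eta> ((1 / R) *\<^sub>R x))" for m
      using times_cont_diff_affine[OF test_functionsD(1)[OF \<eta>], of m "1 / R" 0] by simp
    show "compact ((\<lambda>x. R *\<^sub>R x) ` K)" by (intro compact_continuous_image continuous_intros K)
    show "(\<lambda>x. R *\<^sub>R x) ` K \<subseteq> interior (cube R)"
      using K(2) R by (auto simp: subset_iff mem_interior_cube abs_mult field_simps)
    show "\<eta> ((1 / R) *\<^sub>R x) = 0" if "x \<notin> (\<lambda>x. R *\<^sub>R x) ` K" for x
    proof (rule K(3), rule)
      assume "(1 / R) *\<^sub>R x \<in> K"
      moreover have "x = R *\<^sub>R ((1 / R) *\<^sub>R x)" using R by simp
      ultimately show False using that by (metis image_eqI)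
    qed
  qed
qed

lemma sq_int_shift:
  fixes f :: "real ^ 'n \<Rightarrow> real"
  assumes [measurable]: "f \<in> borel_measurable borel" "T \<in> sets borel" and "\<And>x. x \<in> S \<Longrightarrow> x - z \<in> T"
  shows "sq_int S (\<lambda>x. f (x - z)) \<le> sq_int T f"
proof -
  have "sq_int S (\<lambda>x. f (x - z)) \<le> (\<integral>\<^sup>+x. indicator T (x - z) * ennreal ((f (x - z))\<^sup>2) \<partial>lborel)"
    unfolding sq_int_def nn_integral_completion using assms(3)
    by (intro nn_integral_mono) (auto simp: indicator_def)
  also have "\<dots> = sq_int T f"
    unfolding sq_int_def nn_integral_completion
    by (subst (2) lborel_affine[of "1" "- z"], simp, subst nn_integral_density, simp, simp,
        subst nn_integral_distr) auto
  finally show ?thesis .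
qed


subsection \<open>Pairing divergence free fields with gradients\<close>

lemma finite_uniform_radius:
  fixes P :: "'i :: finite \<Rightarrow> real \<Rightarrow> bool"
  assumes "\<And>i. \<exists>d>0. P i d" and mono: "\<And>i d d'. P i d \<Longrightarrow> 0 < d' \<Longrightarrow> d' \<le> d \<Longrightarrow> P i d'"
  shows "\<exists>d>0. \<forall>i. P i d"
proof -
  obtain f where f: "\<And>i. f i > 0 \<and> P i (f i)" using assms(1) by metis
  have "Min (range f) > 0" using f by (subst Min_gr_iff) auto
  then show ?thesis using f mono by (intro exI[of _ "Min (range f)"]) (auto intro: mono[OF conjunct2[OF f]])
qed

lemma finite_uniform_bound:
  fixes P :: "'i :: finite \<Rightarrow> real \<Rightarrow> bool"
  assumes "\<And>i. \<exists>d>0. P i d" and mono: "\<And>i d d'. P i d \<Longrightarrow> d \<le> d' \<Longrightarrow> P i d'"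
  shows "\<exists>d>0. \<forall>i. P i d"
proof -
  obtain f where f: "\<And>i. f i > 0 \<and> P i (f i)" using assms(1) by metis
  have m: "f i \<le> Max (range f)" for i by simp
  then have "Max (range f) > 0" using f less_le_trans by blast
  then show ?thesis using f mono m by (intro exI[of _ "Max (range f)"]) blast
qed

lemma set_lebesgue_integral_sum:
  fixes f :: "'i \<Rightarrow> 'a \<Rightarrow> real"
  assumes "\<And>i. i \<in> I \<Longrightarrow> set_integrable M S (f i)"
  shows "(LINT x:S|M. \<Sum>i\<in>I. f i x) = (\<Sum>i\<in>I. LINT x:S|M. f i x)"
  using assms unfolding set_lebesgue_integral_def set_integrable_def scaleR_sum_right
  by (rule Bochner_Integration.integral_sum)

text \<open>Sized for the seven error terms in the pairing estimate. Repeated use of the inequality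
  with factors 2 gives \<open>190 * t\<close>, rounded up to \<open>256 * t\<close>.\<close>

lemma sq_int_add7:
  fixes f1 f2 f3 f4 f5 f6 f7 :: "real ^ 'n \<Rightarrow> real"
  assumes m: "f1 \<in> borel_measurable lebesgue" "f2 \<in> borel_measurable lebesgue" "f3 \<in> borel_measurable lebesgue"
    "f4 \<in> borel_measurable lebesgue" "f5 \<in> borel_measurable lebesgue" "f6 \<in> borel_measurable lebesgue"
    "f7 \<in> borel_measurable lebesgue" and S: "S \<in> sets lebesgue"
    and b: "sq_int S f1 \<le> ennreal t" "sq_int S f2 \<le> ennreal t" "sq_int S f3 \<le> ennreal t"
    "sq_int S f4 \<le> ennreal t" "sq_int S f5 \<le> ennreal t" "sq_int S f6 \<le> ennreal t" "sq_int S f7 \<le> ennreal t"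
    and t: "0 \<le> t"
  shows "sq_int S (\<lambda>x. f1 x + (f2 x + (f3 x + (f4 x + (f5 x + (f6 x + f7 x)))))) \<le> ennreal (256 * t)"
proof -
  note add = sq_int_add[OF _ _ S]
  have "sq_int S (\<lambda>x. f6 x + f7 x) \<le> ennreal (2 * t + 2 * t)"
    by (rule add) (use m b t in auto)
  then have "sq_int S (\<lambda>x. f5 x + (f6 x + f7 x)) \<le> ennreal (2 * t + 2 * (2 * t + 2 * t))"
    by (intro add) (use m b t in auto)
  then have "sq_int S (\<lambda>x. f4 x + (f5 x + (f6 x + f7 x))) \<le> ennreal (2 * t + 2 * (2 * t + 2 * (2 * t + 2 * t)))"
    by (intro add) (use m b t in auto)
  then have "sq_int S (\<lambda>x. f3 x + (f4 x + (f5 x + (f6 x + f7 x)))) \<le> ennreal (2 * t + 2 * (2 * t + 2 * (2 * t + 2 * (2 * t + 2 * t))))"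
    by (intro add) (use m b t in auto)
  then have "sq_int S (\<lambda>x. f2 x + (f3 x + (f4 x + (f5 x + (f6 x + f7 x))))) \<le> ennreal (2 * t + 2 * (2 * t + 2 * (2 * t + 2 * (2 * t + 2 * (2 * t + 2 * t)))))"
    by (intro add) (use m b t in auto)
  then have "sq_int S (\<lambda>x. f1 x + (f2 x + (f3 x + (f4 x + (f5 x + (f6 x + f7 x)))))) \<le> ennreal (2 * t + 2 * (2 * t + 2 * (2 * t + 2 * (2 * t + 2 * (2 * t + 2 * (2 * t + 2 * t))))))"
    by (intro add) (use m b t in auto)
  also have "\<dots> \<le> ennreal (256 * t)" using t by (intro ennreal_leI) auto
  finally show ?thesis .
qed

text \<open>The field \<open>G\<close> is almost the gradient of the admissible test function
  \<open>\<eta> (\<psi> - \<psi> * \<rho>\<^sub>s)\<close>, \<open>\<psi> = u * \<rho>\<^sub>r\<close>: the mollification at the small scale \<open>r\<close> is harmless because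
  \<open>G\<close> is close to a uniformly continuous \<open>v\<close>, and the one at the large scale \<open>s = \<delta> R\<close> sends \<open>G\<close> to its
  mean value, which is zero.\<close>

lemma gradient_pairing_bound:
  fixes u \<eta> kr ks :: "real ^ 'n \<Rightarrow> real" and G F :: "real ^ 'n \<Rightarrow> real ^ 'n" and v :: "'n \<Rightarrow> real ^ 'n \<Rightarrow> real"
  assumes w: "has_weak_gradient UNIV u G" and u: "loc_int u" and G: "\<And>i. loc_int (\<lambda>y. G y $ i)"
    and v: "\<And>i. v i \<in> BUC" and kr: "mollifier r kr" and ks: "mollifier s ks"
    and rs: "0 < r" "r \<le> R" "0 < s" "s \<le> R"
    and \<eta>: "\<eta> \<in> test_functions (interior (cube R))" "\<And>x. 0 \<le> \<eta> x \<and> \<eta> x \<le> 1" "\<And>x i. \<bar>grad \<eta> x $ i\<bar> \<le> L"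
    and F: "\<And>i. (\<lambda>x. F x $ i) \<in> borel_measurable lebesgue" "\<And>i. sq_int (interior (cube R)) (\<lambda>x. F x $ i) \<le> ennreal a" "0 \<le> a"
    and div: "distr_div_free (interior (cube R)) F"
    and t: "0 \<le> t" and b: "0 \<le> b"
    and D: "\<And>i. sq_int (ball 0 ((real CARD('n) + 4) * R)) (\<lambda>x. G x $ i - v i x) \<le> ennreal t"
    and cut: "\<And>i. sq_int (interior (cube R)) (\<lambda>x. (1 - \<eta> x) * v i x) \<le> ennreal t"
    and osc: "\<And>i x y. norm (x - y) \<le> r \<Longrightarrow> \<bar>v i x - v i y\<bar> \<le> \<omega>" "\<omega>\<^sup>2 * R ^ CARD('n) \<le> t"
    and mean: "\<And>i. sq_int (interior (cube R)) (conv (v i) ks) \<le> ennreal t"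
    and Gb: "\<And>i. sq_int (ball 0 ((real CARD('n) + 4) * R)) (\<lambda>x. G x $ i) \<le> ennreal b"
  shows "\<bar>LINT x:interior (cube R)|lebesgue. F x \<bullet> G x\<bar> \<le>
     real CARD('n) * sqrt (a * (256 * t)) + real CARD('n) * (s * real CARD('n) * sqrt (L\<^sup>2 * a * b))"
proof -
  let ?n = "real CARD('n)"
  define Q :: "(real ^ 'n) set" where "Q = interior (cube R)"
  have R: "R > 0" using rs by linarith
  have Qb: "Q \<in> sets borel" and Ql: "Q \<in> sets lebesgue" unfolding Q_def by (rule cube_sets)+
  have Qc: "Q \<subseteq> cube R" unfolding Q_def by (rule interior_subset)
  have Qball: "Q \<subseteq> ball 0 (?n * R)" using Qc cube_subset_ball[OF R] by blast
  have Qm: "emeasure lebesgue Q \<le> ennreal (R ^ CARD('n))"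
    using emeasure_mono[OF Qc cube_sets(3)] emeasure_cube[of R, where 'n = 'n] R by simp
  define psi where "psi = conv u kr"
  define g where "g i = conv (\<lambda>y. G y $ i) kr" for i
  define psis where "psis = conv psi ks"
  define gs where "gs i = conv (g i) ks" for i
  note krt = mollifierD(1)[OF kr] and kst = mollifierD(1)[OF ks]
  have cpsi: "continuous_on UNIV psi" unfolding psi_def by (rule times_cont_diff_conv(3)[OF u krt])
  have cg: "continuous_on UNIV (g i)" for i unfolding g_def by (rule times_cont_diff_conv(3)[OF G krt])
  have gpsi: "grad psi x $ i = g i x" for i x
    unfolding psi_def g_def times_cont_diff_conv(4)[OF u krt] by (rule conv_weak_gradient[OF w u G krt])
  have dpsi: "psi differentiable (at x)" for x unfolding psi_def by (rule times_cont_diff_conv(2)[OF u krt])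
  have tpsi: "times_cont_diff m psi" for m unfolding psi_def by (rule times_cont_diff_conv(1)[OF u krt])
  \<comment> \<open>With the compactly supported \<open>ks\<close> as data and \<open>psi\<close> as
    smooth factor, derivatives fall on \<open>psi\<close>, so the gradient of \<open>psis\<close> is
    the smoothed gradient of \<open>psi\<close>.\<close>
  have psis_eq: "psis = conv ks psi"
    unfolding psis_def using conv_commute[OF cpsi mollifierD(5)[OF ks]] by blast
  have tpsis: "times_cont_diff m psis" for m
    unfolding psis_eq
    by (rule times_cont_diff_conv_bounded_supp(1)[OF mollifierD(6)[OF ks] _ tpsi, of s]) (rule mollifierD(3)[OF ks])
  have dpsis: "psis differentiable (at x)" for x using tpsis[of 1] by simp
  have gpsis: "grad psis x $ i = gs i x" for i x
  proof -
    have "grad psis x $ i = conv ks (\<lambda>z. grad psi z $ i) x"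
      unfolding psis_eq
      by (rule times_cont_diff_conv_bounded_supp(3)[OF mollifierD(6)[OF ks] _ tpsi, of s]) (rule mollifierD(3)[OF ks])
    also have "\<dots> = gs i x"
      unfolding gpsi gs_def by (rule conv_commute[OF mollifierD(5)[OF ks] cg])
    finally show ?thesis .
  qed
  define \<phi> where "\<phi> x = \<eta> x * (psi x - psis x)" for x
  have \<phi>_grad: "grad \<phi> x = \<eta> x *\<^sub>R (grad psi x - grad psis x) + (psi x - psis x) *\<^sub>R grad \<eta> x" for x
  proof (rule grad_eqI)
    have "((\<lambda>x. \<eta> x * (psi x - psis x)) has_derivative
      (\<lambda>h. \<eta> x * (grad psi x \<bullet> h - grad psis x \<bullet> h) + grad \<eta> x \<bullet> h * (psi x - psis x))) (at x)"
      by (intro has_derivative_mult has_derivative_diff has_derivative_grad dpsi dpsis test_functionsD(3)[OF \<eta>(1)])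
    then show "(\<phi> has_derivative (\<lambda>h. (\<eta> x *\<^sub>R (grad psi x - grad psis x) + (psi x - psis x) *\<^sub>R grad \<eta> x) \<bullet> h)) (at x)"
      unfolding \<phi>_def by (simp add: inner_add_left inner_diff_left algebra_simps)
  qed
  have \<phi>_test: "\<phi> \<in> test_functions Q"
  proof -
    obtain K where K: "compact K" "K \<subseteq> Q" "\<And>x. x \<notin> K \<Longrightarrow> \<eta> x = 0"
      using test_functions_supp[OF \<eta>(1)] unfolding Q_def by metis
    have "times_cont_diff m (\<lambda>x. \<eta> x * (psi x + (-1) * psis x))" for m
      by (intro times_cont_diff_mult times_cont_diff_add times_cont_diff_const tpsi tpsis test_functionsD(1)[OF \<eta>(1)])
    then have "times_cont_diff m \<phi>" for m by (simp add: \<phi>_def[abs_def])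
    then show ?thesis by (rule test_functionsI[OF _ K(1,2)]) (simp add: \<phi>_def K)
  qed
  \<comment> \<open>The part of \<open>G\<close> missed by
    \<open>\<eta> * (grad psi - grad psis)\<close>. Hence \<open>G\<close> equals \<open>E\<close>
    plus \<open>grad \<phi>\<close> minus \<open>(psi - psis) * grad \<eta>\<close>; paired with
    \<open>F\<close>, the middle term drops out and the other two are estimated separately.\<close>
  define E where "E i x = G x $ i - \<eta> x * (g i x - gs i x)" for i x
  define Dv where "Dv i x = G x $ i - v i x" for i x
  have vl: "loc_int (v i)" for i by (rule BUC_D(6)[OF v])
  have Dl: "loc_int (Dv i)" for i unfolding Dv_def[abs_def] by (intro loc_int_diff G vl)
  \<comment> \<open>The error of small-scale mollification on the uniformly continuous approximant,
    at most its oscillation \<open>\<omega>\<close>.\<close>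
  define W where "W i x = conv (v i) kr x - v i x" for i x
  have Wl: "loc_int (W i)" for i unfolding W_def[abs_def] by (intro loc_int_diff conv_loc_int vl krt)
  have g_split: "g i x = conv (Dv i) kr x + conv (v i) kr x" for i x
    using conv_add[OF Dl[of i] vl[of i] krt, where x = x] by (simp add: g_def Dv_def)
  have gs_split: "gs i x = conv (conv (Dv i) kr) ks x + (conv (W i) ks x + conv (v i) ks x)" for i x
  proof -
    have "g i = (\<lambda>x. conv (Dv i) kr x + (W i x + v i x))" using g_split by (auto simp: W_def)
    then show ?thesis unfolding gs_def
      using conv_add[OF conv_loc_int[OF Dl[of i] krt] loc_int_add[OF Wl[of i] vl[of i]] kst, where x = x]
        conv_add[OF Wl[of i] vl[of i] kst, where x = x]
      by simp
  qed
  have lm: "f \<in> borel_measurable lebesgue" if "loc_int f" for f :: "real ^ 'n \<Rightarrow> real"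
    using that by (simp add: loc_int_def)
  have \<eta>m: "\<eta> \<in> borel_measurable lebesgue"
    by (rule lm[OF continuous_loc_int[OF test_functionsD(2)[OF \<eta>(1)]]])
  have \<eta>1: "\<bar>\<eta> x\<bar> \<le> 1" for x using \<eta>(2)[of x] by simp
  have mult\<eta>: "sq_int Q (\<lambda>x. \<eta> x * f x) \<le> ennreal t" if "loc_int f" "sq_int Q f \<le> ennreal t" for f
    using sq_int_bounded_mult[OF lm[OF that(1)] Ql that(2) t, of \<eta> 1] \<eta>1 by simp
  have W_bd: "\<bar>W i x\<bar> \<le> \<omega>" for i x
    unfolding W_def by (rule conv_bound[OF kr vl]) (metis osc(1) norm_minus_commute)
  have small: "sq_int Q f \<le> ennreal t" if "\<And>x. \<bar>f x\<bar> \<le> \<omega>" for f :: "real ^ 'n \<Rightarrow> real"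
  proof -
    have "sq_int Q f \<le> ennreal (\<omega>\<^sup>2 * R ^ CARD('n))" by (rule sq_int_bounded[OF that Ql Qm]) (use R in simp)
    also have "\<dots> \<le> ennreal t" using osc(2) by (rule ennreal_leI)
    finally show ?thesis .
  qed
  \<comment> \<open>Each mollification enlarges the ball by at most \<open>R\<close>, since
    \<open>r\<close> and \<open>s\<close> do not exceed \<open>R\<close>. Starting from radius
    \<open>?n * R\<close>, two of them stay inside \<open>(?n + 4) * R\<close>, where the hypotheses
    are stated.\<close>
  have young_r: "sq_int (ball 0 ((?n + c) * R)) (conv f kr) \<le> sq_int (ball 0 ((?n + c + 1) * R)) f" if "loc_int f" for c f
  proof (rule sq_int_conv[OF kr that])
    fix x y :: "real ^ 'n" assume "x \<in> ball 0 ((?n + c) * R)" "norm y \<le> r"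
    then have "norm x < (?n + c) * R" "norm y \<le> R" using rs by auto
    then show "x - y \<in> ball 0 ((?n + c + 1) * R)"
      using norm_triangle_ineq4[of x y] by (simp add: algebra_simps)
  qed auto
  have young_s: "sq_int Q (conv f ks) \<le> sq_int (ball 0 ((?n + 1) * R)) f" if "loc_int f" for f
  proof (rule sq_int_conv[OF ks that Qb])
    fix x y :: "real ^ 'n" assume "x \<in> Q" "norm y \<le> s"
    then have "norm x < ?n * R" "norm y \<le> R" using rs Qball by auto
    then show "x - y \<in> ball 0 ((?n + 1) * R)"
      using norm_triangle_ineq4[of x y] by (simp add: algebra_simps)
  qed auto
  have ball_mono: "sq_int (ball 0 ((?n + c) * R)) f \<le> sq_int (ball 0 ((?n + 4) * R)) f" if "c \<le> 4" for c and f :: "real ^ 'n \<Rightarrow> real"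
    using that R by (intro sq_int_mono_set subset_ball mult_right_mono) auto
  have t1: "sq_int Q (Dv i) \<le> ennreal t" for i
  proof -
    have "sq_int Q (Dv i) \<le> sq_int (ball 0 ((?n + 0) * R)) (Dv i)" using Qball by (intro sq_int_mono_set) simp
    also have "\<dots> \<le> sq_int (ball 0 ((?n + 4) * R)) (Dv i)" by (rule ball_mono) simp
    also have "\<dots> \<le> ennreal t" unfolding Dv_def by (rule D)
    finally show ?thesis .
  qed
  have t3: "sq_int Q (conv (Dv i) kr) \<le> ennreal t" for i
  proof -
    have "sq_int Q (conv (Dv i) kr) \<le> sq_int (ball 0 ((?n + 0) * R)) (conv (Dv i) kr)" using Qball by (intro sq_int_mono_set) simp
    also have "\<dots> \<le> sq_int (ball 0 ((?n + 0 + 1) * R)) (Dv i)" by (rule young_r[OF Dl])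
    also have "\<dots> \<le> sq_int (ball 0 ((?n + 4) * R)) (Dv i)" using ball_mono[of 1 "Dv i"] by simp
    also have "\<dots> \<le> ennreal t" unfolding Dv_def by (rule D)
    finally show ?thesis .
  qed
  have t5: "sq_int Q (conv (conv (Dv i) kr) ks) \<le> ennreal t" for i
  proof -
    have "sq_int Q (conv (conv (Dv i) kr) ks) \<le> sq_int (ball 0 ((?n + 1) * R)) (conv (Dv i) kr)"
      by (rule young_s[OF conv_loc_int[OF Dl krt]])
    also have "\<dots> \<le> sq_int (ball 0 ((?n + 1 + 1) * R)) (Dv i)" by (rule young_r[OF Dl])
    also have "\<dots> \<le> sq_int (ball 0 ((?n + 4) * R)) (Dv i)" using ball_mono[of 2 "Dv i"] by (simp add: add.assoc)
    also have "\<dots> \<le> ennreal t" unfolding Dv_def by (rule D)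
    finally show ?thesis .
  qed
  have t6: "sq_int Q (conv (W i) ks) \<le> ennreal t" for i
    using conv_bound[OF ks Wl, where c = 0 and e = \<omega>] W_bd by (intro small) auto
  have t4: "sq_int Q (\<lambda>x. - W i x) \<le> ennreal t" for i
    using W_bd by (intro small) auto
  \<comment> \<open>With \<open>G = Dv + v\<close> the occurrences of \<open>v\<close> outside the
    convolutions combine to \<open>(1 - \<eta>) * v\<close>. The other terms carry the approximation
    error \<open>Dv\<close>, the mollification error \<open>W\<close>, or the large-scale average of
    \<open>v\<close>, small by the hypothesis \<open>mean\<close>.\<close>
  have E_split: "E i = (\<lambda>x. Dv i x + ((1 - \<eta> x) * v i x + (\<eta> x * (- conv (Dv i) kr x) + (\<eta> x * (- W i x) +
     (\<eta> x * conv (conv (Dv i) kr) ks x + (\<eta> x * conv (W i) ks x + \<eta> x * conv (v i) ks x))))))" for i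
    unfolding E_def g_split gs_split by (auto simp: Dv_def W_def algebra_simps)
  have neg: "loc_int (\<lambda>x. - f x)" if "loc_int f" for f :: "real ^ 'n \<Rightarrow> real"
    using loc_int_diff[OF continuous_loc_int[OF continuous_on_const] that, of 0] by simp
  have E_sq: "sq_int Q (E i) \<le> ennreal (256 * t)" for i
    unfolding E_split
  proof (rule sq_int_add7[OF _ _ _ _ _ _ _ Ql])
    show "sq_int Q (\<lambda>x. (1 - \<eta> x) * v i x) \<le> ennreal t" using cut unfolding Q_def .
    show "sq_int Q (Dv i) \<le> ennreal t" by (rule t1)
    have "sq_int Q (\<lambda>x. - conv (Dv i) kr x) \<le> ennreal t"
      using t3[of i] sq_int_mono[of Q "\<lambda>x. - conv (Dv i) kr x" "conv (Dv i) kr"] by (auto intro: order_trans)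
    then show "sq_int Q (\<lambda>x. \<eta> x * (- conv (Dv i) kr x)) \<le> ennreal t"
      by (rule mult\<eta>[OF neg[OF conv_loc_int[OF Dl krt]]])
    show "sq_int Q (\<lambda>x. \<eta> x * (- W i x)) \<le> ennreal t" by (rule mult\<eta>[OF neg[OF Wl] t4])
    show "sq_int Q (\<lambda>x. \<eta> x * conv (conv (Dv i) kr) ks x) \<le> ennreal t"
      by (rule mult\<eta>[OF conv_loc_int[OF conv_loc_int[OF Dl krt] kst] t5])
    show "sq_int Q (\<lambda>x. \<eta> x * conv (W i) ks x) \<le> ennreal t" by (rule mult\<eta>[OF conv_loc_int[OF Wl kst] t6])
    show "sq_int Q (\<lambda>x. \<eta> x * conv (v i) ks x) \<le> ennreal t"
      by (rule mult\<eta>[OF conv_loc_int[OF vl kst]]) (use mean in \<open>simp add: Q_def\<close>)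
    note m\<eta> = borel_measurable_times[OF \<eta>m lm]
    show "Dv i \<in> borel_measurable lebesgue" by (rule lm[OF Dl])
    show "(\<lambda>x. \<eta> x * (- conv (Dv i) kr x)) \<in> borel_measurable lebesgue"
      by (rule m\<eta>[OF neg[OF conv_loc_int[OF Dl krt]]])
    show "(\<lambda>x. \<eta> x * (- W i x)) \<in> borel_measurable lebesgue" by (rule m\<eta>[OF neg[OF Wl]])
    show "(\<lambda>x. \<eta> x * conv (conv (Dv i) kr) ks x) \<in> borel_measurable lebesgue"
      by (rule m\<eta>[OF conv_loc_int[OF conv_loc_int[OF Dl krt] kst]])
    show "(\<lambda>x. \<eta> x * conv (W i) ks x) \<in> borel_measurable lebesgue" by (rule m\<eta>[OF conv_loc_int[OF Wl kst]])
    show "(\<lambda>x. \<eta> x * conv (v i) ks x) \<in> borel_measurable lebesgue" by (rule m\<eta>[OF conv_loc_int[OF vl kst]])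
    show "(\<lambda>x. (1 - \<eta> x) * v i x) \<in> borel_measurable lebesgue"
      using \<eta>m lm[OF vl] by (intro borel_measurable_times borel_measurable_diff) auto
  qed (rule t)
  have Em: "E i \<in> borel_measurable lebesgue" for i
    unfolding E_def[abs_def] by (intro borel_measurable_diff borel_measurable_times \<eta>m lm G continuous_loc_int cg)
      (auto simp: gs_def intro!: times_cont_diff_conv(3) continuous_loc_int cg kst)
  have FE_int: "set_integrable lebesgue Q (\<lambda>x. F x $ i * E i x)"
    and FE_bd: "\<bar>LINT x:Q|lebesgue. F x $ i * E i x\<bar> \<le> sqrt (a * (256 * t))" for i
    using sq_int_CS[OF F(1)[of i] Em[of i] Ql F(2)[folded Q_def] E_sq F(3)] t by auto
  \<comment> \<open>Data for the shift estimate: one component of the cutoff term without the factor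
    \<open>psi - psis\<close>. It inherits the energy of \<open>F\<close> multiplied by the squared
    slope of the cutoff.\<close>
  define H where "H i x = indicator Q x * (F x $ i * grad \<eta> x $ i)" for i x
  have cge: "continuous_on UNIV (\<lambda>x. grad \<eta> x $ i)" for i by (rule test_functionsD(5)[OF \<eta>(1)])
  have F_bdd_int: "set_integrable lebesgue Q (\<lambda>x. F x $ i * f x)" if f: "continuous_on UNIV f" for f i
  proof -
    obtain C where C: "\<And>x. x \<in> ball 0 (?n * R) \<Longrightarrow> \<bar>f x\<bar> \<le> C"
      using continuous_bounded_on_bounded_set[OF f bounded_ball[of 0 "?n * R"]] by metis
    have "sq_int Q f \<le> ennreal (C\<^sup>2 * R ^ CARD('n))"
      by (rule sq_int_bounded[OF _ Ql Qm]) (use C Qball R in auto)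
    from sq_int_CS(1)[OF F(1) lm[OF continuous_loc_int[OF f]] Ql F(2)[folded Q_def] this F(3)] R
    show ?thesis by simp
  qed
  have H_int: "integrable lebesgue (H i)" for i
    using F_bdd_int[OF cge[of i], of i] by (simp add: set_integrable_def H_def[abs_def])
  have H_sq: "sq_int Q (H i) \<le> ennreal (L\<^sup>2 * a)" for i
  proof -
    have "sq_int Q (H i) \<le> sq_int Q (\<lambda>x. grad \<eta> x $ i * F x $ i)"
      by (rule sq_int_mono) (simp add: H_def mult.commute)
    also have "\<dots> \<le> ennreal (L\<^sup>2 * a)"
      by (rule sq_int_bounded_mult[OF F(1) Ql F(2)[folded Q_def] F(3)]) (use \<eta>(3) in auto)
    finally show ?thesis .
  qed
  have shift: "\<bar>LINT x|lebesgue. H i x * (psi x - psi (x - z))\<bar> \<le> s * ?n * sqrt (L\<^sup>2 * a * b)"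
    if z: "norm z \<le> s" for i z
  proof (rule shift_difference_bound[OF H_int _ _ Qb])
    show "H i x = 0" if "x \<notin> Q" for x using that by (simp add: H_def)
    show "Q \<subseteq> cball 0 (?n * R)" using Qball by force
    show "psi differentiable (at x)" for x by (rule dpsi)
    have "continuous_on UNIV (\<lambda>x. \<chi> i. grad psi x $ i)"
      unfolding gpsi by (intro continuous_on_vec_lambda cg)
    then show "continuous_on UNIV (grad psi)" by simp
    show "sq_int Q (H i) \<le> ennreal (L\<^sup>2 * a)" by (rule H_sq)
    fix z :: "real ^ 'n" and j assume z: "norm z \<le> s"
    have "sq_int Q (\<lambda>x. g j (x - z)) \<le> sq_int (ball 0 ((?n + 1) * R)) (g j)"
    proof (rule sq_int_shift)
      show "g j \<in> borel_measurable borel" by (rule borel_measurable_continuous_onI[OF cg])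
      fix x assume "x \<in> Q"
      then have "norm x < ?n * R" "norm z \<le> R" using rs Qball z by auto
      then show "x - z \<in> ball 0 ((?n + 1) * R)"
        using norm_triangle_ineq4[of x z] by (simp add: algebra_simps)
    qed simp
    also have "\<dots> \<le> sq_int (ball 0 ((?n + 1 + 1) * R)) (\<lambda>x. G x $ j)" unfolding g_def by (rule young_r[OF G])
    also have "\<dots> \<le> sq_int (ball 0 ((?n + 4) * R)) (\<lambda>x. G x $ j)" using ball_mono[of 2] by (simp add: add.assoc)
    also have "\<dots> \<le> ennreal b" by (rule Gb)
    finally show "sq_int Q (\<lambda>x. grad psi (x - z) $ j) \<le> ennreal b" unfolding gpsi .
  qed (use F(3) b z in auto)
  have H_bd: "\<bar>LINT x|lebesgue. H i x * (psi x - psis x)\<bar> \<le> s * ?n * sqrt (L\<^sup>2 * a * b)" for i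
    unfolding psis_def
  proof (rule integral_diff_conv_bound[OF H_int _ cpsi ks shift])
    show "H i x = 0" if "norm x > ?n * R" for x using that Qball by (auto simp: H_def indicator_def)
  qed
  have cpsis: "continuous_on UNIV psis"
    using dpsis by (auto intro!: differentiable_imp_continuous_on simp: differentiable_on_def differentiable_at_withinI)
  have FH_int: "set_integrable lebesgue Q (\<lambda>x. F x $ i * (grad \<eta> x $ i * (psi x - psis x)))" for i
    by (intro F_bdd_int continuous_intros cge cpsi cpsis)
  have FH_eq: "(LINT x:Q|lebesgue. F x $ i * (grad \<eta> x $ i * (psi x - psis x))) = (LINT x|lebesgue. H i x * (psi x - psis x))" for i
    unfolding set_lebesgue_integral_def H_def by (simp add: mult.assoc)
  have F\<phi>_int: "set_integrable lebesgue Q (\<lambda>x. F x $ i * grad \<phi> x $ i)" for i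
    by (rule F_bdd_int[OF test_functionsD(5)[OF \<phi>_test]])
  have "(LINT x:Q|lebesgue. F x \<bullet> grad \<phi> x) = 0"
    using div \<phi>_test by (simp add: distr_div_free_def Q_def)
  \<comment> \<open>The divergence condition annihilates only the sum over components, so the sum is
    kept until this term has cancelled.\<close>
  then have F\<phi>: "(\<Sum>i\<in>UNIV. LINT x:Q|lebesgue. F x $ i * grad \<phi> x $ i) = 0"
    unfolding inner_vec_def inner_real_def
    by (subst set_lebesgue_integral_sum[symmetric]) (auto intro: F\<phi>_int)
  have "(LINT x:Q|lebesgue. F x \<bullet> G x) = (LINT x:Q|lebesgue. \<Sum>i\<in>UNIV. F x $ i * E i x + F x $ i * grad \<phi> x $ i
      - F x $ i * (grad \<eta> x $ i * (psi x - psis x)))"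
    by (rule set_lebesgue_integral_cong[OF Ql])
      (auto simp: inner_vec_def E_def \<phi>_grad gpsi gpsis algebra_simps intro!: sum.cong)
  also have "\<dots> = (\<Sum>i\<in>UNIV. LINT x:Q|lebesgue. F x $ i * E i x + F x $ i * grad \<phi> x $ i
      - F x $ i * (grad \<eta> x $ i * (psi x - psis x)))"
    by (intro set_lebesgue_integral_sum set_integral_diff set_integral_add FE_int F\<phi>_int FH_int)
  also have "\<dots> = (\<Sum>i\<in>UNIV. (LINT x:Q|lebesgue. F x $ i * E i x) + (LINT x:Q|lebesgue. F x $ i * grad \<phi> x $ i)
      - (LINT x|lebesgue. H i x * (psi x - psis x)))"
    unfolding FH_eq[symmetric]
    by (intro sum.cong refl) (simp add: set_integral_diff set_integral_add FE_int F\<phi>_int FH_int)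
  also have "\<dots> = (\<Sum>i\<in>UNIV. (LINT x:Q|lebesgue. F x $ i * E i x) - (LINT x|lebesgue. H i x * (psi x - psis x)))"
    using F\<phi> by (simp add: sum.distrib sum_subtractf)
  finally have eq: "(LINT x:Q|lebesgue. F x \<bullet> G x) = (\<Sum>i\<in>UNIV. (LINT x:Q|lebesgue. F x $ i * E i x) - (LINT x|lebesgue. H i x * (psi x - psis x)))" .
  have "\<bar>LINT x:Q|lebesgue. F x \<bullet> G x\<bar> \<le> (\<Sum>i\<in>(UNIV :: 'n set). sqrt (a * (256 * t)) + s * ?n * sqrt (L\<^sup>2 * a * b))"
    unfolding eq
  proof (intro order_trans[OF sum_abs] sum_mono)
    fix i
    show "\<bar>(LINT x:Q|lebesgue. F x $ i * E i x) - (LINT x|lebesgue. H i x * (psi x - psis x))\<bar>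
       \<le> sqrt (a * (256 * t)) + s * ?n * sqrt (L\<^sup>2 * a * b)"
      using FE_bd[of i] H_bd[of i] by linarith
  qed
  then show ?thesis unfolding Q_def by (simp add: algebra_simps)
qed

text \<open>All parameters of the preceding bound depend on \<open>a\<close>,
  \<open>\<epsilon>\<close> and \<open>G\<close> alone, so a single threshold for \<open>R\<close>
  serves every field \<open>F\<close>. This uniformity is essential because the bound will be
  applied to fields that vary with \<open>R\<close>.\<close>

lemma gradient_pairing_small:
  fixes u :: "real ^ 'n \<Rightarrow> real" and G :: "real ^ 'n \<Rightarrow> real ^ 'n"
  assumes \<A>: "algebra_wmv \<A>" and w: "has_weak_gradient UNIV u G" and u: "loc_int u"
    and G: "\<And>i. (\<lambda>y. G y $ i) \<in> besicovitch 2 \<A>" and G0: "\<And>i. mean_ext 2 \<A> (\<lambda>y. G y $ i) = 0"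
    and a: "a > 0" and \<epsilon>: "\<epsilon> > 0"
  shows "\<forall>\<^sub>F R in at_top. \<forall>F :: real ^ 'n \<Rightarrow> real ^ 'n. (\<forall>i. (\<lambda>x. F x $ i) \<in> borel_measurable lebesgue) \<longrightarrow>
    (\<forall>i. sq_int (interior (cube R)) (\<lambda>x. F x $ i) \<le> ennreal (a * R ^ CARD('n))) \<longrightarrow>
    distr_div_free (interior (cube R)) F \<longrightarrow>
    \<bar>LINT x:interior (cube R)|lebesgue. F x \<bullet> G x\<bar> \<le> \<epsilon> * R ^ CARD('n)"
proof -
  let ?n = "real CARD('n)"
  note AB = algebra_wmvD(1)[OF \<A>]
  note GD = besicovitchD[OF G AB]
  define K where "K = (?n + 4) ^ CARD('n)"
  have K: "K > 0" by (simp add: K_def)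
  \<comment> \<open>Solves \<open>?n * sqrt (a * (256 * \<tau>)) = \<epsilon> / 2\<close>: the seven
    error terms together get half of the allowance.\<close>
  define \<tau> where "\<tau> = (\<epsilon> / (2 * ?n))\<^sup>2 / (256 * a)"
  have \<tau>: "\<tau> > 0" using a \<epsilon> by (simp add: \<tau>_def)
  \<comment> \<open>\<open>K\<close> converts a bound on the ball of radius
    \<open>(?n + 4) * R\<close> into one per \<open>R ^ CARD('n)\<close>. The factor 2 makes
    \<open>e * K\<close> equal to \<open>\<tau> / 2\<close>, which also bounds the squared mean
    value of the approximants.\<close>
  define e where "e = \<tau> / (2 * K)"
  have e: "e > 0" using \<tau> K by (simp add: e_def)
  have "\<forall>i. \<exists>v\<in>\<A>. asym_le (\<lambda>x. G x $ i - v x) e" using GD(5)[OF e] by blast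
  then obtain v where v: "\<And>i. v i \<in> \<A>" "\<And>i. asym_le (\<lambda>x. G x $ i - v i x) e" by metis
  have vB: "v i \<in> BUC" for i using v(1) AB by blast
  have "\<exists>V>0. \<forall>i. \<forall>x. \<bar>v i x\<bar> \<le> V"
    by (rule finite_uniform_bound[OF BUC_D(3)[OF vB]]) (auto intro: order_trans)
  then obtain V where V: "V > 0" "\<And>i x. \<bar>v i x\<bar> \<le> V" by blast
  have "\<tau> / V\<^sup>2 > 0" using \<tau> V by simp
  then obtain \<eta> :: "real ^ 'n \<Rightarrow> real" where \<eta>: "\<eta> \<in> test_functions (interior (cube 1))"
    "\<And>x. 0 \<le> \<eta> x \<and> \<eta> x \<le> 1" "(LINT x:cube 1|lebesgue. (1 - \<eta> x)\<^sup>2) \<le> \<tau> / V\<^sup>2"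
    using cutoff_exists[of "\<tau> / V\<^sup>2"] by blast
  have "\<exists>L>0. \<forall>i. \<forall>x. \<bar>grad \<eta> x $ i\<bar> \<le> L"
  proof (rule finite_uniform_bound)
    show "\<exists>d>0. \<forall>x. \<bar>grad \<eta> x $ i\<bar> \<le> d" for i
      using test_functions_bounded[OF grad_test_functions[OF \<eta>(1)], of i] by metis
  qed (auto intro: order_trans)
  then obtain L where L: "L > 0" "\<And>i x. \<bar>grad \<eta> x $ i\<bar> \<le> L" by blast
  have "\<exists>B>0. \<forall>i. asym_le (\<lambda>x. G x $ i) B"
  proof (rule finite_uniform_bound)
    show "\<exists>d>0. asym_le (\<lambda>x. G x $ i) d" for i
    proof -
      obtain d where "d \<ge> 0" "asym_le (\<lambda>x. G x $ i) d" using GD(3) by blast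
      then show ?thesis by (intro exI[of _ "d + 1"]) (auto intro: asym_le_mono)
    qed
  qed (rule asym_le_mono)
  then obtain B where B: "B > 0" "\<And>i. asym_le (\<lambda>x. G x $ i) B" by blast
  define b where "b = B * K"
  have b: "b > 0" using B K by (simp add: b_def)
  \<comment> \<open>The cost of the cutoff term per unit of \<open>\<delta>\<close> and of volume:
    the factor \<open>R\<close> in the scale \<open>\<delta> * R\<close> cancels against the slope
    \<open>L / R\<close>.\<close>
  define X where "X = ?n\<^sup>2 * L * sqrt (a * b)"
  have X: "X \<ge> 0" using L a b by (simp add: X_def)
  define \<delta> where "\<delta> = \<epsilon> / (2 * (X + \<epsilon>))"
  have \<delta>: "\<delta> > 0" "\<delta> \<le> 1" "\<delta> * X \<le> \<epsilon> / 2" using X \<epsilon> by (auto simp: \<delta>_def field_simps)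
  have "\<exists>r>0. \<forall>i. \<forall>x y. dist x y < r \<longrightarrow> \<bar>v i x - v i y\<bar> \<le> sqrt \<tau>"
  proof (rule finite_uniform_radius)
    show "\<exists>d>0. \<forall>x y. dist x y < d \<longrightarrow> \<bar>v i x - v i y\<bar> \<le> sqrt \<tau>" for i
    proof -
      have "sqrt \<tau> > 0" using \<tau> by simp
      then obtain d where "d > 0" "\<And>x y. dist y x < d \<Longrightarrow> dist (v i y) (v i x) < sqrt \<tau>"
        using BUC_D(2)[OF vB[of i]] unfolding uniformly_continuous_on_def by (metis UNIV_I)
      then show ?thesis by (intro exI[of _ d]) (auto simp: dist_real_def less_imp_le)
    qed
  qed (use less_le_trans in blast)
  then obtain d where d: "d > 0" "\<And>i x y. dist x y < d \<Longrightarrow> \<bar>v i x - v i y\<bar> \<le> sqrt \<tau>" by blast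
  \<comment> \<open>Halving \<open>d\<close> turns the strict inequality of uniform continuity into
    \<open>norm (x - y) \<le> r\<close>; the bound 1 ensures \<open>r \<le> R\<close>.\<close>
  define r where "r = min 1 (d / 2)"
  have r: "r > 0" "r \<le> 1" "r < d" using d(1) by (auto simp: r_def)
  obtain \<rho> :: "real ^ 'n \<Rightarrow> real" where \<rho>: "mollifier 1 \<rho>" using mollifier_exists by blast
  have kr: "mollifier r (rescale \<rho> r)" using mollifier_rescale[OF \<rho> r(1)] by simp
  have ev1: "\<forall>\<^sub>F R in at_top. \<forall>i. sq_int (ball 0 ((?n + 4) * R)) (\<lambda>x. G x $ i - v i x) \<le> ennreal (e * K * R ^ CARD('n))"
    unfolding K_def by (intro eventually_all_finite asym_le_scaled_ball v(2)) (simp add: add_pos_pos)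
  have ev2: "\<forall>\<^sub>F R in at_top. \<forall>i. sq_int (ball 0 ((?n + 4) * R)) (\<lambda>x. G x $ i) \<le> ennreal (b * R ^ CARD('n))"
    unfolding b_def K_def by (intro eventually_all_finite asym_le_scaled_ball B(2)) (simp add: add_pos_pos)
  have ev3: "\<forall>\<^sub>F R in at_top. \<forall>i. sq_int (cube R) (conv (v i) (rescale \<rho> (\<delta> * R))) \<le>
     ennreal (((mean_value (v i))\<^sup>2 + \<tau> / 2) * R ^ CARD('n))"
    using \<tau> by (intro eventually_all_finite smoothing_mean_value vB algebra_wmvD(5)[OF \<A> v(1)] \<rho> \<delta>) auto
  \<comment> \<open>The mean value zero belongs to \<open>G\<close>, not to its approximant. The
    quantitative comparison of mean values turns closeness of the functions into smallness
    here.\<close>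
  have mv: "(mean_value (v i))\<^sup>2 \<le> \<tau> / 2" for i
  proof -
    have "\<bar>mean_value (v i)\<bar> \<le> sqrt (e * ?n ^ CARD('n))"
      using mean_ext_limit(2)[OF \<A> G v(1) v(2)] G0 e by simp
    then have "\<bar>mean_value (v i)\<bar>\<^sup>2 \<le> (sqrt (e * ?n ^ CARD('n)))\<^sup>2" by (rule power_mono) simp
    also have "\<dots> = e * ?n ^ CARD('n)" using e by simp
    also have "\<dots> \<le> e * K" unfolding K_def using e by (intro mult_left_mono power_mono) auto
    also have "\<dots> = \<tau> / 2" using K by (simp add: e_def)
    finally show ?thesis by simp
  qed
  show ?thesis
    using ev1 ev2 ev3 eventually_ge_at_top[of 1]
  proof (eventually_elim, intro allI impI)
    fix R :: real and F :: "real ^ 'n \<Rightarrow> real ^ 'n"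
    assume h1: "\<forall>i. sq_int (ball 0 ((?n + 4) * R)) (\<lambda>x. G x $ i - v i x) \<le> ennreal (e * K * R ^ CARD('n))"
      and h2: "\<forall>i. sq_int (ball 0 ((?n + 4) * R)) (\<lambda>x. G x $ i) \<le> ennreal (b * R ^ CARD('n))"
      and h3: "\<forall>i. sq_int (cube R) (conv (v i) (rescale \<rho> (\<delta> * R))) \<le> ennreal (((mean_value (v i))\<^sup>2 + \<tau> / 2) * R ^ CARD('n))"
      and R1: "1 \<le> R" and Fm: "\<forall>i. (\<lambda>x. F x $ i) \<in> borel_measurable lebesgue"
      and Fb: "\<forall>i. sq_int (interior (cube R)) (\<lambda>x. F x $ i) \<le> ennreal (a * R ^ CARD('n))"
      and div: "distr_div_free (interior (cube R)) F"
    have R: "R > 0" using R1 by simp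
    define N where "N = R ^ CARD('n)"
    have N: "N > 0" using R by (simp add: N_def)
    define \<eta>R where "\<eta>R x = \<eta> ((1 / R) *\<^sub>R x)" for x
    have ks: "mollifier (\<delta> * R) (rescale \<rho> (\<delta> * R))"
      using mollifier_rescale[OF \<rho>, of "\<delta> * R"] \<delta> R by simp
    \<comment> \<open>Energies and errors are all proportional to \<open>N\<close>, and the cutoff
      dilated to \<open>cube R\<close> has slope \<open>L / R\<close>; both resulting terms are
      therefore proportional to \<open>N\<close>.\<close>
    have "\<bar>LINT x:interior (cube R)|lebesgue. F x \<bullet> G x\<bar> \<le>
      ?n * sqrt ((a * N) * (256 * (\<tau> * N))) + ?n * ((\<delta> * R) * ?n * sqrt ((L / R)\<^sup>2 * (a * N) * (b * N)))"
    proof (rule gradient_pairing_bound[OF w u GD(2) vB kr ks, where \<eta> = \<eta>R and \<omega> = "sqrt \<tau>"])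
      show "r \<le> R" "0 < r" "0 < \<delta> * R" "\<delta> * R \<le> R" using r R1 \<delta> by (auto simp: mult_left_le_one_le)
      show "\<eta>R \<in> test_functions (interior (cube R))"
        unfolding \<eta>R_def by (rule cutoff_scale(1)[OF \<eta>(1) R])
      show "0 \<le> \<eta>R x \<and> \<eta>R x \<le> 1" for x unfolding \<eta>R_def by (rule \<eta>(2))
      show "\<bar>grad \<eta>R x $ i\<bar> \<le> L / R" for x i
        unfolding \<eta>R_def[abs_def] cutoff_scale(2)[OF \<eta>(1) R]
        using L(2) R by (simp add: abs_mult divide_right_mono)
      show "(\<lambda>x. F x $ i) \<in> borel_measurable lebesgue" for i using Fm by blast
      show "sq_int (interior (cube R)) (\<lambda>x. F x $ i) \<le> ennreal (a * N)" for i using Fb by (simp add: N_def)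
      show "distr_div_free (interior (cube R)) F" by (rule div)
      show "sq_int (ball 0 ((?n + 4) * R)) (\<lambda>x. G x $ i - v i x) \<le> ennreal (\<tau> * N)" for i
      proof -
        have "e * K * N \<le> \<tau> * N" using \<tau> K N by (intro mult_right_mono) (auto simp: e_def)
        then show ?thesis using h1 unfolding N_def[symmetric] by (meson ennreal_leI order_trans)
      qed
      show "sq_int (interior (cube R)) (\<lambda>x. (1 - \<eta>R x) * v i x) \<le> ennreal (\<tau> * N)" for i
      proof -
        have m: "(\<lambda>x. 1 - \<eta>R x) \<in> borel_measurable lebesgue"
        proof -
          have "continuous_on UNIV (\<lambda>x. 1 - \<eta>R x)" unfolding \<eta>R_def
            by (intro continuous_intros continuous_on_compose2[OF test_functionsD(2)[OF \<eta>(1)]]) auto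
          from continuous_loc_int[OF this] show ?thesis by (simp add: loc_int_def)
        qed
        have "sq_int (cube R) (\<lambda>x. 1 - \<eta>R x) \<le> ennreal (N * (\<tau> / V\<^sup>2))"
          unfolding \<eta>R_def cutoff_scale(3)[OF \<eta>(1) R] N_def[symmetric]
          using \<eta>(3) N by (intro ennreal_leI mult_left_mono) auto
        then have "sq_int (interior (cube R)) (\<lambda>x. 1 - \<eta>R x) \<le> ennreal (N * (\<tau> / V\<^sup>2))"
          using sq_int_mono_set[OF interior_subset] order_trans by blast
        then have "sq_int (interior (cube R)) (\<lambda>x. v i x * (1 - \<eta>R x)) \<le> ennreal (V\<^sup>2 * (N * (\<tau> / V\<^sup>2)))"
          by (rule sq_int_bounded_mult[OF m cube_sets(4)]) (use N \<tau> V in auto)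
        then show ?thesis using V by (simp add: mult.commute)
      qed
      show "\<bar>v i x - v i y\<bar> \<le> sqrt \<tau>" if "norm (x - y) \<le> r" for i x y
        using that r(3) by (intro d(2)) (simp add: dist_norm)
      show "(sqrt \<tau>)\<^sup>2 * R ^ CARD('n) \<le> \<tau> * N" using \<tau> by (simp add: N_def)
      show "sq_int (interior (cube R)) (conv (v i) (rescale \<rho> (\<delta> * R))) \<le> ennreal (\<tau> * N)" for i
      proof -
        have "sq_int (interior (cube R)) (conv (v i) (rescale \<rho> (\<delta> * R))) \<le> sq_int (cube R) (conv (v i) (rescale \<rho> (\<delta> * R)))"
          by (rule sq_int_mono_set[OF interior_subset])
        also have "\<dots> \<le> ennreal (((mean_value (v i))\<^sup>2 + \<tau> / 2) * N)" using h3 unfolding N_def by blast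
        also have "\<dots> \<le> ennreal (\<tau> * N)" using mv[of i] N by (intro ennreal_leI mult_right_mono) auto
        finally show ?thesis .
      qed
      show "sq_int (ball 0 ((?n + 4) * R)) (\<lambda>x. G x $ i) \<le> ennreal (b * N)" for i using h2 by (simp add: N_def)
    qed (use a \<tau> N b in auto)
    also have "?n * sqrt ((a * N) * (256 * (\<tau> * N))) = \<epsilon> / 2 * N"
    proof -
      have "(a * N) * (256 * (\<tau> * N)) = (\<epsilon> / (2 * ?n) * N)\<^sup>2"
        using a by (simp add: \<tau>_def power2_eq_square field_simps)
      then have "sqrt ((a * N) * (256 * (\<tau> * N))) = \<epsilon> / (2 * ?n) * N"
        using \<epsilon> N by (simp only: real_sqrt_abs) (simp add: abs_mult)
      then show ?thesis by simp
    qed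
    also have "?n * ((\<delta> * R) * ?n * sqrt ((L / R)\<^sup>2 * (a * N) * (b * N))) = \<delta> * X * N"
    proof -
      have "(L / R)\<^sup>2 * (a * N) * (b * N) = (L / R * N)\<^sup>2 * (a * b)"
        by (simp add: power_mult_distrib power2_eq_square)
      then have "sqrt ((L / R)\<^sup>2 * (a * N) * (b * N)) = L / R * N * sqrt (a * b)"
        using L R N by (simp only: real_sqrt_mult real_sqrt_abs) (simp add: abs_mult)
      then show ?thesis using R by (simp add: X_def power2_eq_square)
    qed
    also have "\<epsilon> / 2 * N + \<delta> * X * N \<le> \<epsilon> / 2 * N + \<epsilon> / 2 * N"
      using \<delta>(3) N by (intro add_left_mono mult_right_mono) auto
    also have "\<dots> = \<epsilon> * R ^ CARD('n)" by (simp add: N_def)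
    finally show "\<bar>LINT x:interior (cube R)|lebesgue. F x \<bullet> G x\<bar> \<le> \<epsilon> * R ^ CARD('n)" .
  qed
qed


subsection \<open>Square integrable fields and the cube problems\<close>

text \<open>Measurability is demanded on the whole space, so that \<open>sq_int\<close> estimates
  apply directly; fields given only on \<open>S\<close> enter through their extension by
  zero.\<close>

definition L2_field :: "(real ^ 'n) set \<Rightarrow> (real ^ 'n \<Rightarrow> real ^ 'n) \<Rightarrow> bool" where
  "L2_field S V \<longleftrightarrow> (\<forall>i. (\<lambda>x. V x $ i) \<in> borel_measurable lebesgue) \<and>
     (\<exists>t\<ge>0. \<forall>i. sq_int S (\<lambda>x. V x $ i) \<le> ennreal t)"

lemma L2_fieldI:
  fixes V :: "real ^ 'n \<Rightarrow> real ^ 'n"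
  assumes "\<And>i. (\<lambda>x. V x $ i) \<in> borel_measurable lebesgue" "\<And>i. sq_int S (\<lambda>x. V x $ i) < \<infinity>"
  shows "L2_field S V"
proof -
  have "\<exists>t>0. \<forall>i. sq_int S (\<lambda>x. V x $ i) \<le> ennreal t"
  proof (rule finite_uniform_bound)
    fix i
    show "\<exists>t>0. sq_int S (\<lambda>x. V x $ i) \<le> ennreal t"
    proof (cases "sq_int S (\<lambda>x. V x $ i)")
      case (real t)
      then show ?thesis by (intro exI[of _ "t + 1"]) (auto intro: ennreal_leI)
    qed (use assms(2)[of i] in simp)
  next
    show "\<And>i d d'. sq_int S (\<lambda>x. V x $ i) \<le> ennreal d \<Longrightarrow> d \<le> d' \<Longrightarrow> sq_int S (\<lambda>x. V x $ i) \<le> ennreal d'"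
      using ennreal_leI order_trans by blast
  qed
  then show ?thesis using assms(1) by (auto simp: L2_field_def intro: less_imp_le)
qed

lemma L2_field_inner_integrable:
  fixes F V :: "real ^ 'n \<Rightarrow> real ^ 'n"
  assumes "L2_field S F" "L2_field S V" and S: "S \<in> sets lebesgue"
  shows "set_integrable lebesgue S (\<lambda>x. F x \<bullet> V x)"
proof -
  obtain s t where st: "s \<ge> 0" "t \<ge> 0" "\<And>i. sq_int S (\<lambda>x. F x $ i) \<le> ennreal s" "\<And>i. sq_int S (\<lambda>x. V x $ i) \<le> ennreal t"
    using assms(1,2) by (auto simp: L2_field_def)
  have "set_integrable lebesgue S (\<lambda>x. F x $ i * V x $ i)" for i
    using assms(1,2) by (intro sq_int_CS(1)[OF _ _ S st(3,4,1,2)]) (auto simp: L2_field_def)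
  then show ?thesis
    unfolding inner_vec_def set_integrable_def scaleR_sum_right
    by (intro Bochner_Integration.integrable_sum) (simp add: mult_ac)
qed

lemma L2_field_add:
  assumes "L2_field S F" "L2_field S V" and S: "S \<in> sets lebesgue"
  shows "L2_field S (\<lambda>x. F x + V x)"
proof -
  obtain s t where st: "s \<ge> 0" "t \<ge> 0" "\<And>i. sq_int S (\<lambda>x. F x $ i) \<le> ennreal s" "\<And>i. sq_int S (\<lambda>x. V x $ i) \<le> ennreal t"
    using assms(1,2) by (auto simp: L2_field_def)
  have "sq_int S (\<lambda>x. (F x + V x) $ i) \<le> ennreal (2 * s + 2 * t)" for i
    using sq_int_add[OF _ _ S st(3)[of i] st(4)[of i] st(1,2)] assms(1,2) by (simp add: L2_field_def)
  moreover have "(\<lambda>x. (F x + V x) $ i) \<in> borel_measurable lebesgue" for i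
    using assms(1,2) unfolding vector_add_component by (intro borel_measurable_add) (auto simp: L2_field_def)
  moreover have "2 * s + 2 * t \<ge> 0" using st by simp
  ultimately show ?thesis unfolding L2_field_def by blast
qed

lemma L2_field_uminus: "L2_field S V \<Longrightarrow> L2_field S (\<lambda>x. - V x)"
proof -
  assume V: "L2_field S V"
  have "sq_int S (\<lambda>x. (- V x) $ i) = sq_int S (\<lambda>x. V x $ i)" for i by (simp add: sq_int_def)
  then show ?thesis using V by (simp add: L2_field_def)
qed

lemma L2_field_diff:
  "L2_field S F \<Longrightarrow> L2_field S V \<Longrightarrow> S \<in> sets lebesgue \<Longrightarrow> L2_field S (\<lambda>x. F x - V x)"
  using L2_field_add[of S F "\<lambda>x. - V x"] L2_field_uminus[of S V] by simp

section \<open>Square integrability of sums, matrix products and basic fields\<close>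

lemma sq_int_sum:
  fixes f :: "'i \<Rightarrow> real ^ 'n \<Rightarrow> real"
  assumes "finite I" and S: "S \<in> sets lebesgue" and m: "\<And>i. i \<in> I \<Longrightarrow> f i \<in> borel_measurable lebesgue"
    and b: "\<And>i. i \<in> I \<Longrightarrow> sq_int S (f i) \<le> ennreal t" and t: "0 \<le> t"
  shows "sq_int S (\<lambda>x. \<Sum>i\<in>I. f i x) \<le> ennreal (4 ^ card I * t)"
  using assms(1) m b
proof (induction I rule: finite_induct)
  case empty
  then show ?case by (simp add: sq_int_def)
next
  case (insert i I)
  have "sq_int S (\<lambda>x. f i x + (\<Sum>i\<in>I. f i x)) \<le> ennreal (2 * t + 2 * (4 ^ card I * t))"
    by (rule sq_int_add[OF _ _ S]) (use insert t in auto)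
  also have "\<dots> \<le> ennreal (4 ^ card (insert i I) * t)"
  proof (rule ennreal_leI)
    have "t * 1 \<le> t * 4 ^ card I" using t by (intro mult_left_mono) auto
    then show "2 * t + 2 * (4 ^ card I * t) \<le> 4 ^ card (insert i I) * t"
      using insert by (simp add: algebra_simps)
  qed
  finally show ?case using insert by simp
qed

lemma sq_int_mat_vec:
  fixes A :: "real ^ 'n \<Rightarrow> real ^ 'n ^ 'n" and V :: "real ^ 'n \<Rightarrow> real ^ 'n"
  assumes A: "\<And>i j. (\<lambda>x. A x $ i $ j) \<in> borel_measurable lebesgue" "\<And>i j. AE x in lebesgue. \<bar>A x $ i $ j\<bar> \<le> C"
    and V: "\<And>i. (\<lambda>x. V x $ i) \<in> borel_measurable lebesgue" and S: "S \<in> sets lebesgue"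
    and b: "\<And>i. sq_int S (\<lambda>x. V x $ i) \<le> ennreal t" and t: "0 \<le> t"
  shows "sq_int S (\<lambda>x. (A x *v V x) $ i) \<le> ennreal (4 ^ CARD('n) * (C\<^sup>2 * t))"
    and "(\<lambda>x. (A x *v V x) $ i) \<in> borel_measurable lebesgue"
proof -
  have m: "(\<lambda>x. A x $ i $ j * V x $ j) \<in> borel_measurable lebesgue" for j
    by (intro borel_measurable_times A V)
  have "sq_int S (\<lambda>x. A x $ i $ j * V x $ j) \<le> ennreal (C\<^sup>2 * t)" for j
    by (rule sq_int_bounded_mult[OF V S b t]) (use A(2)[of i j] in auto)
  then have "sq_int S (\<lambda>x. \<Sum>j\<in>UNIV. A x $ i $ j * V x $ j) \<le> ennreal (4 ^ CARD('n) * (C\<^sup>2 * t))"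
    by (intro sq_int_sum S m) (use t in auto)
  then show "sq_int S (\<lambda>x. (A x *v V x) $ i) \<le> ennreal (4 ^ CARD('n) * (C\<^sup>2 * t))"
    by (simp add: matrix_vector_mult_def)
  show "(\<lambda>x. (A x *v V x) $ i) \<in> borel_measurable lebesgue"
    unfolding matrix_vector_mult_def using m by simp
qed

lemma L2_field_mat_vec:
  fixes A :: "real ^ 'n \<Rightarrow> real ^ 'n ^ 'n" and V :: "real ^ 'n \<Rightarrow> real ^ 'n"
  assumes A: "\<And>i j. (\<lambda>x. A x $ i $ j) \<in> borel_measurable lebesgue" "\<And>i j. AE x in lebesgue. \<bar>A x $ i $ j\<bar> \<le> C"
    and V: "L2_field S V" and S: "S \<in> sets lebesgue"
  shows "L2_field S (\<lambda>x. A x *v V x)"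
proof -
  obtain t where t: "t \<ge> 0" "\<And>i. sq_int S (\<lambda>x. V x $ i) \<le> ennreal t" "\<And>i. (\<lambda>x. V x $ i) \<in> borel_measurable lebesgue"
    using V by (auto simp: L2_field_def)
  note * = sq_int_mat_vec[OF A t(3) S t(2,1)]
  have "0 \<le> 4 ^ CARD('n) * (C\<^sup>2 * t)" using t by simp
  then show ?thesis unfolding L2_field_def using * by blast
qed

lemma L2_field_const:
  assumes S: "S \<in> sets lebesgue" "emeasure lebesgue S < \<infinity>"
  shows "L2_field S (\<lambda>_. c :: real ^ 'n)"
proof (rule L2_fieldI)
  fix i
  have "sq_int S (\<lambda>x. c $ i) \<le> ennreal (\<bar>c $ i\<bar>\<^sup>2 * measure lebesgue S)"
    by (rule sq_int_bounded[OF _ S(1)]) (use S(2) emeasure_eq_ennreal_measure[of lebesgue S] in auto)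
  then show "sq_int S (\<lambda>x. c $ i) < \<infinity>" by (rule le_less_trans) simp
qed simp

lemma L2_field_test:
  fixes \<phi> :: "real ^ 'n \<Rightarrow> real"
  assumes \<phi>: "\<phi> \<in> test_functions \<Omega>" and S: "S \<in> sets lebesgue" "emeasure lebesgue S < \<infinity>"
  shows "L2_field S (grad \<phi>)"
proof (rule L2_fieldI)
  fix i
  show "(\<lambda>x. grad \<phi> x $ i) \<in> borel_measurable lebesgue"
    using continuous_loc_int[OF test_functionsD(5)[OF \<phi>]] by (simp add: loc_int_def)
  obtain B where "B > 0" "\<And>x. \<bar>grad \<phi> x $ i\<bar> \<le> B"
    using test_functions_bounded[OF grad_test_functions[OF \<phi>, of i]] by metis
  then have "sq_int S (\<lambda>x. grad \<phi> x $ i) \<le> ennreal (B\<^sup>2 * measure lebesgue S)"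
    by (intro sq_int_bounded[OF _ S(1)]) (use S(2) emeasure_eq_ennreal_measure[of lebesgue S] in auto)
  then show "sq_int S (\<lambda>x. grad \<phi> x $ i) < \<infinity>" by (rule le_less_trans) simp
qed

lemma L2_field_norm:
  fixes V :: "real ^ 'n \<Rightarrow> real ^ 'n"
  assumes V: "L2_field S V" and S: "S \<in> sets lebesgue"
  shows "set_integrable lebesgue S (\<lambda>x. (norm (V x))\<^sup>2)"
    and "sq_int S (\<lambda>x. V x $ i) \<le> ennreal (LINT x:S|lebesgue. (norm (V x))\<^sup>2)"
proof -
  show int: "set_integrable lebesgue S (\<lambda>x. (norm (V x))\<^sup>2)"
    using L2_field_inner_integrable[OF V V S] by (simp add: power2_norm_eq_inner)
  have "sq_int S (\<lambda>x. V x $ i) \<le> (\<integral>\<^sup>+x. ennreal (indicator S x *\<^sub>R (norm (V x))\<^sup>2) \<partial>lebesgue)"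
    unfolding sq_int_def
  proof (intro nn_integral_mono)
    fix x
    have "(V x $ i)\<^sup>2 \<le> (norm (V x))\<^sup>2"
      using component_le_norm_cart[of "V x" i] by (metis abs_le_square_iff abs_norm_cancel)
    then show "indicator S x * ennreal ((V x $ i)\<^sup>2) \<le> ennreal (indicator S x *\<^sub>R (norm (V x))\<^sup>2)"
      by (auto simp: indicator_def intro: ennreal_leI)
  qed
  also have "\<dots> = ennreal (LINT x:S|lebesgue. (norm (V x))\<^sup>2)"
    unfolding set_lebesgue_integral_def using int[unfolded set_integrable_def]
    by (intro nn_integral_eq_integral) auto
  finally show "sq_int S (\<lambda>x. V x $ i) \<le> ennreal (LINT x:S|lebesgue. (norm (V x))\<^sup>2)" .
qed

text \<open>Outside \<open>S\<close> a representative of a weak gradient may be arbitrary, even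
  nonmeasurable; multiplying by the indicator removes this ambiguity.\<close>

lemma Lp_on_L2_field:
  fixes W :: "real ^ 'n \<Rightarrow> real ^ 'n"
  assumes "Lp_on 2 S W"
  shows "L2_field S (\<lambda>x. indicator S x *\<^sub>R W x)"
proof (rule L2_fieldI)
  fix i
  have m: "(\<lambda>x. indicator S x *\<^sub>R W x) \<in> borel_measurable lebesgue"
    using assms by (simp add: Lp_on_def set_borel_measurable_def)
  have "(\<lambda>v :: real ^ 'n. v $ i) \<in> borel_measurable borel"
    by (intro borel_measurable_continuous_onI continuous_intros)
  from measurable_compose[OF m this]
  show "(\<lambda>x. (indicator S x *\<^sub>R W x) $ i) \<in> borel_measurable lebesgue" .
  have int: "set_integrable lebesgue S (\<lambda>x. (norm (W x))\<^sup>2)"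
    using assms by (simp add: Lp_on_def)
  have "sq_int S (\<lambda>x. (indicator S x *\<^sub>R W x) $ i) \<le> (\<integral>\<^sup>+x. ennreal (norm (indicator S x *\<^sub>R (norm (W x))\<^sup>2)) \<partial>lebesgue)"
    unfolding sq_int_def
  proof (intro nn_integral_mono)
    fix x
    have "(W x $ i)\<^sup>2 \<le> (norm (W x))\<^sup>2"
      using component_le_norm_cart[of "W x" i] by (metis abs_le_square_iff abs_norm_cancel)
    then show "indicator S x * ennreal (((indicator S x *\<^sub>R W x) $ i)\<^sup>2) \<le> ennreal (norm (indicator S x *\<^sub>R (norm (W x))\<^sup>2))"
      by (auto simp: indicator_def intro: ennreal_leI)
  qed
  also have "\<dots> < \<infinity>" using int unfolding set_integrable_def integrable_iff_bounded by blast
  finally show "sq_int S (\<lambda>x. (indicator S x *\<^sub>R W x) $ i) < \<infinity>" .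
qed

lemma set_lebesgue_integral_eqI:
  "(LINT x:S|M. f x) = (LINT x:S|M. g x)" if "\<And>x. x \<in> S \<Longrightarrow> f x = g x"
  unfolding set_lebesgue_integral_def
  by (rule Bochner_Integration.integral_cong) (use that in \<open>auto simp: indicator_def\<close>)

lemma L2_field_inner_bound:
  fixes F V :: "real ^ 'n \<Rightarrow> real ^ 'n"
  assumes F: "L2_field S F" "\<And>i. sq_int S (\<lambda>x. F x $ i) \<le> ennreal a" "0 \<le> a"
    and V: "L2_field S V" and S: "S \<in> sets lebesgue"
  shows "\<bar>LINT x:S|lebesgue. F x \<bullet> V x\<bar> \<le> real CARD('n) * sqrt (a * (LINT x:S|lebesgue. (norm (V x))\<^sup>2))"
proof -
  let ?e = "LINT x:S|lebesgue. (norm (V x))\<^sup>2"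
  have e: "?e \<ge> 0" by (auto simp: set_lebesgue_integral_def intro!: integral_nonneg_AE)
  have m: "(\<lambda>x. F x $ i) \<in> borel_measurable lebesgue" "(\<lambda>x. V x $ i) \<in> borel_measurable lebesgue" for i
    using F(1) V by (auto simp: L2_field_def)
  note CS = sq_int_CS[OF m S F(2) L2_field_norm(2)[OF V S] F(3) e]
  have "(LINT x:S|lebesgue. F x \<bullet> V x) = (\<Sum>i\<in>UNIV. LINT x:S|lebesgue. F x $ i * V x $ i)"
    unfolding inner_vec_def inner_real_def by (rule set_lebesgue_integral_sum) (rule CS(1))
  also have "\<bar>\<dots>\<bar> \<le> (\<Sum>i\<in>(UNIV :: 'n set). sqrt (a * ?e))"
    by (intro order_trans[OF sum_abs] sum_mono CS(2))
  finally show ?thesis by simp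
qed

text \<open>The distributional condition covers test functions only. Pairing with a square
  integrable \<open>F\<close> is continuous in the gradient, so the vanishing passes to limits of
  test functions in the Sobolev norm.\<close>

lemma H1_0_orthogonal:
  fixes u :: "real ^ 'n \<Rightarrow> real"
  assumes u: "u \<in> H1_0 \<Omega>" and \<Omega>: "\<Omega> \<in> sets lebesgue" "emeasure lebesgue \<Omega> < \<infinity>"
    and F: "L2_field \<Omega> F" and div: "distr_div_free \<Omega> F"
  shows "(LINT x:\<Omega>|lebesgue. F x \<bullet> weak_gradient \<Omega> u x) = 0"
proof -
  define W where "W x = indicator \<Omega> x *\<^sub>R weak_gradient \<Omega> u x" for x
  have "Lp_on 2 \<Omega> (weak_gradient \<Omega> u)" using u by (auto simp: H1_0_def H1_def)
  then have W: "L2_field \<Omega> W" unfolding W_def[abs_def] by (rule Lp_on_L2_field)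
  obtain \<phi> where \<phi>: "\<And>n. \<phi> n \<in> test_functions \<Omega>" and lim: "(\<lambda>n. (LINT x:\<Omega>|lebesgue. (u x - \<phi> n x)\<^sup>2) +
          (LINT x:\<Omega>|lebesgue. (norm (weak_gradient \<Omega> u x - grad (\<phi> n) x))\<^sup>2)) \<longlonglongrightarrow> 0"
    using u by (auto simp: H1_0_def)
  define e where "e n = (LINT x:\<Omega>|lebesgue. (norm (W x - grad (\<phi> n) x))\<^sup>2)" for n
  have e_eq: "e n = (LINT x:\<Omega>|lebesgue. (norm (weak_gradient \<Omega> u x - grad (\<phi> n) x))\<^sup>2)" for n
    unfolding e_def by (rule set_lebesgue_integral_eqI) (simp add: W_def)
  have e0: "e n \<ge> 0" for n unfolding e_def by (auto simp: set_lebesgue_integral_def intro!: integral_nonneg_AE)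
  have e_lim: "e \<longlonglongrightarrow> 0"
  proof (rule tendsto_sandwich[OF _ _ tendsto_const lim])
    have "(LINT x:\<Omega>|lebesgue. (u x - \<phi> n x)\<^sup>2) \<ge> 0" for n
      by (auto simp: set_lebesgue_integral_def intro!: integral_nonneg_AE)
    then show "\<forall>\<^sub>F n in sequentially. e n \<le> (LINT x:\<Omega>|lebesgue. (u x - \<phi> n x)\<^sup>2) +
          (LINT x:\<Omega>|lebesgue. (norm (weak_gradient \<Omega> u x - grad (\<phi> n) x))\<^sup>2)"
      unfolding e_eq by simp
  qed (use e0 in simp)
  obtain a where a: "a \<ge> 0" "\<And>i. sq_int \<Omega> (\<lambda>x. F x $ i) \<le> ennreal a" using F by (auto simp: L2_field_def)
  have bd: "\<bar>LINT x:\<Omega>|lebesgue. F x \<bullet> W x\<bar> \<le> real CARD('n) * sqrt (a * e n)" for n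
  proof -
    note g = L2_field_test[OF \<phi> \<Omega>]
    have "(LINT x:\<Omega>|lebesgue. F x \<bullet> (W x - grad (\<phi> n) x)) = (LINT x:\<Omega>|lebesgue. F x \<bullet> W x) - (LINT x:\<Omega>|lebesgue. F x \<bullet> grad (\<phi> n) x)"
      unfolding inner_diff_right
      by (rule set_integral_diff(2)) (intro L2_field_inner_integrable F W g \<Omega>)+
    also have "(LINT x:\<Omega>|lebesgue. F x \<bullet> grad (\<phi> n) x) = 0" using div \<phi> by (simp add: distr_div_free_def)
    finally show ?thesis
      using L2_field_inner_bound[OF F a(2,1) L2_field_diff[OF W g \<Omega>(1)] \<Omega>(1), of n] by (simp add: e_def)
  qed
  have "(\<lambda>n. real CARD('n) * sqrt (a * e n)) \<longlonglongrightarrow> real CARD('n) * sqrt (a * 0)"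
    by (intro tendsto_intros e_lim)
  then have "\<bar>LINT x:\<Omega>|lebesgue. F x \<bullet> W x\<bar> \<le> 0"
    by (intro LIMSEQ_le_const[of "\<lambda>n. real CARD('n) * sqrt (a * e n)"]) (use bd in auto)
  then have "(LINT x:\<Omega>|lebesgue. F x \<bullet> W x) = 0" by simp
  moreover have "(LINT x:\<Omega>|lebesgue. F x \<bullet> W x) = (LINT x:\<Omega>|lebesgue. F x \<bullet> weak_gradient \<Omega> u x)"
    by (rule set_lebesgue_integral_eqI) (simp add: W_def)
  ultimately show ?thesis by simp
qed

text \<open>The equation is tested with its own solution, as encoded in \<open>orth\<close>:
  ellipticity bounds the quadratic term from below, and the source term is absorbed into half of it.
  The energy is thus proportional to the volume, with a constant independent of
  \<open>S\<close>.\<close>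

lemma energy_bound:
  fixes A :: "real ^ 'n \<Rightarrow> real ^ 'n ^ 'n" and W :: "real ^ 'n \<Rightarrow> real ^ 'n"
  assumes A: "\<And>i j. (\<lambda>x. A x $ i $ j) \<in> borel_measurable lebesgue" "\<And>i j. AE x in lebesgue. \<bar>A x $ i $ j\<bar> \<le> C"
    and \<alpha>: "\<alpha> > 0" and ell: "AE y in lebesgue. \<forall>l. \<alpha> * (norm l)\<^sup>2 \<le> (A y *v l) \<bullet> l"
    and S: "S \<in> sets lebesgue" "emeasure lebesgue S < \<infinity>" and W: "L2_field S W"
    and orth: "(LINT x:S|lebesgue. (A x *v (axis j 1 + W x)) \<bullet> W x) = 0"
  shows "(LINT x:S|lebesgue. (norm (W x))\<^sup>2) \<le> (real CARD('n) * C / \<alpha>)\<^sup>2 * measure lebesgue S"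
proof -
  let ?M = "real CARD('n) * C"
  note e = L2_field_const[OF S]
  note AW = L2_field_mat_vec[OF A W S(1)] and Ae = L2_field_mat_vec[OF A e S(1)]
  have i1: "set_integrable lebesgue S (\<lambda>x. (A x *v W x) \<bullet> W x)" by (rule L2_field_inner_integrable[OF AW W S(1)])
  have i2: "set_integrable lebesgue S (\<lambda>x. (A x *v axis j 1) \<bullet> W x)" by (rule L2_field_inner_integrable[OF Ae W S(1)])
  note i3 = L2_field_norm(1)[OF W S(1)]
  have sum0: "(LINT x:S|lebesgue. (A x *v axis j 1) \<bullet> W x) + (LINT x:S|lebesgue. (A x *v W x) \<bullet> W x) = 0"
    using orth set_integral_add(2)[OF i2 i1] by (simp add: matrix_vector_right_distrib inner_add_left)
  have col: "AE x in lebesgue. norm (A x *v axis j 1) \<le> ?M"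
  proof -
    have "AE x in lebesgue. \<forall>i. \<bar>A x $ i $ j\<bar> \<le> C" using A(2) by (simp add: AE_all_countable)
    then show ?thesis
    proof eventually_elim
      fix x assume "\<forall>i. \<bar>A x $ i $ j\<bar> \<le> C"
      moreover have "norm (A x *v axis j 1) \<le> (\<Sum>i\<in>UNIV. \<bar>A x $ i $ j\<bar>)"
        using norm_le_l1_cart[of "A x *v axis j 1"] by (simp add: matrix_vector_mult_basis column_def)
      moreover have "(\<Sum>i\<in>UNIV. \<bar>A x $ i $ j\<bar>) \<le> (\<Sum>i\<in>(UNIV :: 'n set). C)" using calculation by (intro sum_mono) auto
      ultimately show "norm (A x *v axis j 1) \<le> ?M" by simp
    qed
  qed
  have i4: "set_integrable lebesgue S (\<lambda>x. (\<alpha> / 2) * (norm (W x))\<^sup>2)"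
    using i3 by (rule set_integrable_mult_right)
  have "AE x in lebesgue. indicator S x *\<^sub>R ((\<alpha> / 2) * (norm (W x))\<^sup>2) \<le>
      indicator S x *\<^sub>R ((A x *v W x) \<bullet> W x + (A x *v axis j 1) \<bullet> W x + ?M\<^sup>2 / (2 * \<alpha>))"
    using ell col
  proof eventually_elim
    fix x assume h: "\<forall>l. \<alpha> * (norm l)\<^sup>2 \<le> (A x *v l) \<bullet> l" "norm (A x *v axis j 1) \<le> ?M"
    have "- ((A x *v axis j 1) \<bullet> W x) \<le> norm (A x *v axis j 1) * norm (W x)"
      using Cauchy_Schwarz_ineq2[of "A x *v axis j 1" "W x"] by linarith
    also have "\<dots> \<le> ?M * norm (W x)" using h(2) by (rule mult_right_mono) simp
    \<comment> \<open>Young's inequality, weighted to leave exactly half of the elliptic term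
      \<open>\<alpha> * (norm (W x))\<^sup>2\<close>.\<close>
    also have "\<dots> \<le> ?M\<^sup>2 / (2 * \<alpha>) + (\<alpha> / 2) * (norm (W x))\<^sup>2"
    proof -
      have "0 \<le> (?M - \<alpha> * norm (W x))\<^sup>2" by simp
      then have "2 * \<alpha> * (?M * norm (W x)) \<le> ?M\<^sup>2 + \<alpha>\<^sup>2 * (norm (W x))\<^sup>2"
        by (simp add: power2_diff power_mult_distrib algebra_simps)
      then show ?thesis using \<alpha> by (simp add: field_simps power2_eq_square)
    qed
    finally have "(\<alpha> / 2) * (norm (W x))\<^sup>2 \<le> (A x *v W x) \<bullet> W x + (A x *v axis j 1) \<bullet> W x + ?M\<^sup>2 / (2 * \<alpha>)"
      using h(1)[rule_format, of "W x"] by (simp add: field_simps)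
    then show "indicator S x *\<^sub>R ((\<alpha> / 2) * (norm (W x))\<^sup>2) \<le>
      indicator S x *\<^sub>R ((A x *v W x) \<bullet> W x + (A x *v axis j 1) \<bullet> W x + ?M\<^sup>2 / (2 * \<alpha>))"
      by (intro scaleR_left_mono) auto
  qed
  moreover have ic: "set_integrable lebesgue S (\<lambda>_. c :: real)" for c
    using S unfolding set_integrable_def by (intro integrable_scaleR_left integrable_real_indicator) auto
  ultimately have "(LINT x:S|lebesgue. (\<alpha> / 2) * (norm (W x))\<^sup>2) \<le>
      (LINT x:S|lebesgue. (A x *v W x) \<bullet> W x + (A x *v axis j 1) \<bullet> W x + ?M\<^sup>2 / (2 * \<alpha>))"
    unfolding set_lebesgue_integral_def
    using set_integral_add(1)[OF set_integral_add(1)[OF i1 i2] ic] i4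
    by (intro integral_mono_AE) (simp_all only: set_integrable_def)
  also have "\<dots> = ((LINT x:S|lebesgue. (A x *v W x) \<bullet> W x) + (LINT x:S|lebesgue. (A x *v axis j 1) \<bullet> W x)) +
      (LINT x:S|lebesgue. ?M\<^sup>2 / (2 * \<alpha>))"
    using set_integral_add(2)[OF set_integral_add(1)[OF i1 i2] ic] set_integral_add(2)[OF i1 i2] by simp
  also have "\<dots> = (LINT x:S|lebesgue. ?M\<^sup>2 / (2 * \<alpha>))" using sum0 by linarith
  also have "\<dots> = ?M\<^sup>2 / (2 * \<alpha>) * measure lebesgue S"
    by (simp add: set_lebesgue_integral_def)
  finally have "(\<alpha> / 2) * (LINT x:S|lebesgue. (norm (W x))\<^sup>2) \<le> ?M\<^sup>2 / (2 * \<alpha>) * measure lebesgue S" by simp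
  then have "(LINT x:S|lebesgue. (norm (W x))\<^sup>2) \<le> (?M\<^sup>2 / (2 * \<alpha>) * measure lebesgue S) / (\<alpha> / 2)"
    using \<alpha> by (simp add: field_simps)
  also have "\<dots> = (?M / \<alpha>)\<^sup>2 * measure lebesgue S" using \<alpha> by (simp add: field_simps power2_eq_square)
  finally show ?thesis .
qed

text \<open>The faces of the cube are negligible. This reconciles averages over the closed cube with
  Sobolev functions on its interior.\<close>

lemma cube_interior_integral:
  fixes f :: "real ^ 'n \<Rightarrow> 'b::euclidean_space"
  assumes "set_integrable lebesgue (interior (cube R)) f"
  shows "set_integrable lebesgue (cube R) f"
    and "(LINT x:cube R|lebesgue. f x) = (LINT x:interior (cube R)|lebesgue. f x)"
proof -
  have n: "negligible (cube R - interior (cube R :: (real ^ 'n) set))"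
    unfolding cube_def interior_cbox by (rule negligible_frontier_interval)
  have "interior (cube R :: (real ^ 'n) set) - cube R = {}" using interior_subset by blast
  then have e: "{x \<in> interior (cube R :: (real ^ 'n) set) - cube R. f x \<noteq> 0} = {}" by auto
  have n1: "negligible {x \<in> cube R - interior (cube R). f x \<noteq> 0}"
    by (rule negligible_subset[OF n]) auto
  have n2: "negligible {x \<in> interior (cube R) - cube R. f x \<noteq> 0}" unfolding e by simp
  show 1: "set_integrable lebesgue (cube R) f"
    using absolutely_integrable_spike_set_eq[OF n1 n2] assms by simp
  have "integral (cube R) f = integral (interior (cube R)) f"
    by (rule integral_spike_set[OF n1 n2])
  then show "(LINT x:cube R|lebesgue. f x) = (LINT x:interior (cube R)|lebesgue. f x)"
    using set_lebesgue_integral_eq_integral(2)[OF 1] set_lebesgue_integral_eq_integral(2)[OF assms] by simp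
qed

section \<open>Correctors and divergence free fields on subdomains\<close>

lemma corrector_facts:
  fixes chi :: "real ^ 'n \<Rightarrow> real"
  assumes "is_corrector \<A> A j chi"
  shows "has_weak_gradient UNIV chi (weak_gradient UNIV chi)" "loc_int chi"
    "(\<lambda>y. weak_gradient UNIV chi y $ i) \<in> besicovitch 2 \<A>"
    "mean_ext 2 \<A> (\<lambda>y. weak_gradient UNIV chi y $ i) = 0"
    "distr_div_free UNIV (\<lambda>y. A y *v (axis j 1 + weak_gradient UNIV chi y))"
proof -
  have H: "chi \<in> H1_loc" using assms by (simp add: is_corrector_def)
  then obtain G where "has_weak_gradient UNIV chi G" by (auto simp: H1_loc_def)
  then show "has_weak_gradient UNIV chi (weak_gradient UNIV chi)"
    unfolding weak_gradient_def by (rule someI[of "has_weak_gradient UNIV chi"])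
  have L: "Lp_loc 2 UNIV chi" using H by (simp add: H1_loc_def)
  show "loc_int chi" by (rule sq_int_loc_int[OF Lp_loc_2D[OF L]])
qed (use assms in \<open>auto simp: is_corrector_def\<close>)

text \<open>A test function on \<open>\<Omega>\<close> is one on the whole space, and its gradient
  vanishes outside \<open>\<Omega>\<close>, so the two pairings are the same number.\<close>

lemma distr_div_free_subset:
  fixes F :: "real ^ 'n \<Rightarrow> real ^ 'n"
  assumes "distr_div_free UNIV F"
  shows "distr_div_free \<Omega> F"
  unfolding distr_div_free_def
proof
  fix \<phi> :: "real ^ 'n \<Rightarrow> real" assume \<phi>: "\<phi> \<in> test_functions \<Omega>"
  then obtain K where K: "K \<subseteq> \<Omega>" "\<And>x. x \<notin> K \<Longrightarrow> grad \<phi> x = 0"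
    using test_functions_supp by metis
  then have g0: "grad \<phi> x = 0" if "x \<notin> \<Omega>" for x using that by blast
  have "(LINT x:UNIV|lebesgue. F x \<bullet> grad \<phi> x) = 0"
    using assms \<phi> test_functions_mono[of \<Omega> UNIV] by (auto simp: distr_div_free_def)
  moreover have "(LINT x:UNIV|lebesgue. F x \<bullet> grad \<phi> x) = (LINT x:\<Omega>|lebesgue. F x \<bullet> grad \<phi> x)"
    unfolding set_lebesgue_integral_def
    by (rule Bochner_Integration.integral_cong) (use g0 in \<open>auto simp: indicator_def\<close>)
  ultimately show "(LINT x:\<Omega>|lebesgue. F x \<bullet> grad \<phi> x) = 0" by simp
qed

lemma distr_div_free_cong:
  fixes F :: "real ^ 'n \<Rightarrow> real ^ 'n"
  assumes "distr_div_free \<Omega> F" "\<And>x. x \<in> \<Omega> \<Longrightarrow> H x = F x"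
  shows "distr_div_free \<Omega> H"
proof -
  have "(LINT x:\<Omega>|lebesgue. H x \<bullet> grad \<phi> x) = (LINT x:\<Omega>|lebesgue. F x \<bullet> grad \<phi> x)" for \<phi>
    by (rule set_lebesgue_integral_eqI) (simp add: assms(2))
  then show ?thesis using assms(1) by (simp add: distr_div_free_def)
qed

lemma distr_div_free_diff:
  fixes F H :: "real ^ 'n \<Rightarrow> real ^ 'n"
  assumes "distr_div_free \<Omega> F" "distr_div_free \<Omega> H" "L2_field \<Omega> F" "L2_field \<Omega> H"
    and \<Omega>: "\<Omega> \<in> sets lebesgue" "emeasure lebesgue \<Omega> < \<infinity>"
  shows "distr_div_free \<Omega> (\<lambda>x. F x - H x)"
  unfolding distr_div_free_def
proof
  fix \<phi> :: "real ^ 'n \<Rightarrow> real" assume \<phi>: "\<phi> \<in> test_functions \<Omega>"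
  note g = L2_field_test[OF \<phi> \<Omega>]
  show "(LINT x:\<Omega>|lebesgue. (F x - H x) \<bullet> grad \<phi> x) = 0"
    unfolding inner_diff_left
    using set_integral_diff(2)[OF L2_field_inner_integrable[OF assms(3) g \<Omega>(1)] L2_field_inner_integrable[OF assms(4) g \<Omega>(1)]]
      assms(1,2) \<phi> by (simp add: distr_div_free_def)
qed

lemma symmetric_mat_vec_inner:
  fixes A :: "real ^ 'n ^ 'n"
  assumes "transpose A = A"
  shows "(A *v x) \<bullet> y = (A *v y) \<bullet> x"
  by (metis assms dot_lmul_matrix inner_commute transpose_matrix_vector)

lemma besicovitch_sq_int_cube:
  fixes f :: "real ^ 'n \<Rightarrow> real"
  assumes f: "f \<in> besicovitch 2 \<A>" and \<A>: "\<A> \<subseteq> BUC"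
  shows "\<exists>b>0. \<forall>\<^sub>F R in at_top. sq_int (interior (cube R)) f \<le> ennreal (b * R ^ CARD('n))"
proof -
  obtain a where a: "a \<ge> 0" "asym_le f a" using besicovitchD(3)[OF f \<A>] by blast
  let ?b = "a * real CARD('n) ^ CARD('n)"
  have n: "real CARD('n) > 0" by simp
  have "\<forall>\<^sub>F R in at_top. sq_int (interior (cube R)) f \<le> ennreal ((?b + 1) * R ^ CARD('n))"
    using asym_le_scaled_ball[OF a(2) n] eventually_gt_at_top[of 0]
  proof eventually_elim
    fix R :: real assume h: "sq_int (ball 0 (real CARD('n) * R)) f \<le> ennreal (?b * R ^ CARD('n))" "0 < R"
    have "sq_int (interior (cube R)) f \<le> sq_int (ball 0 (real CARD('n) * R)) f"
      using cube_subset_ball[OF h(2)] interior_subset by (intro sq_int_mono_set) blast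
    also have "\<dots> \<le> ennreal ((?b + 1) * R ^ CARD('n))"
      using h by (elim order_trans) (auto intro!: ennreal_leI mult_right_mono)
    finally show "sq_int (interior (cube R)) f \<le> ennreal ((?b + 1) * R ^ CARD('n))" .
  qed
  moreover have "?b + 1 > 0" using a by (simp add: add_nonneg_pos)
  ultimately show ?thesis by blast
qed


subsection \<open>Convergence of the approximate matrices\<close>

theorem theorem3p1:
  fixes \<A> :: "(real ^ 'n \<Rightarrow> real) set"
    and A :: "real ^ 'n \<Rightarrow> real ^ 'n ^ 'n"
    and \<alpha> \<beta> p :: real
    and chi :: "'n \<Rightarrow> real ^ 'n \<Rightarrow> real"
    and chi_R :: "real \<Rightarrow> 'n \<Rightarrow> real ^ 'n \<Rightarrow> real"
  assumes "algebra_wmv \<A>"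
    and "1 \<le> p" and "ergodic p \<A>"
    and "Linf A"
    and "AE y in lebesgue. transpose (A y) = A y"
    and "\<And>i j. (\<lambda>y. A y $ i $ j) \<in> besicovitch 2 \<A>"
    and "0 < \<alpha>" and "0 < \<beta>"
    and "AE y in lebesgue. \<forall>l. \<alpha> * (norm l)\<^sup>2 \<le> (A y *v l) \<bullet> l \<and> (A y *v l) \<bullet> l \<le> \<beta> * (norm l)\<^sup>2"
    and "\<And>j. is_corrector \<A> A j (chi j)"
    and "\<And>R j. 1 \<le> R \<Longrightarrow> solves_cube_problem A R j (chi_R R j)"
  shows "((\<lambda>R. approx_hom_matrix A R (chi_R R)) \<longlongrightarrow> hom_matrix \<A> A chi) at_top"
proof (intro vec_tendstoI)
  fix i j :: 'n

  \<comment> \<open>Coefficients, corrector gradients and their fluxes\<close>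
  note \<A> = assms(1) and sym = assms(5) and Abes = assms(6) and \<alpha> = assms(7)
  note AB = algebra_wmvD(1)[OF \<A>]
  have ell: "AE y in lebesgue. \<forall>l. \<alpha> * (norm l)\<^sup>2 \<le> (A y *v l) \<bullet> l"
    using assms(9) by eventually_elim blast
  have Am: "(\<lambda>x. A x $ k $ l) \<in> borel_measurable lebesgue" for k l by (rule besicovitchD(1)[OF Abes AB])
  obtain C0 where C0: "AE x in lebesgue. norm (A x) \<le> C0" using assms(4) by (auto simp: Linf_def)
  define C where "C = max C0 1"
  have C: "C > 0" by (simp add: C_def)
  have AC: "AE x in lebesgue. \<bar>A x $ k $ l\<bar> \<le> C" for k l
    using C0
  proof eventually_elim
    fix x assume "norm (A x) \<le> C0"
    moreover have "\<bar>A x $ k $ l\<bar> \<le> norm (A x)"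
      using Finite_Cartesian_Product.norm_nth_le[of "A x" k] Finite_Cartesian_Product.norm_nth_le[of "A x $ k" l] by simp
    ultimately show "\<bar>A x $ k $ l\<bar> \<le> C" by (simp add: C_def)
  qed
  define G where "G k = weak_gradient UNIV (chi k)" for k
  note cf = corrector_facts[OF assms(10), folded G_def]
  have Gl: "loc_int (\<lambda>y. G k y $ l)" for k l by (rule besicovitchD(2)[OF cf(3) AB])
  define P where "P k y = axis k 1 + G k y" for k y
  define F1 where "F1 k y = A y *v P k y" for k y
  have Pbes: "(\<lambda>y. P k y $ l) \<in> besicovitch 2 \<A>" for k l
    unfolding P_def vector_add_component
    by (intro besicovitch_add[OF \<A>] cf(3) besicovitch_algebra[OF \<A>] algebra_wmvD(4)[OF \<A>])
  have F1bes: "(\<lambda>y. F1 k y $ l) \<in> besicovitch 2 \<A>" for k l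
    unfolding F1_def matrix_vector_mult_def vec_lambda_beta
    by (intro besicovitch_sum[OF \<A>] besicovitch_mult[OF \<A> Abes Pbes AC])
  \<comment> \<open>Column \<open>j\<close> of \<open>grad_matrix\<close> is the gradient of the
    \<open>j\<close>-th corrector, so this entry is component \<open>i\<close> of the flux
    \<open>A\<close> applied to \<open>P j\<close>.\<close>
  have hom: "hom_matrix \<A> A chi $ i $ j = mean_ext 2 \<A> (\<lambda>y. F1 j y $ i)"
  proof -
    have "(A y ** (mat 1 + grad_matrix UNIV chi y)) $ i $ j = F1 j y $ i" for y
      unfolding matrix_matrix_mult_def F1_def matrix_vector_mult_def P_def
      by (simp add: mat_def grad_matrix_def axis_def G_def eq_commute)
    then show ?thesis by (simp add: hom_matrix_def)
  qed
  define Q :: "real \<Rightarrow> (real ^ 'n) set" where "Q R = interior (cube R)" for R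
  have Ql: "Q R \<in> sets lebesgue" for R unfolding Q_def by (rule cube_sets)
  have Qc: "Q R \<subseteq> cube R" for R unfolding Q_def by (rule interior_subset)
  have Qm: "emeasure lebesgue (Q R) \<le> ennreal (R ^ CARD('n))" if "R \<ge> 0" for R
    using emeasure_mono[OF Qc cube_sets(3)] emeasure_cube[OF that, where 'n = 'n] by metis
  have Qf: "emeasure lebesgue (Q R) < \<infinity>" if "R \<ge> 0" for R
    using Qm[OF that] by (rule le_less_trans) simp
  have F1m: "(\<lambda>y. F1 k y $ l) \<in> borel_measurable lebesgue" for k l by (rule besicovitchD(1)[OF F1bes AB])
  \<comment> \<open>A common energy constant for the finitely many components, since the pairing
    estimate takes one bound for the whole field.\<close>
  have "\<exists>b>0. \<forall>l. \<forall>\<^sub>F R in at_top. sq_int (Q R) (\<lambda>y. f l y) \<le> ennreal (b * R ^ CARD('n))"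
    if f: "\<And>l. f l \<in> besicovitch 2 \<A>" for f :: "'n \<Rightarrow> real ^ 'n \<Rightarrow> real"
  proof (rule finite_uniform_bound)
    show "\<exists>b>0. \<forall>\<^sub>F R in at_top. sq_int (Q R) (f l) \<le> ennreal (b * R ^ CARD('n))" for l
      unfolding Q_def by (rule besicovitch_sq_int_cube[OF f AB])
    fix l b b'
    assume b: "\<forall>\<^sub>F R in at_top. sq_int (Q R) (f l) \<le> ennreal (b * R ^ CARD('n))" "(b :: real) \<le> b'"
    show "\<forall>\<^sub>F R in at_top. sq_int (Q R) (f l) \<le> ennreal (b' * R ^ CARD('n))"
      using b(1) eventually_ge_at_top[of 0]
    proof eventually_elim
      fix R :: real assume "sq_int (Q R) (f l) \<le> ennreal (b * R ^ CARD('n))" "0 \<le> R"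
      then show "sq_int (Q R) (f l) \<le> ennreal (b' * R ^ CARD('n))"
        using b(2) by (elim order_trans) (auto intro!: ennreal_leI mult_right_mono)
    qed
  qed
  note uni = this
  obtain a1 where a1: "a1 > 0" "\<And>l. \<forall>\<^sub>F R in at_top. sq_int (Q R) (\<lambda>y. F1 i y $ l) \<le> ennreal (a1 * R ^ CARD('n))"
    using uni[of "\<lambda>l y. F1 i y $ l"] F1bes by blast
  obtain a1' where a1': "a1' > 0" "\<And>l. \<forall>\<^sub>F R in at_top. sq_int (Q R) (\<lambda>y. F1 j y $ l) \<le> ennreal (a1' * R ^ CARD('n))"
    using uni[of "\<lambda>l y. F1 j y $ l"] F1bes by blast
  obtain g where g: "g > 0" "\<And>l. \<forall>\<^sub>F R in at_top. sq_int (Q R) (\<lambda>y. G j y $ l) \<le> ennreal (g * R ^ CARD('n))"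
    using uni[of "\<lambda>l y. G j y $ l"] cf(3) by blast
  obtain gi where gi: "gi > 0" "\<And>l. \<forall>\<^sub>F R in at_top. sq_int (Q R) (\<lambda>y. G i y $ l) \<le> ennreal (gi * R ^ CARD('n))"
    using uni[of "\<lambda>l y. G i y $ l"] cf(3) by blast
  \<comment> \<open>Extension by zero of the cube solution's gradient, whose chosen representative
    is meaningful only on \<open>Q R\<close>.\<close>
  define W where "W R x = indicator (Q R) x *\<^sub>R weak_gradient (Q R) (chi_R R j) x" for R x
  define cW where "cW = (real CARD('n) * C / \<alpha>)\<^sup>2"
  \<comment> \<open>Mean energy of \<open>F2 R\<close>: \<open>cW\<close> for the cube solution and
    \<open>g\<close> for the corrector gradient combine with factors 2; multiplication by
    \<open>A\<close> contributes \<open>C\<^sup>2\<close> and a sum over \<open>CARD('n)\<close>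
    entries contributes \<open>4 ^ CARD('n)\<close>.\<close>
  define a2 where "a2 = 4 ^ CARD('n) * (C\<^sup>2 * (2 * cW + 2 * g))"
  have cW: "cW \<ge> 0" by (simp add: cW_def)
  have a2: "a2 > 0" using C g cW by (simp add: a2_def add_nonneg_pos)
  define F2 where "F2 R x = A x *v (W R x - G j x)" for R x
  have hyps: "\<forall>\<^sub>F R in at_top. (\<forall>l. sq_int (Q R) (\<lambda>y. F1 i y $ l) \<le> ennreal (a1 * R ^ CARD('n))) \<and>
    (\<forall>l. sq_int (Q R) (\<lambda>y. F1 j y $ l) \<le> ennreal (a1' * R ^ CARD('n))) \<and>
    (\<forall>l. sq_int (Q R) (\<lambda>y. G j y $ l) \<le> ennreal (g * R ^ CARD('n))) \<and>
    (\<forall>l. sq_int (Q R) (\<lambda>y. G i y $ l) \<le> ennreal (gi * R ^ CARD('n))) \<and> 1 \<le> R"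
    by (intro eventually_conj eventually_all_finite a1 a1' g gi eventually_ge_at_top)
  \<comment> \<open>Two pairings are used: \<open>F1 i\<close>, which is the same for all
    \<open>R\<close>, against \<open>G j\<close>, and \<open>F2 R\<close> against
    \<open>G i\<close>. Each contributes \<open>\<epsilon>\<close>.\<close>
  have key: "\<forall>\<^sub>F R in at_top. \<bar>approx_hom_matrix A R (chi_R R) $ i $ j -
     (LINT x:cube R|lebesgue. F1 j x $ i) / R ^ CARD('n)\<bar> \<le> 2 * \<epsilon>" if \<epsilon>: "\<epsilon> > 0" for \<epsilon>
    using gradient_pairing_small[OF \<A> cf(1) cf(2) cf(3) cf(4) a1(1) \<epsilon>, of j]
      gradient_pairing_small[OF \<A> cf(1) cf(2) cf(3) cf(4) a2 \<epsilon>, of i] hyps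
  proof eventually_elim
    fix R :: real
    let ?N = "R ^ CARD('n)"
    assume s1: "\<forall>F :: real ^ 'n \<Rightarrow> real ^ 'n. (\<forall>i. (\<lambda>x. F x $ i) \<in> borel_measurable lebesgue) \<longrightarrow>
        (\<forall>i. sq_int (interior (cube R)) (\<lambda>x. F x $ i) \<le> ennreal (a1 * ?N)) \<longrightarrow>
        distr_div_free (interior (cube R)) F \<longrightarrow> \<bar>LINT x:interior (cube R)|lebesgue. F x \<bullet> G j x\<bar> \<le> \<epsilon> * ?N"
      and s2: "\<forall>F :: real ^ 'n \<Rightarrow> real ^ 'n. (\<forall>i. (\<lambda>x. F x $ i) \<in> borel_measurable lebesgue) \<longrightarrow>
        (\<forall>i. sq_int (interior (cube R)) (\<lambda>x. F x $ i) \<le> ennreal (a2 * ?N)) \<longrightarrow>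
        distr_div_free (interior (cube R)) F \<longrightarrow> \<bar>LINT x:interior (cube R)|lebesgue. F x \<bullet> G i x\<bar> \<le> \<epsilon> * ?N"
      and h: "(\<forall>l. sq_int (Q R) (\<lambda>y. F1 i y $ l) \<le> ennreal (a1 * ?N)) \<and>
        (\<forall>l. sq_int (Q R) (\<lambda>y. F1 j y $ l) \<le> ennreal (a1' * ?N)) \<and>
        (\<forall>l. sq_int (Q R) (\<lambda>y. G j y $ l) \<le> ennreal (g * ?N)) \<and>
        (\<forall>l. sq_int (Q R) (\<lambda>y. G i y $ l) \<le> ennreal (gi * ?N)) \<and> 1 \<le> R"
    have R: "R \<ge> 1" "R > 0" "R \<ge> 0" using h by auto
    have N: "?N > 0" using R by simp
    note Qf = Qf[OF R(3)]
    have sol: "solves_cube_problem A R k (chi_R R k)" for k by (rule assms(11)[OF R(1)])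
    have L2: "L2_field (Q R) V" if "\<And>l. (\<lambda>y. V y $ l) \<in> borel_measurable lebesgue"
      "\<And>l. sq_int (Q R) (\<lambda>y. V y $ l) \<le> ennreal c" for V c
      by (rule L2_fieldI[OF that(1)]) (rule le_less_trans[OF that(2)], simp)
    have Gm: "(\<lambda>y. G k y $ l) \<in> borel_measurable lebesgue" for k l using Gl by (simp add: loc_int_def)
    have G2: "L2_field (Q R) (G j)" by (rule L2[OF Gm, of _ "g * ?N"]) (use h in blast)
    have G2i: "L2_field (Q R) (G i)" by (rule L2[OF Gm, of _ "gi * ?N"]) (use h in blast)
    have F12: "L2_field (Q R) (F1 i)" by (rule L2[OF F1m, of _ "a1 * ?N"]) (use h in blast)
    have F12j: "L2_field (Q R) (F1 j)" by (rule L2[OF F1m, of _ "a1' * ?N"]) (use h in blast)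
    note e2 = L2_field_const[OF Ql Qf]
    have P2: "L2_field (Q R) (P i)" and P2j: "L2_field (Q R) (P j)"
      unfolding P_def[abs_def] by (intro L2_field_add e2 G2 G2i Ql)+
    have inH: "chi_R R j \<in> H1_0 (Q R)" using sol by (simp add: solves_cube_problem_def Q_def)
    then have "Lp_on 2 (Q R) (weak_gradient (Q R) (chi_R R j))" by (auto simp: H1_0_def H1_def)
    then have W2: "L2_field (Q R) (W R)" unfolding W_def[abs_def] by (rule Lp_on_L2_field)
    \<comment> \<open>The flux of the cube problem. On \<open>Q R\<close> it differs from the flux
      of the corrector by \<open>F2 R\<close>, so \<open>F2 R\<close> is divergence free there as
      the difference of two such fields.\<close>
    define PW where "PW x = A x *v (axis j 1 + W R x)" for x
    have PW2: "L2_field (Q R) PW"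
      unfolding PW_def[abs_def] by (intro L2_field_mat_vec[OF Am AC] L2_field_add e2 W2 Ql)
    have "distr_div_free (Q R) (\<lambda>y. A y *v (axis j 1 + weak_gradient (Q R) (chi_R R j) y))"
      using sol by (simp add: solves_cube_problem_def Q_def)
    then have PWdiv: "distr_div_free (Q R) PW"
      by (rule distr_div_free_cong) (simp add: PW_def W_def)
    have orthW: "(LINT x:Q R|lebesgue. F x \<bullet> W R x) = 0" if "L2_field (Q R) F" "distr_div_free (Q R) F" for F
    proof -
      have "(LINT x:Q R|lebesgue. F x \<bullet> W R x) = (LINT x:Q R|lebesgue. F x \<bullet> weak_gradient (Q R) (chi_R R j) x)"
        by (rule set_lebesgue_integral_eqI) (simp add: W_def)
      then show ?thesis using H1_0_orthogonal[OF inH Ql Qf that] by simp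
    qed
    have F1div: "distr_div_free (Q R) (F1 k)" for k
      using distr_div_free_subset[OF cf(5)] by (simp add: F1_def[abs_def] P_def)
    have energy: "(LINT x:Q R|lebesgue. (norm (W R x))\<^sup>2) \<le> cW * ?N"
    proof -
      have "(LINT x:Q R|lebesgue. (norm (W R x))\<^sup>2) \<le> cW * measure lebesgue (Q R)"
        unfolding cW_def
        by (rule energy_bound[OF Am AC \<alpha> ell Ql Qf W2]) (rule orthW[OF PW2 PWdiv, unfolded PW_def])
      also have "measure lebesgue (Q R) \<le> ?N"
        unfolding measure_def using Qm[OF R(3)] N by (intro enn2real_leI) auto
      finally show ?thesis using cW by (simp add: mult_left_mono)
    qed
    have Wb: "sq_int (Q R) (\<lambda>x. W R x $ l) \<le> ennreal (cW * ?N)" for l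
      using L2_field_norm(2)[OF W2 Ql] ennreal_leI[OF energy] by (rule order_trans)
    have Wm: "(\<lambda>x. W R x $ l) \<in> borel_measurable lebesgue" for l using W2 by (simp add: L2_field_def)
    have q2: "L2_field (Q R) (\<lambda>x. W R x - G j x)" by (rule L2_field_diff[OF W2 G2 Ql])
    have qm: "(\<lambda>x. (W R x - G j x) $ l) \<in> borel_measurable lebesgue" for l using q2 by (simp add: L2_field_def)
    have qb: "sq_int (Q R) (\<lambda>x. (W R x - G j x) $ l) \<le> ennreal ((2 * cW + 2 * g) * ?N)" for l
    proof -
      have "sq_int (Q R) (\<lambda>x. - G j x $ l) \<le> ennreal (g * ?N)" using h by (simp add: sq_int_def)
      then have "sq_int (Q R) (\<lambda>x. W R x $ l + - G j x $ l) \<le> ennreal (2 * (cW * ?N) + 2 * (g * ?N))"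
        by (intro sq_int_add[OF Wm _ Ql Wb]) (use Gm g cW N in auto)
      then show ?thesis by (simp add: algebra_simps)
    qed
    have F2m: "(\<lambda>x. F2 R x $ l) \<in> borel_measurable lebesgue"
      and F2b: "sq_int (Q R) (\<lambda>x. F2 R x $ l) \<le> ennreal (a2 * ?N)" for l
      using sq_int_mat_vec[OF Am AC qm Ql qb, of l] g cW N by (auto simp: F2_def a2_def mult.assoc)
    have F22: "L2_field (Q R) (F2 R)" by (rule L2[OF F2m F2b])
    have F2_eq: "F2 R x = PW x - F1 j x" for x
      unfolding F2_def PW_def F1_def P_def matrix_vector_mult_diff_distrib[symmetric] by simp
    have F2div: "distr_div_free (Q R) (F2 R)"
      using distr_div_free_diff[OF PWdiv F1div PW2 F12j Ql Qf] F2_eq by (metis (no_types, lifting) distr_div_free_cong)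
    have b1: "\<bar>LINT x:Q R|lebesgue. F1 i x \<bullet> G j x\<bar> \<le> \<epsilon> * ?N"
      using s1 h F1m F1div unfolding Q_def by blast
    have b2: "\<bar>LINT x:Q R|lebesgue. F2 R x \<bullet> G i x\<bar> \<le> \<epsilon> * ?N"
      using s2 F2m F2b F2div unfolding Q_def by blast
    have fl: "set_integrable lebesgue (Q R) (\<lambda>x. F2 R x $ i)"
      using L2_field_inner_integrable[OF F22 e2[of "axis i 1"] Ql] by (simp add: inner_axis)
    \<comment> \<open>Symmetry of \<open>A\<close> moves the matrix from \<open>W R - G j\<close>
      onto \<open>P i\<close>, producing the divergence free flux \<open>F1 i\<close>. Its pairing
      with \<open>W R\<close> vanishes by orthogonality on the cube.\<close>
    have ae: "AE x in lebesgue. F2 R x \<bullet> P i x = F1 i x \<bullet> W R x - F1 i x \<bullet> G j x"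
      using sym
    proof eventually_elim
      fix x assume "transpose (A x) = A x"
      from symmetric_mat_vec_inner[OF this, of "W R x - G j x" "P i x"]
      show "F2 R x \<bullet> P i x = F1 i x \<bullet> W R x - F1 i x \<bullet> G j x"
        by (simp add: F2_def F1_def inner_diff_right)
    qed
    have iFP: "set_integrable lebesgue (Q R) (\<lambda>x. F2 R x \<bullet> P i x)"
      and iFG: "set_integrable lebesgue (Q R) (\<lambda>x. F2 R x \<bullet> G i x)"
      and iFW: "set_integrable lebesgue (Q R) (\<lambda>x. F1 i x \<bullet> W R x)"
      and iF1G: "set_integrable lebesgue (Q R) (\<lambda>x. F1 i x \<bullet> G j x)"
      by (intro L2_field_inner_integrable F22 P2 G2i F12 W2 G2 Ql)+
    have "(LINT x:Q R|lebesgue. F2 R x \<bullet> P i x) = (LINT x:Q R|lebesgue. F1 i x \<bullet> W R x - F1 i x \<bullet> G j x)"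
      unfolding set_lebesgue_integral_def
    proof (rule integral_cong_AE)
      show "(\<lambda>x. indicat_real (Q R) x *\<^sub>R (F2 R x \<bullet> P i x)) \<in> borel_measurable lebesgue"
        using iFP unfolding set_integrable_def by (rule borel_measurable_integrable)
      show "(\<lambda>x. indicat_real (Q R) x *\<^sub>R (F1 i x \<bullet> W R x - F1 i x \<bullet> G j x)) \<in> borel_measurable lebesgue"
        using set_integral_diff(1)[OF iFW iF1G] unfolding set_integrable_def by (rule borel_measurable_integrable)
    qed (use ae in auto)
    also have "\<dots> = (LINT x:Q R|lebesgue. F1 i x \<bullet> W R x) - (LINT x:Q R|lebesgue. F1 i x \<bullet> G j x)"
      by (rule set_integral_diff(2)[OF iFW iF1G])
    also have "(LINT x:Q R|lebesgue. F1 i x \<bullet> W R x) = 0" by (rule orthW[OF F12 F1div])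
    finally have FP: "(LINT x:Q R|lebesgue. F2 R x \<bullet> P i x) = - (LINT x:Q R|lebesgue. F1 i x \<bullet> G j x)" by simp
    \<comment> \<open>The unit vector is \<open>P i - G i\<close>, so the wanted component splits
      into the pairing just computed and a second pairing with a mean-zero gradient.\<close>
    have "F2 R x $ i = F2 R x \<bullet> P i x - F2 R x \<bullet> G i x" for x
      by (simp add: P_def inner_add_right inner_axis)
    then have "(LINT x:Q R|lebesgue. F2 R x $ i) = (LINT x:Q R|lebesgue. F2 R x \<bullet> P i x) - (LINT x:Q R|lebesgue. F2 R x \<bullet> G i x)"
      using set_integral_diff(2)[OF iFP iFG] by simp
    then have small: "\<bar>LINT x:Q R|lebesgue. F2 R x $ i\<bar> \<le> 2 * \<epsilon> * ?N" using FP b1 b2 by linarith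
    have iF1: "set_integrable lebesgue (Q R) (\<lambda>x. F1 j x $ i)"
      using L2_field_inner_integrable[OF F12j e2[of "axis i 1"] Ql] by (simp add: inner_axis)
    have iPW: "set_integrable lebesgue (Q R) (\<lambda>x. PW x $ i)"
      using L2_field_inner_integrable[OF PW2 e2[of "axis i 1"] Ql] by (simp add: inner_axis)
    \<comment> \<open>The definition integrates a matrix-valued function. Taking an entry commutes
      with the Bochner integral only after integrability of the whole matrix is known, and this is
      assembled from the entries.\<close>
    have approx: "approx_hom_matrix A R (chi_R R) $ i $ j = (LINT x:Q R|lebesgue. PW x $ i) / ?N"
    proof -
      define M where "M y = A y ** (mat 1 + grad_matrix (Q R) (chi_R R) y)" for y
      have L2k: "L2_field (Q R) (\<lambda>y. A y *v (axis l 1 + indicator (Q R) y *\<^sub>R weak_gradient (Q R) (chi_R R l) y))" for l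
      proof -
        have "Lp_on 2 (Q R) (weak_gradient (Q R) (chi_R R l))"
          using sol[of l] by (auto simp: solves_cube_problem_def Q_def H1_0_def H1_def)
        then show ?thesis
          by (intro L2_field_mat_vec[OF Am AC] L2_field_add e2 Ql Lp_on_L2_field)
      qed
      have Mc: "M y $ k $ l = (A y *v (axis l 1 + indicator (Q R) y *\<^sub>R weak_gradient (Q R) (chi_R R l) y)) $ k"
        if "y \<in> Q R" for y k l
        using that unfolding M_def matrix_matrix_mult_def matrix_vector_mult_def
        by (simp add: mat_def grad_matrix_def axis_def eq_commute)
      have Mi: "integrable lebesgue (\<lambda>y. (indicator (Q R) y *\<^sub>R M y) $ k $ l)" for k l
      proof -
        have "set_integrable lebesgue (Q R) (\<lambda>y. (A y *v (axis l 1 + indicator (Q R) y *\<^sub>R weak_gradient (Q R) (chi_R R l) y)) $ k)"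
          using L2_field_inner_integrable[OF L2k e2[of "axis k 1"] Ql] by (simp add: inner_axis)
        moreover have "(\<lambda>y. (indicator (Q R) y *\<^sub>R M y) $ k $ l) =
          (\<lambda>y. indicator (Q R) y *\<^sub>R (A y *v (axis l 1 + indicator (Q R) y *\<^sub>R weak_gradient (Q R) (chi_R R l) y)) $ k)"
          using Mc by (auto simp: indicator_def)
        ultimately show ?thesis by (simp add: set_integrable_def)
      qed
      have Mi1: "integrable lebesgue (\<lambda>y. (indicator (Q R) y *\<^sub>R M y) $ k)" for k
        by (rule integrable_vecI) (rule Mi)
      have Mi2: "integrable lebesgue (\<lambda>y. indicator (Q R) y *\<^sub>R M y)"
      proof -
        have "integrable lebesgue (\<lambda>y. \<Sum>k\<in>UNIV. axis k ((indicator (Q R) y *\<^sub>R M y) $ k))"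
        proof (intro Bochner_Integration.integrable_sum)
          fix k
          have "bounded_linear (axis k :: real ^ 'n \<Rightarrow> real ^ 'n ^ 'n)"
            by (rule linear_conv_bounded_linear[THEN iffD1])
              (auto simp: linear_iff axis_def vec_eq_iff)
          from integrable_bounded_linear[OF this Mi1]
          show "integrable lebesgue (\<lambda>y. axis k ((indicator (Q R) y *\<^sub>R M y) $ k))" .
        qed
        moreover have "(\<Sum>k\<in>UNIV. axis k (X $ k)) = X" for X :: "real ^ 'n ^ 'n"
          by (simp add: vec_eq_iff axis_def sum_component if_distrib[of "\<lambda>f. f $ _"] cong: if_cong)
        ultimately show ?thesis by (simp only:)
      qed
      then have MQ: "set_integrable lebesgue (interior (cube R)) M" by (simp add: set_integrable_def Q_def)
      have "approx_hom_matrix A R (chi_R R) $ i $ j = (LINT y:Q R|lebesgue. M y) $ i $ j / ?N"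
        unfolding approx_hom_matrix_def measure_cube[OF R(3)]
        using cube_interior_integral(2)[OF MQ] by (simp add: M_def Q_def)
      also have "(LINT y:Q R|lebesgue. M y) $ i $ j = (LINT y|lebesgue. (indicator (Q R) y *\<^sub>R M y) $ i $ j)"
        unfolding set_lebesgue_integral_def integral_vec_nth[OF Mi, symmetric]
        using integral_bounded_linear[OF bounded_linear_vec_nth Mi2, of i] by (simp only:)
      also have "\<dots> = (LINT x:Q R|lebesgue. PW x $ i)"
        unfolding set_lebesgue_integral_def
        by (rule Bochner_Integration.integral_cong) (auto simp: indicator_def Mc PW_def W_def)
      finally show ?thesis .
    qed
    have "(LINT x:Q R|lebesgue. PW x $ i) - (LINT x:cube R|lebesgue. F1 j x $ i) = (LINT x:Q R|lebesgue. F2 R x $ i)"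
      using cube_interior_integral(2)[of R "\<lambda>x. F1 j x $ i"] iF1 set_integral_diff(2)[OF iPW iF1]
      by (simp add: Q_def F2_eq)
    then have "approx_hom_matrix A R (chi_R R) $ i $ j - (LINT x:cube R|lebesgue. F1 j x $ i) / ?N = (LINT x:Q R|lebesgue. F2 R x $ i) / ?N"
      unfolding approx by (simp add: diff_divide_distrib[symmetric])
    then show "\<bar>approx_hom_matrix A R (chi_R R) $ i $ j - (LINT x:cube R|lebesgue. F1 j x $ i) / ?N\<bar> \<le> 2 * \<epsilon>"
      using small N by (simp add: field_simps)
  qed
  have "((\<lambda>R. approx_hom_matrix A R (chi_R R) $ i $ j - (LINT x:cube R|lebesgue. F1 j x $ i) / R ^ CARD('n)) \<longlongrightarrow> 0) at_top"
  proof (rule tendstoI)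
    fix \<epsilon> :: real assume "\<epsilon> > 0"
    then show "\<forall>\<^sub>F R in at_top. dist (approx_hom_matrix A R (chi_R R) $ i $ j - (LINT x:cube R|lebesgue. F1 j x $ i) / R ^ CARD('n)) 0 < \<epsilon>"
      using key[of "\<epsilon> / 4"] by (auto elim!: eventually_mono simp: dist_real_def)
  qed
  \<comment> \<open>The cube averages of the corrector flux converge to its extended mean value,
    which is the required entry of the homogenized matrix.\<close>
  from tendsto_add[OF this mean_ext_limit(1)[OF \<A> F1bes[of j i]]]
  show "((\<lambda>R. approx_hom_matrix A R (chi_R R) $ i $ j) \<longlongrightarrow> hom_matrix \<A> A chi $ i $ j) at_top"
    unfolding hom by simp
qed

end
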